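(* Let $\alpha\ge0$ be real, $r\ge1$ an integer, $1\le s\le\infty$, $1\le p\le\infty$, $\mu>r+1-1/s$, and let $\theta>0$ be fixed with $\theta>\mu+1/s-1-r$. Then there are constants $0<c'\le c''$ not depending on $\delta$ such that for every $0<\delta<1$ $$c'\,\delta^{(\mu+1/s-1-r)/(\mu+1/s-1/p)}\le\mathcal{E}^r_\delta\bigl(W_s^\mu,\Psi,C,\ell_p\bigr)\le c''\,\delta^{(\mu+1/s-1-r)/(\mu+1/s-1/p)} .$$ Moreover, the upper bound is attained in order on every method of $\mathcal{S}^\theta$: for every array $\nu$ defining a method in $\mathcal{S}^\theta$ and all constants $0<a_1\le a_2$ there is a constant $c>0$, not depending on $\delta$ and $N$, such that for every $0<\delta<1$ and every integer $N\ge r$ with $a_1\delta^{-1/(\mu+1/s-1/p)}\le N\le a_2\delta^{-1/(\mu+1/s-1/p)}$ the recovery operator $\psi^N:\mathbf{y}\mapsto(S_N^\nu\mathbf{y})^{(r)}$ satisfies $$e_\delta\bigl(W_s^\mu,\psi^N G,C,\ell_p\bigr)\le c\,\delta^{(\mu+1/s-1-r)/(\mu+1/s-1/p)} .$$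
   Context: $w(t)=t^\alpha e^{-t}$ on $(0,\infty)$; $L_{2,w}$ is the Hilbert space of real-valued functions on $(0,\infty)$ square-summable with weight $w$, with $\langle f,g\rangle=\int_0^\infty w f g\,dt$. $L_k^{(\alpha)}$ are the Laguerre polynomials and $\ell_k^{(\alpha)}=(k!/\Gamma(k+\alpha+1))^{1/2}L_k^{(\alpha)}$, $k\in\mathbb{N}_0$, is the corresponding orthonormal system (a basis of $L_{2,w}$). $C$ is the space of all real-valued continuous functions on $(0,\infty)$ (not necessarily bounded), and $\|g\|_C=\sup_{t>0}|g(t)|\in[0,+\infty]$. Conventions: $1/\infty=0$. With $\underline{k}=\max\{1,k\}$: $\|f\|_{s,\mu}=\bigl(\sum_{k\ge0}\underline{k}^{s\mu}|\langle f,\ell_k^{(\alpha)}\rangle|^s\bigr)^{1/s}$ for $1\le s<\infty$, $\|f\|_{\infty,\mu}=\sup_{k\ge0}\underline{k}^{\mu}|\langle f,\ell_k^{(\alpha)}\rangle|$; here $W_s^\mu$ denotes the unit ball $\{f\in L_{2,w}:\|f\|_{s,\mu}\le1\}$. For $\mu>r+1-1/s$ each $f\in W_s^\mu$ is identified with its representative of class $C^r$ on $(0,\infty)$ (which exists), and $f^{(r)}$ is its $r$-th derivative. For a triangular array of real numbers $\nu=\{\nu_k^N\}$, $0\le k\le N$, $N\in\mathbb{N}$, put $S_N^\nu\mathbf{y}(t)=\sum_{k=0}^N\nu_k^N y_k\,\ell_k^{(\alpha)}(t)$. For $\theta>0$, $\mathcal{S}^\theta$ is the class of all such methods for which there is $C(\nu)>0$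 with $|1-\nu_k^N|\le C(\nu)(k/N)^\theta$ for all $N\in\mathbb{N}$, $0\le k\le N$ (with $0^\theta=0$). $G:L_{2,w}\to\ell_2$, $Gf=(\langle f,\ell_k^{(\alpha)}\rangle)_{k\in\mathbb{N}_0}$. A recovery operator is an arbitrary mapping $\psi:\ell_{\max\{p,2\}}\to C$ (no linearity or continuity is required); $\Psi$ is the set of all $\psi G$. The error is $$e_\delta(W_s^\mu,\psi G,C,\ell_p)=\sup_{f\in W_s^\mu}\ \sup_{\|\boldsymbol{\xi}\|_{\ell_p}\le\delta}\bigl\|\bigl(f^{(r)}-\psi(Gf+\boldsymbol{\xi})\bigr)\sqrt{w}\bigr\|_C ,$$ the inner supremum being over real sequences $\boldsymbol{\xi}$, and $\mathcal{E}^r_\delta(W_s^\mu,\Psi,C,\ell_p)=\inf_{\psi G\in\Psi}e_\delta(W_s^\mu,\psi G,C,\ell_p)$. *)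

theory Defs
  imports "HOL-Analysis.Analysis"
begin

text \<open>
  Functions on the half-line \<open>(0,\<infinity>)\<close> are represented by total functions \<open>real \<Rightarrow> real\<close>; only
  their values at \<open>t > 0\<close> ever matter. Exponents in \<open>[1,\<infinity>]\<close> and quantities that may be
  infinite have type \<^typ>\<open>ennreal\<close>.
\<close>

text \<open>The real number \<open>1/q\<close>, with \<open>1/\<infinity> = 0\<close>.\<close>

definition recip :: "ennreal \<Rightarrow> real" where
  "recip q = enn2real (1 / q)"

definition weight :: "real \<Rightarrow> real \<Rightarrow> real" where
  "weight \<alpha> t = t powr \<alpha> * exp (- t)"

text \<open>Elements of \<open>L2w\<close> are functions, not classes modulo null sets.\<close>

definition L2w :: "real \<Rightarrow> (real \<Rightarrow> real) set" where
  "L2w \<alpha> = {f. f \<in> borel_measurable (lebesgue_on {0<..}) \<and>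
               integrable (lebesgue_on {0<..}) (\<lambda>t. weight \<alpha> t * (f t)\<^sup>2)}"

definition inner_w :: "real \<Rightarrow> (real \<Rightarrow> real) \<Rightarrow> (real \<Rightarrow> real) \<Rightarrow> real" where
  "inner_w \<alpha> f g = (\<integral>t. weight \<alpha> t * f t * g t \<partial>lebesgue_on {0<..})"

definition Laguerre :: "real \<Rightarrow> nat \<Rightarrow> real \<Rightarrow> real" where
  "Laguerre \<alpha> k t = (\<Sum>i\<le>k. (-1) ^ i * ((real k + \<alpha>) gchoose (k - i)) * t ^ i / fact i)"

definition ell :: "real \<Rightarrow> nat \<Rightarrow> real \<Rightarrow> real" where
  "ell \<alpha> k t = sqrt (fact k / Gamma (real k + \<alpha> + 1)) * Laguerre \<alpha> k t"

definition coeffs_w :: "real \<Rightarrow> (real \<Rightarrow> real) \<Rightarrow> nat \<Rightarrow> real" where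
  "coeffs_w \<alpha> f = (\<lambda>k. inner_w \<alpha> f (ell \<alpha> k))"

definition lp_norm :: "ennreal \<Rightarrow> (nat \<Rightarrow> real) \<Rightarrow> ennreal" where
  "lp_norm p x =
    (if p = \<infinity> then (SUP k. ennreal \<bar>x k\<bar>)
     else if summable (\<lambda>k. \<bar>x k\<bar> powr enn2real p)
       then ennreal ((\<Sum>k. \<bar>x k\<bar> powr enn2real p) powr (1 / enn2real p))
     else \<infinity>)"

definition lp_space :: "ennreal \<Rightarrow> (nat \<Rightarrow> real) set" where
  "lp_space p = {x. lp_norm p x < \<infinity>}"

definition W_norm :: "real \<Rightarrow> ennreal \<Rightarrow> real \<Rightarrow> (real \<Rightarrow> real) \<Rightarrow> ennreal" where
  "W_norm \<alpha> s \<mu> f =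
    (if s = \<infinity> then (SUP k. ennreal (real (max 1 k) powr \<mu> * \<bar>coeffs_w \<alpha> f k\<bar>))
     else if summable (\<lambda>k. real (max 1 k) powr (enn2real s * \<mu>) * \<bar>coeffs_w \<alpha> f k\<bar> powr enn2real s)
       then ennreal ((\<Sum>k. real (max 1 k) powr (enn2real s * \<mu>) * \<bar>coeffs_w \<alpha> f k\<bar> powr enn2real s)
                       powr (1 / enn2real s))
     else \<infinity>)"

definition W_ball :: "real \<Rightarrow> ennreal \<Rightarrow> real \<Rightarrow> (real \<Rightarrow> real) set" where
  "W_ball \<alpha> s \<mu> = {f \<in> L2w \<alpha>. W_norm \<alpha> s \<mu> f \<le> 1}"

definition class_Cr :: "nat \<Rightarrow> (real \<Rightarrow> real) \<Rightarrow> bool" where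
  "class_Cr r g \<longleftrightarrow>
     (\<forall>k<r. \<forall>t>0. (deriv ^^ k) g differentiable (at t)) \<and>
     continuous_on {0<..} ((deriv ^^ r) g)"

text \<open>
  The \<open>r\<close>-th derivative of the representative of class \<open>C\<^sup>r\<close> of \<open>f\<close>. Two such representatives
  agree almost everywhere and are continuous, hence agree on \<open>(0,\<infinity>)\<close>, so there the choice made
  by \<open>SOME\<close> is immaterial.
\<close>

definition rderiv :: "nat \<Rightarrow> (real \<Rightarrow> real) \<Rightarrow> real \<Rightarrow> real" where
  "rderiv r f =
     (deriv ^^ r) (SOME g. class_Cr r g \<and> (AE t in lebesgue_on {0<..}. g t = f t))"

definition C_space :: "(real \<Rightarrow> real) set" where
  "C_space = {g. continuous_on {0<..} g}"

definition C_norm :: "(real \<Rightarrow> real) \<Rightarrow> ennreal" where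
  "C_norm g = (SUP t\<in>{0<..}. ennreal \<bar>g t\<bar>)"

text \<open>Arbitrary mappings \<open>\<psi>\<close> from \<open>lp_space (max p 2)\<close> to \<open>C_space\<close>; the error below evaluates
  \<open>\<psi>\<close> only on that space.\<close>

definition recovery_ops :: "ennreal \<Rightarrow> ((nat \<Rightarrow> real) \<Rightarrow> real \<Rightarrow> real) set" where
  "recovery_ops p = lp_space (max p 2) \<rightarrow> C_space"

definition recovery_error ::
  "real \<Rightarrow> nat \<Rightarrow> real \<Rightarrow> (real \<Rightarrow> real) set \<Rightarrow> ((nat \<Rightarrow> real) \<Rightarrow> real \<Rightarrow> real) \<Rightarrow> ennreal \<Rightarrow> ennreal" where
  "recovery_error \<alpha> r \<delta> W \<psi> p =
     (SUP f\<in>W. SUP \<xi>\<in>{\<xi>. lp_norm p \<xi> \<le> ennreal \<delta>}.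
        C_norm (\<lambda>t. (rderiv r f t - \<psi> (\<lambda>k. coeffs_w \<alpha> f k + \<xi> k) t) * sqrt (weight \<alpha> t)))"

definition optimal_error ::
  "real \<Rightarrow> nat \<Rightarrow> real \<Rightarrow> (real \<Rightarrow> real) set \<Rightarrow> ennreal \<Rightarrow> ennreal" where
  "optimal_error \<alpha> r \<delta> W p = (INF \<psi>\<in>recovery_ops p. recovery_error \<alpha> r \<delta> W \<psi> p)"

text \<open>An array \<open>\<nu>\<close> is indexed as \<open>\<nu> N k\<close>; only the entries with \<open>k \<le> N\<close> and \<open>N \<ge> 1\<close> are used.\<close>

definition S_op :: "real \<Rightarrow> (nat \<Rightarrow> nat \<Rightarrow> real) \<Rightarrow> nat \<Rightarrow> (nat \<Rightarrow> real) \<Rightarrow> real \<Rightarrow> real" where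
  "S_op \<alpha> \<nu> N y t = (\<Sum>k\<le>N. \<nu> N k * y k * ell \<alpha> k t)"

definition S_class :: "real \<Rightarrow> (nat \<Rightarrow> nat \<Rightarrow> real) set" where
  "S_class \<theta> = {\<nu>. \<exists>C>0. \<forall>N\<ge>1. \<forall>k\<le>N. \<bar>1 - \<nu> N k\<bar> \<le> C * (real k / real N) powr \<theta>}"

definition psi_S :: "real \<Rightarrow> nat \<Rightarrow> (nat \<Rightarrow> nat \<Rightarrow> real) \<Rightarrow> nat \<Rightarrow> (nat \<Rightarrow> real) \<Rightarrow> real \<Rightarrow> real" where
  "psi_S \<alpha> r \<nu> N y = (deriv ^^ r) (S_op \<alpha> \<nu> N y)"

end

theory Submission
  imports Defs "HOL-Complex_Analysis.Complex_Analysis"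
begin

text \<open>
  Everything rests on the bound \<open>\<bar>(deriv ^^ r) (ell \<alpha> k) t\<bar> * sqrt (weight \<alpha> t) \<le> C * (k + 1) ^ r\<close>, which is
  sharp at \<open>t \<approx> 1 / k\<close>. It follows from Cauchy's formula for the generating function
  \<open>(1 - z) powr (- a - 1) * exp (- t z / (1 - z))\<close> on the circle of radius \<open>1 - 1 / (n + 2)\<close>. The same
  generating function expands \<open>exp (- m t)\<close> into Laguerre polynomials, so a function orthogonal to all of
  them has vanishing moments in the variable \<open>exp (- t)\<close> and is zero; hence the \<open>C\<^sup>r\<close> representative of a
  function in the ball is its Laguerre series. With \<open>\<kappa> = \<mu> + 1/s - 1 - r\<close>, the tail of the series and the
  damping by \<open>\<nu>\<close> each cost \<open>N powr (- \<kappa>)\<close> and the noise costs \<open>\<delta> * N powr (r + 1 - 1/p)\<close>; the prescribed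
  \<open>N\<close> balances the two. For the lower bound, take two opposite multiples of \<open>\<Sum>k\<in>{N..<2*N}. ell \<alpha> k\<close>,
  evaluated at \<open>1 / (8 * N)\<close>, where all the \<open>r\<close>-th derivatives have the same sign.
\<close>


section \<open>Laguerre polynomials\<close>

text \<open>The exponent \<open>r\<close> in the key bound must be exact, because truncation,
  damping and noise all inherit it. Bounding Cauchy's integrand by its maximum would lose a factor
  n: the Poisson kernel reaches order n on that circle, while its mean is 1. So one Poisson kernel
  is split off, everything else is bounded pointwise, and the kernel is integrated exactly. It
  absorbs |1 - z|^(-2) out of the |1 - z|^(-r-1) that remains once the weight has cancelled the
  powers depending on \<open>\<alpha>\<close>. Hence nothing is lost for r \<ge> 1; order 0 gets
  exponent 1 instead, which suffices since it only serves convergence of the undifferentiated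
  series.

  The rate comes from d = \<mu> + 1/s - 1/p = \<kappa> + (r + 1 - 1/p): equating N^(-\<kappa>) with
  \<delta> N^(r + 1 - 1/p) means N = \<delta>^(-1/d), and the common value is \<delta>^(\<kappa>/d).

  Completeness is needed in the almost-everywhere sense because \<open>rderiv\<close> differentiates
  an unspecified C^r representative: equality almost everywhere with the Laguerre series, together
  with continuity, is what pins this representative down.\<close>

definition gamma_ratio :: "real \<Rightarrow> nat \<Rightarrow> real" where
  "gamma_ratio a k = Gamma (real k + a + 1) / fact k"

lemma gamma_ratio_pos: "0 \<le> a \<Longrightarrow> gamma_ratio a k > 0"
  unfolding gamma_ratio_def by (intro divide_pos_pos Gamma_real_pos) auto

lemma gchoose_shift_Gamma:
  assumes "0 \<le> a" "i \<le> k"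
  shows "(real k + a) gchoose (k - i) = Gamma (real k + a + 1) / (fact (k - i) * Gamma (real i + a + 1))"
proof -
  have "real k + a \<ge> 0" using assms by simp
  hence "real k + a + 1 \<notin> \<int>\<^sub>\<le>\<^sub>0"
    by (auto elim!: nonpos_Ints_cases)
  hence "(real k + a) gchoose (k - i)
      = Gamma (real k + a + 1) / (fact (k - i) * Gamma (real k + a - real (k - i) + 1))"
    by (intro gbinomial_Gamma) (auto simp: nonpos_Ints_def add.assoc)
  also have "real k + a - real (k - i) + 1 = real i + a + 1"
    using assms by (simp add: of_nat_diff)
  finally show ?thesis .
qed

lemma gchoose_shift_nonneg: "0 \<le> a \<Longrightarrow> i \<le> k \<Longrightarrow> 0 \<le> (real k + a) gchoose (k - i)"
  by (subst gchoose_shift_Gamma) (auto intro!: divide_nonneg_pos mult_pos_pos less_imp_le[OF Gamma_real_pos])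

lemma positive_convergent_bounds:
  fixes X :: "nat \<Rightarrow> real"
  assumes lim: "X \<longlonglongrightarrow> L" "L > 0" and pos: "\<And>n. X n > 0"
  obtains c C where "c > 0" "C > 0" "\<And>n. c \<le> X n" "\<And>n. X n \<le> C"
proof -
  have "Bseq X" using lim by (intro convergent_imp_Bseq) (auto simp: convergent_def)
  then obtain C where C: "C > 0" "\<And>n. norm (X n) \<le> C" by (auto elim: BseqE)
  have "(\<lambda>n. inverse (X n)) \<longlonglongrightarrow> inverse L" using lim by (intro tendsto_inverse) auto
  hence "Bseq (\<lambda>n. inverse (X n))" by (intro convergent_imp_Bseq) (auto simp: convergent_def)
  then obtain D where D: "D > 0" "\<And>n. norm (inverse (X n)) \<le> D" by (auto elim: BseqE)
  show ?thesis
  proof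
    show "inverse D > 0" "C > 0" using C D by auto
    fix n
    show "inverse D \<le> X n" using D(2)[of n] pos[of n] D(1) by (simp add: field_simps)
    show "X n \<le> C" using C(2)[of n] by simp
  qed
qed

text \<open>\<open>gamma_ratio a k\<close> is the squared norm of \<open>Laguerre a k\<close> for
  the weight with exponent a. Gauss's limit for Gamma(a + 1), taken at index k + 1, contains it up
  to a rational factor 1/Q with 1 \<le> Q \<le> (a + 2)^2, and a positive sequence with a positive
  limit stays away from 0 and infinity. So the bounds hold from k = 0 on, not only
  asymptotically.\<close>

lemma gamma_ratio_bounds:
  assumes a: "0 \<le> a"
  obtains c C where "c > 0" "C > 0"
    "\<And>k. c * real (k + 1) powr a \<le> gamma_ratio a k"
    "\<And>k. gamma_ratio a k \<le> C * real (k + 1) powr a"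
proof -
  define Y where "Y k = Gamma_series (a + 1) (Suc k)" for k
  have lim: "Y \<longlonglongrightarrow> Gamma (a + 1)"
    unfolding Y_def by (rule LIMSEQ_Suc[OF Gamma_series_LIMSEQ])
  have G: "Gamma (a + 1) > 0" using a by simp
  have Y: "Y k = Gamma (a + 1) * (real (k + 1) powr a / gamma_ratio a k)
        * (real (k + 1) ^ 2 / ((a + real k + 2) * (a + real k + 1)))" for k
  proof -
    have a1: "a + 1 \<notin> \<int>\<^sub>\<le>\<^sub>0" using a by (auto elim!: nonpos_Ints_cases)
    have "Gamma (a + 1 + real (Suc (Suc k))) = Gamma ((real k + a + 1 + 1) + 1)"
      by (simp add: algebra_simps)
    also have "\<dots> = (real k + a + 1 + 1) * Gamma (real k + a + 1 + 1)"
      using a by (subst Gamma_plus1) (auto elim!: nonpos_Ints_cases)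
    also have "Gamma (real k + a + 1 + 1) = (real k + a + 1) * Gamma (real k + a + 1)"
      using a by (subst Gamma_plus1) (auto elim!: nonpos_Ints_cases)
    finally have "pochhammer (a + 1) (Suc (Suc k))
       = (real k + a + 2) * (real k + a + 1) * Gamma (real k + a + 1) / Gamma (a + 1)"
      using a1 by (subst pochhammer_Gamma) (auto simp: algebra_simps)
    moreover have "exp ((a + 1) * ln (real (Suc k))) = real (k+1) powr a * real (k + 1)"
      using powr_add[of "real (k+1)" a 1] by (simp add: powr_def)
    ultimately show ?thesis
      using G gamma_ratio_pos[OF a, of k] a
      unfolding Y_def Gamma_series_def gamma_ratio_def
      by (simp add: field_simps power2_eq_square)
  qed
  have pos: "Y k > 0" for k
    unfolding Y using G gamma_ratio_pos[OF a, of k] a by auto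
  from positive_convergent_bounds[OF lim G pos] obtain y z
    where y: "y > 0" "z > 0" "\<And>k. y \<le> Y k" "\<And>k. Y k \<le> z" by blast
  let ?G = "Gamma (a + 1)"
  show ?thesis
  proof
    show "?G / (z * (a + 2)^2) > 0" "?G / y > 0" using y G a by auto
    fix k
    define g P Q where "g = gamma_ratio a k" and "P = real (k + 1) powr a"
      and "Q = (a + real k + 2) * (a + real k + 1) / real (k + 1) ^ 2"
    have g: "g > 0" and P: "P > 0" using gamma_ratio_pos[OF a] by (auto simp: g_def P_def)
    have Q1: "Q \<ge> 1"
    proof -
      have "real (k + 1) * real (k + 1) \<le> (a + real k + 2) * (a + real k + 1)"
        using a by (intro mult_mono) auto
      thus ?thesis unfolding Q_def by (simp add: power2_eq_square)
    qed
    have Q2: "Q \<le> (a + 2)^2"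
    proof -
      have "(a + real k + 2) * (a + real k + 1) \<le> ((a + 2) * real (k + 1)) * ((a + 2) * real (k+1))"
        using a by (intro mult_mono) (auto simp: algebra_simps)
      thus ?thesis unfolding Q_def by (simp add: power2_eq_square divide_simps mult_ac)
    qed
    have Qpos: "Q > 0" using Q1 by simp
    have "Y k = ?G * (P / g) * (1 / Q)"
      unfolding Y g_def[symmetric] P_def[symmetric] Q_def by simp
    hence YQ: "Y k * g * Q = ?G * P"
      using g Qpos by (simp add: field_simps)
    have "?G * P \<le> z * g * (a + 2)^2"
      unfolding YQ[symmetric] using y g Q1 Q2 less_imp_le[OF pos[of k]]
      by (intro mult_mono) auto
    thus "?G / (z * (a + 2)^2) * real (k + 1) powr a \<le> gamma_ratio a k"
      using y a unfolding P_def[symmetric] g_def[symmetric]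
      by (simp add: divide_simps mult_ac)
    have "y * g * 1 \<le> Y k * g * Q"
      using y g Q1 less_imp_le[OF pos[of k]] by (intro mult_mono) auto
    hence "y * g \<le> ?G * P" using YQ by simp
    thus "gamma_ratio a k \<le> ?G / y * real (k + 1) powr a"
      using y unfolding P_def[symmetric] g_def[symmetric] by (simp add: field_simps)
  qed
qed

section \<open>Finite differences and the Gamma form of the coefficients\<close>

text \<open>Up to sign this is the k-th finite difference, in i, of a polynomial of degree j: it
  vanishes for j < k and sees only the leading coefficient for j = k. Pascal's rule peels off one
  difference, and the difference of a rising factorial is a multiple of one of degree j - 1 at x +
  1, which is why the induction leaves x and j free.\<close>

lemma alternating_binomial_pochhammer:
  fixes x :: real
  shows "j \<le> k \<Longrightarrow> (\<Sum>i\<le>k. (-1) ^ i * real (k choose i) * pochhammer (x + real i) j)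
      = (if j = k then (-1) ^ k * fact k else 0)"
proof (induction k arbitrary: j x)
  case 0
  then show ?case by simp
next
  case (Suc k)
  define g where "g i = pochhammer (x + real i) j" for i :: nat
  have diff: "g i - g (Suc i) = - (real j * pochhammer (x + 1 + real i) (j - 1))" for i
  proof (cases j)
    case (Suc j')
    have "g i = (x + real i) * pochhammer (x + real i + 1) j'"
      unfolding g_def Suc by (simp add: pochhammer_rec)
    moreover have "g (Suc i) = pochhammer (x + real i + 1) j' * (x + real i + 1 + real j')"
      unfolding g_def Suc by (simp add: pochhammer_Suc algebra_simps)
    ultimately show ?thesis by (simp add: Suc algebra_simps)
  qed (simp add: g_def)
  have "(\<Sum>i\<le>Suc k. (-1) ^ i * real (Suc k choose i) * g i)
      = g 0 + (\<Sum>i\<le>k. (-1) ^ Suc i * real (Suc k choose Suc i) * g (Suc i))"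
    by (subst sum.atMost_Suc_shift) simp
  also have "(\<Sum>i\<le>k. (-1) ^ Suc i * real (Suc k choose Suc i) * g (Suc i))
      = (\<Sum>i\<le>k. (-1) ^ Suc i * real (k choose Suc i) * g (Suc i))
        - (\<Sum>i\<le>k. (-1) ^ i * real (k choose i) * g (Suc i))"
    by (simp add: algebra_simps sum.distrib sum_negf sum_subtractf)
  also have "(\<Sum>i\<le>k. (-1) ^ Suc i * real (k choose Suc i) * g (Suc i))
      = (\<Sum>i\<le>Suc k. (-1) ^ i * real (k choose i) * g i) - g 0"
    by (subst sum.atMost_Suc_shift) simp
  also have "(\<Sum>i\<le>Suc k. (-1) ^ i * real (k choose i) * g i)
      = (\<Sum>i\<le>k. (-1) ^ i * real (k choose i) * g i)"
    by simp
  finally have "(\<Sum>i\<le>Suc k. (-1) ^ i * real (Suc k choose i) * g i)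
      = (\<Sum>i\<le>k. (-1) ^ i * real (k choose i) * (g i - g (Suc i)))"
    by (simp add: algebra_simps sum_subtractf)
  also have "\<dots> = - real j * (\<Sum>i\<le>k. (-1) ^ i * real (k choose i) * pochhammer (x + 1 + real i) (j - 1))"
    unfolding diff by (simp add: sum_distrib_left sum_negf mult_ac)
  also have "\<dots> = (if j = Suc k then (-1) ^ Suc k * fact (Suc k) else 0)"
  proof (cases "j = 0")
    case False
    hence "j - 1 \<le> k" "j = Suc k \<longleftrightarrow> j - 1 = k" using Suc.prems by auto
    with Suc.IH[of "j - 1" "x + 1"] False show ?thesis by (auto simp: algebra_simps)
  qed simp
  finally show ?case by (simp add: g_def)
qed

lemma Laguerre_Gamma:
  assumes "0 \<le> a"
  shows "Laguerre a k t = (\<Sum>i\<le>k. gamma_ratio a k * ((-1) ^ i * real (k choose i) / Gamma (real i + a + 1)) * t ^ i)"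
  unfolding Laguerre_def gamma_ratio_def
proof (intro sum.cong refl)
  fix i assume "i \<in> {..k}"
  hence i: "i \<le> k" by simp
  have "Gamma (real i + a + 1) > 0" using assms by simp
  thus "(- 1) ^ i * (real k + a gchoose (k - i)) * t ^ i / fact i
     = Gamma (real k + a + 1) / fact k * ((- 1) ^ i * real (k choose i) / Gamma (real i + a + 1)) * t ^ i"
    unfolding gchoose_shift_Gamma[OF assms i] binomial_fact[OF i] by (simp add: field_simps)
qed

lemma Laguerre_0 [simp]: "Laguerre a 0 t = 1"
  by (simp add: Laguerre_def)

lemma continuous_on_Laguerre [continuous_intros]:
  "continuous_on A f \<Longrightarrow> continuous_on A (\<lambda>x. Laguerre a k (f x))"
  unfolding Laguerre_def by (intro continuous_intros) auto

lemma borel_measurable_Laguerre [measurable]: "Laguerre a k \<in> borel_measurable borel"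
  by (intro borel_measurable_continuous_onI continuous_intros)

lemma DERIV_Laguerre:
  "(Laguerre a (Suc k) has_real_derivative - Laguerre (a + 1) k t) (at t)"
proof -
  have "((\<lambda>t. \<Sum>i\<le>Suc k. (-1) ^ i * ((real (Suc k) + a) gchoose (Suc k - i)) * t ^ i / fact i)
     has_real_derivative
     (\<Sum>i\<le>Suc k. (-1) ^ i * ((real (Suc k) + a) gchoose (Suc k - i)) * (real i * t ^ (i - 1)) / fact i)) (at t)"
    using DERIV_pow[of _ t] by (intro DERIV_sum DERIV_cdivide DERIV_cmult) simp
  also have "(\<Sum>i\<le>Suc k. (-1) ^ i * ((real (Suc k) + a) gchoose (Suc k - i)) * (real i * t ^ (i - 1)) / fact i)
     = - Laguerre (a + 1) k t"
  proof -
    have frac: "real (Suc i) * x / fact (Suc i) = x / fact i" for i :: nat and x :: real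
      by (simp add: field_simps del: of_nat_Suc)
    have "(-1) ^ Suc i * ((real (Suc k) + a) gchoose (Suc k - Suc i)) * (real (Suc i) * t ^ (Suc i - 1)) / fact (Suc i)
        = - ((-1) ^ i * ((real k + (a + 1)) gchoose (k - i)) * t ^ i / fact i)" for i
      using frac[of i "(-1) ^ Suc i * ((real (Suc k) + a) gchoose (Suc k - Suc i)) * t ^ i"]
      by (simp add: algebra_simps)
    thus ?thesis unfolding Laguerre_def
      by (subst sum.atMost_Suc_shift) (simp add: sum_negf del: of_nat_Suc fact_Suc)
  qed
  finally show ?thesis unfolding Laguerre_def[abs_def] .
qed


section \<open>Orthonormality\<close>

lemma weight_nonneg [simp]: "0 \<le> weight \<alpha> t"
  by (simp add: weight_def)

lemma weight_pos: "0 < t \<Longrightarrow> 0 < weight \<alpha> t"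
  by (simp add: weight_def)

lemma borel_measurable_weight [measurable]: "weight \<alpha> \<in> borel_measurable borel"
  unfolding weight_def[abs_def] by measurable

lemma borel_measurable_ell [measurable]: "ell \<alpha> k \<in> borel_measurable borel"
  unfolding ell_def[abs_def] by measurable

lemma borel_measurable_lebesgue_onI [intro]:
  fixes f :: "real \<Rightarrow> real"
  shows "f \<in> borel_measurable borel \<Longrightarrow> f \<in> borel_measurable (lebesgue_on A)"
  by (rule measurable_restrict_space1) (rule measurable_completion, simp)

lemma ell_gamma_ratio: "ell \<alpha> k t = Laguerre \<alpha> k t / sqrt (gamma_ratio \<alpha> k)"
  by (simp add: ell_def gamma_ratio_def real_sqrt_divide)

lemma has_integral_weight_power:
  assumes "0 \<le> \<alpha>"
  shows "has_bochner_integral (lebesgue_on {0<..}) (\<lambda>t. weight \<alpha> t * t ^ j) (Gamma (real j + \<alpha> + 1))"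
proof (rule has_bochner_integral_nn_integral)
  show "(\<lambda>t. weight \<alpha> t * t ^ j) \<in> borel_measurable (lebesgue_on {0<..})"
    by (intro borel_measurable_lebesgue_onI) measurable
  show "AE t in lebesgue_on {0<..}. 0 \<le> weight \<alpha> t * t ^ j"
    by (intro AE_I2) (auto simp: space_restrict_space)
  show "0 \<le> Gamma (real j + \<alpha> + 1)" using assms by (intro less_imp_le Gamma_real_pos) auto
  have "(\<integral>\<^sup>+t. ennreal (weight \<alpha> t * t ^ j) \<partial>lebesgue_on {0<..})
      = (\<integral>\<^sup>+t. ennreal (weight \<alpha> t * t ^ j) * indicator {0<..} t \<partial>lborel)"
    by (subst nn_integral_restrict_space) (auto simp: nn_integral_completion)
  also have "\<dots> = (\<integral>\<^sup>+t. ennreal (indicator {0..} t * t powr ((real j + \<alpha> + 1) - 1) / exp t) \<partial>lborel)"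
    by (intro nn_integral_cong)
       (auto simp: weight_def exp_minus powr_add powr_realpow field_simps split: split_indicator)
  also have "\<dots> = ennreal (Gamma (real j + \<alpha> + 1))"
    using assms by (subst Gamma_conv_nn_integral_real) auto
  finally show "(\<integral>\<^sup>+t. ennreal (weight \<alpha> t * t ^ j) \<partial>lebesgue_on {0<..}) = ennreal (Gamma (real j + \<alpha> + 1))" .
qed

text \<open>Each moment Gamma(i + j + \<alpha> + 1) meets the denominator Gamma(i + \<alpha> + 1) of
  a coefficient, and the quotient is a rising factorial of degree j in i. Orthogonality to lower
  powers is thus the vanishing of finite differences.\<close>

lemma has_integral_weight_power_Laguerre:
  assumes "0 \<le> \<alpha>" "j \<le> k"
  shows "has_bochner_integral (lebesgue_on {0<..}) (\<lambda>t. weight \<alpha> t * t ^ j * Laguerre \<alpha> k t)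
           (if j = k then (-1) ^ k * fact k * gamma_ratio \<alpha> k else 0)"
proof -
  have 1: "weight \<alpha> t * t ^ j * Laguerre \<alpha> k t
     = (\<Sum>i\<le>k. gamma_ratio \<alpha> k * ((-1) ^ i * real (k choose i) / Gamma (real i + \<alpha> + 1)) * (weight \<alpha> t * t ^ (i + j)))" for t
    unfolding Laguerre_Gamma[OF assms(1)] by (simp add: sum_distrib_left power_add mult_ac)
  have "has_bochner_integral (lebesgue_on {0<..}) (\<lambda>t. weight \<alpha> t * t ^ j * Laguerre \<alpha> k t)
     (\<Sum>i\<le>k. gamma_ratio \<alpha> k * ((-1) ^ i * real (k choose i) / Gamma (real i + \<alpha> + 1)) * Gamma (real (i + j) + \<alpha> + 1))"
    unfolding 1
    by (intro has_bochner_integral_sum has_bochner_integral_mult_right has_integral_weight_power assms)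
  also have "(\<Sum>i\<le>k. gamma_ratio \<alpha> k * ((-1) ^ i * real (k choose i) / Gamma (real i + \<alpha> + 1)) * Gamma (real (i + j) + \<alpha> + 1))
     = gamma_ratio \<alpha> k * (\<Sum>i\<le>k. (-1) ^ i * real (k choose i) * pochhammer ((\<alpha> + 1) + real i) j)"
    unfolding sum_distrib_left
  proof (intro sum.cong refl)
    fix i
    have "pochhammer ((\<alpha> + 1) + real i) j = Gamma (\<alpha> + 1 + real i + real j) / Gamma (\<alpha> + 1 + real i)"
      using assms by (intro pochhammer_Gamma) (auto elim!: nonpos_Ints_cases)
    thus "gamma_ratio \<alpha> k * ((-1) ^ i * real (k choose i) / Gamma (real i + \<alpha> + 1)) * Gamma (real (i + j) + \<alpha> + 1)
      = gamma_ratio \<alpha> k * ((-1) ^ i * real (k choose i) * pochhammer ((\<alpha> + 1) + real i) j)"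
      by (simp add: add_ac)
  qed
  also have "\<dots> = (if j = k then (-1) ^ k * fact k * gamma_ratio \<alpha> k else 0)"
    using assms(2) by (subst alternating_binomial_pochhammer) auto
  finally show ?thesis .
qed

lemma has_integral_weight_Laguerre_Laguerre:
  assumes "0 \<le> \<alpha>" "j \<le> k"
  shows "has_bochner_integral (lebesgue_on {0<..}) (\<lambda>t. weight \<alpha> t * Laguerre \<alpha> j t * Laguerre \<alpha> k t)
           (if j = k then gamma_ratio \<alpha> k else 0)"
proof -
  define c where "c i = gamma_ratio \<alpha> j * ((-1) ^ i * real (j choose i) / Gamma (real i + \<alpha> + 1))" for i
  have 1: "weight \<alpha> t * Laguerre \<alpha> j t * Laguerre \<alpha> k t
     = (\<Sum>i\<le>j. c i * (weight \<alpha> t * t ^ i * Laguerre \<alpha> k t))" for t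
    unfolding Laguerre_Gamma[OF assms(1), of j] c_def
    by (simp add: sum_distrib_left sum_distrib_right power_add mult_ac)
  have "has_bochner_integral (lebesgue_on {0<..}) (\<lambda>t. weight \<alpha> t * Laguerre \<alpha> j t * Laguerre \<alpha> k t)
     (\<Sum>i\<le>j. c i * (if i = k then (-1) ^ k * fact k * gamma_ratio \<alpha> k else 0))"
    unfolding 1 using assms
    by (intro has_bochner_integral_sum has_bochner_integral_mult_right has_integral_weight_power_Laguerre) auto
  also have "(\<Sum>i\<le>j. c i * (if i = k then (-1) ^ k * fact k * gamma_ratio \<alpha> k else 0))
     = (\<Sum>i\<le>j. if i = k then c k * ((-1) ^ k * fact k * gamma_ratio \<alpha> k) else 0)"
    by (intro sum.cong) auto
  \<comment> \<open>Only the top power of the factor of degree j can survive. Its coefficient brings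
    a second sign (-1)^k and 1 / Gamma(k + \<alpha> + 1), which cancel all but one
    \<open>gamma_ratio\<close>.\<close>
  also have "\<dots> = (if j = k then gamma_ratio \<alpha> k else 0)"
  proof -
    have "Gamma (real k + \<alpha> + 1) \<noteq> 0" using assms by (intro less_imp_neq[symmetric] Gamma_real_pos) auto
    thus ?thesis using assms by (auto simp: c_def gamma_ratio_def power_mult_distrib[symmetric])
  qed
  finally show ?thesis .
qed

lemma has_integral_ell_ell:
  assumes "0 \<le> \<alpha>"
  shows "has_bochner_integral (lebesgue_on {0<..}) (\<lambda>t. weight \<alpha> t * ell \<alpha> j t * ell \<alpha> k t)
           (if j = k then 1 else 0)"
proof -
  have le: "has_bochner_integral (lebesgue_on {0<..}) (\<lambda>t. weight \<alpha> t * ell \<alpha> j t * ell \<alpha> k t)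
           (if j = k then 1 else 0)" if "j \<le> k" for j k
  proof -
    have "has_bochner_integral (lebesgue_on {0<..})
       (\<lambda>t. weight \<alpha> t * Laguerre \<alpha> j t * Laguerre \<alpha> k t / (sqrt (gamma_ratio \<alpha> j) * sqrt (gamma_ratio \<alpha> k)))
       ((if j = k then gamma_ratio \<alpha> k else 0) / (sqrt (gamma_ratio \<alpha> j) * sqrt (gamma_ratio \<alpha> k)))"
      using has_integral_weight_Laguerre_Laguerre[OF assms that] by (rule has_bochner_integral_divide_zero)
    thus ?thesis using gamma_ratio_pos[OF assms, of k]
      by (auto simp: ell_gamma_ratio split: if_splits)
  qed
  show ?thesis
  proof (cases "j \<le> k")
    case False
    hence "k \<le> j" by simp
    from le[OF this] show ?thesis by (simp add: mult_ac eq_commute)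
  qed (rule le)
qed

lemma inner_w_ell_ell: "0 \<le> \<alpha> \<Longrightarrow> inner_w \<alpha> (ell \<alpha> j) (ell \<alpha> k) = (if j = k then 1 else 0)"
  unfolding inner_w_def by (rule has_bochner_integral_integral_eq[OF has_integral_ell_ell])

lemma ell_in_L2w: "0 \<le> \<alpha> \<Longrightarrow> ell \<alpha> k \<in> L2w \<alpha>"
  using has_integral_ell_ell[of \<alpha> k k]
  by (auto simp: L2w_def power2_eq_square has_bochner_integral_iff mult_ac)

lemma abs_mult_le_half_squares: "\<bar>x * y\<bar> \<le> (x\<^sup>2 + y\<^sup>2) / (2 :: real)"
  using sum_squares_bound[of "\<bar>x\<bar>" "\<bar>y\<bar>"] by (simp add: abs_mult)

text \<open>The arithmetic-geometric mean inequality stands in for Cauchy-Schwarz. As the functions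
  \<open>ell\<close> have norm 1, it bounds the integrals of |weight * f * ell| by a number
  independent of the index, which is the form used later.\<close>

lemma L2w_mult:
  assumes "f \<in> L2w \<alpha>" "g \<in> L2w \<alpha>"
  shows "integrable (lebesgue_on {0<..}) (\<lambda>t. weight \<alpha> t * f t * g t)"
    and "(\<integral>t. \<bar>weight \<alpha> t * f t * g t\<bar> \<partial>lebesgue_on {0<..})
      \<le> ((\<integral>t. weight \<alpha> t * (f t)\<^sup>2 \<partial>lebesgue_on {0<..}) + (\<integral>t. weight \<alpha> t * (g t)\<^sup>2 \<partial>lebesgue_on {0<..})) / 2"
proof -
  let ?M = "lebesgue_on {0<..}"
  have [measurable]: "f \<in> borel_measurable ?M" "g \<in> borel_measurable ?M" "weight \<alpha> \<in> borel_measurable ?M"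
    using assms by (auto simp: L2w_def)
  have int: "integrable ?M (\<lambda>t. weight \<alpha> t * (f t)\<^sup>2)" "integrable ?M (\<lambda>t. weight \<alpha> t * (g t)\<^sup>2)"
    using assms by (auto simp: L2w_def)
  have bnd: "\<bar>weight \<alpha> t * f t * g t\<bar> \<le> (weight \<alpha> t * (f t)\<^sup>2 + weight \<alpha> t * (g t)\<^sup>2) / 2" for t
    using mult_left_mono[OF abs_mult_le_half_squares[of "f t" "g t"] weight_nonneg[of \<alpha> t]]
    by (simp add: abs_mult field_simps)
  show fg: "integrable ?M (\<lambda>t. weight \<alpha> t * f t * g t)"
  proof (rule Bochner_Integration.integrable_bound)
    show "integrable ?M (\<lambda>t. (weight \<alpha> t * (f t)\<^sup>2 + weight \<alpha> t * (g t)\<^sup>2) / 2)"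
      using int by auto
    show "AE t in ?M. norm (weight \<alpha> t * f t * g t) \<le> norm ((weight \<alpha> t * (f t)\<^sup>2 + weight \<alpha> t * (g t)\<^sup>2) / 2)"
      using bnd by (intro AE_I2) (auto intro: order_trans)
  qed measurable
  have "(\<integral>t. \<bar>weight \<alpha> t * f t * g t\<bar> \<partial>?M) \<le> (\<integral>t. (weight \<alpha> t * (f t)\<^sup>2 + weight \<alpha> t * (g t)\<^sup>2) / 2 \<partial>?M)"
    using int fg bnd by (intro integral_mono) auto
  also have "\<dots> = ((\<integral>t. weight \<alpha> t * (f t)\<^sup>2 \<partial>?M) + (\<integral>t. weight \<alpha> t * (g t)\<^sup>2 \<partial>?M)) / 2"
    using int by simp
  finally show "(\<integral>t. \<bar>weight \<alpha> t * f t * g t\<bar> \<partial>?M)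
    \<le> ((\<integral>t. weight \<alpha> t * (f t)\<^sup>2 \<partial>?M) + (\<integral>t. weight \<alpha> t * (g t)\<^sup>2 \<partial>?M)) / 2" .
qed

lemma integral_ell_square: "0 \<le> \<alpha> \<Longrightarrow> (\<integral>t. weight \<alpha> t * (ell \<alpha> k t)\<^sup>2 \<partial>lebesgue_on {0<..}) = 1"
  using inner_w_ell_ell[of \<alpha> k k] by (simp add: inner_w_def power2_eq_square mult.assoc)


section \<open>Generating function\<close>

text \<open>Newton's series with the sign moved into the coefficient, which is then nonnegative for
  b \<ge> 0. The norms of the complex series are therefore the terms of this one, and that yields
  absolute convergence of the double series behind the generating function.\<close>

lemma sums_negative_binomial_real:
  fixes x b :: real
  assumes "\<bar>x\<bar> < 1"
  shows "(\<lambda>m. ((real m + b) gchoose m) * x ^ m) sums ((1 - x) powr (- (b + 1)))"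
proof -
  have eq: "((- (b + 1)) gchoose m) * (- x) ^ m = ((real m + b) gchoose m) * x ^ m" for m
  proof -
    have "(-1 :: real) ^ m * (-1) ^ m = 1" by (simp flip: power_mult_distrib)
    hence "((-1) ^ m * c) * ((-1) ^ m * d) = c * d" for c d :: real
      by (simp add: mult_ac)
    moreover have "b + 1 + real m - 1 = real m + b" by simp
    ultimately show ?thesis
      by (simp only: gbinomial_minus power_minus[of x m])
  qed
  have "\<bar>- x\<bar> < 1" using assms by simp
  from gen_binomial_real[OF this, of "- (b + 1)"] show ?thesis
    unfolding eq by simp
qed

lemma sums_negative_binomial_complex:
  fixes z :: complex and b :: real
  assumes "norm z < 1"
  shows "(\<lambda>m. of_real ((real m + b) gchoose m) * z ^ m) sums ((1 - z) powr (- of_real (b + 1)))"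
proof -
  have eq: "((- of_real (b + 1) :: complex) gchoose m) * (- z) ^ m = of_real ((real m + b) gchoose m) * z ^ m" for m
  proof -
    have "(- of_real (b + 1) :: complex) gchoose m = of_real ((- (b + 1)) gchoose m)"
      by (simp add: gbinomial_prod_rev)
    also have "(- (b + 1)) gchoose m = (-1) ^ m * ((real m + b) gchoose m)"
      using gbinomial_minus[of "b + 1" m] by (simp add: add_ac)
    finally have 1: "(- of_real (b + 1) :: complex) gchoose m = (-1) ^ m * of_real ((real m + b) gchoose m)"
      by simp
    have "(-1 :: complex) ^ m * (-1) ^ m = 1" by (simp flip: power_mult_distrib)
    hence "((-1) ^ m * c) * ((-1) ^ m * d) = c * d" for c d :: complex
      by (simp add: mult_ac)
    thus ?thesis
      unfolding 1 power_minus[of z m] .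
  qed
  have "norm (- z) < 1" using assms by simp
  from gen_binomial_complex[OF this, of "- of_real (b + 1)"] show ?thesis
    unfolding eq by simp
qed

lemma one_minus_not_nonpos_Reals: "norm z < 1 \<Longrightarrow> 1 - z \<notin> \<real>\<^sub>\<le>\<^sub>0" for z :: complex
  using complex_Re_le_cmod[of z] by (auto simp: complex_nonpos_Reals_iff)

text \<open>Expand the exponential in powers of z / (1 - z), then each (1 - z)^(-i-a-1) by Newton's
  series. Summing the double family over m first gives the closed form, summing along i + m = n
  gives the Laguerre polynomials, and absolute summability identifies the two.\<close>

theorem Laguerre_generating_function:
  fixes z :: complex and a t :: real
  assumes a: "0 \<le> a" and z: "norm z < 1"
  shows "(\<lambda>n. of_real (Laguerre a n t) * z ^ n) sums
           ((1 - z) powr (- of_real (a + 1)) * exp (- (of_real t * z / (1 - z))))"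
proof -
  define T :: "nat \<times> nat \<Rightarrow> complex" where
    "T = (\<lambda>(i, m). (- of_real t * z) ^ i / fact i * (of_real ((real m + (real i + a)) gchoose m) * z ^ m))"
  define R :: "nat \<Rightarrow> complex" where
    "R i = (- of_real t * z) ^ i / fact i * (1 - z) powr (- of_real (real i + a + 1))" for i
  have z1: "1 - z \<noteq> 0" using z by auto
  have inner: "(\<lambda>m. T (i, m)) sums R i" for i
    using sums_mult[OF sums_negative_binomial_complex[OF z, of "real i + a"], of "(- of_real t * z) ^ i / fact i"]
    by (simp add: T_def R_def)
  have nonneg: "0 \<le> (real m + (real i + a)) gchoose m" for m i
    using gchoose_shift_nonneg[of "real i + a" 0 m] a by simp
  have inner_norm: "(\<lambda>m. norm (T (i, m))) sums
      ((\<bar>t\<bar> * norm z) ^ i / fact i * (1 - norm z) powr (- (real i + a + 1)))" for i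
  proof -
    have "norm (T (i, m)) = (\<bar>t\<bar> * norm z) ^ i / fact i
       * (((real m + (real i + a)) gchoose m) * norm z ^ m)" for m
      using nonneg by (simp add: T_def norm_mult norm_divide norm_power abs_of_nonneg)
    thus ?thesis
      using sums_mult[OF sums_negative_binomial_real[of "norm z" "real i + a"],
          of "(\<bar>t\<bar> * norm z) ^ i / fact i"] z by simp
  qed
  have inner_has_sum: "((\<lambda>m. T (i, m)) has_sum R i) UNIV" for i
    using inner_norm[of i] inner[of i] by (intro norm_summable_imp_has_sum) (auto simp: sums_iff)
  \<comment> \<open>The norms form the same expansion at |t| and |z| with the minus sign in the
    exponential removed, so their iterated sums are again the terms of an exponential
    series.\<close>
  have outer_norm: "infsum (\<lambda>m. norm (T (i, m))) UNIV
     = (1 - norm z) powr (- (a + 1)) * ((\<bar>t\<bar> * norm z / (1 - norm z)) ^ i /\<^sub>R fact i)" for i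
  proof -
    have "((\<lambda>m. norm (T (i, m))) has_sum
      ((\<bar>t\<bar> * norm z) ^ i / fact i * (1 - norm z) powr (- (real i + a + 1)))) UNIV"
      using inner_norm[of i] by (intro norm_summable_imp_has_sum) (auto simp: sums_iff)
    moreover have "(1 - norm z) powr (- (real i + a + 1)) = (1 - norm z) powr (- (a + 1)) / (1 - norm z) ^ i"
    proof -
      have "- (real i + a + 1) = - (a + 1) - real i" by simp
      thus ?thesis using z by (simp only: powr_diff) (simp add: powr_realpow)
    qed
    ultimately show ?thesis
      by (simp add: infsumI power_divide field_simps)
  qed
  have "(\<lambda>p. norm (T p)) summable_on (Sigma UNIV (\<lambda>_. UNIV))"
  proof (intro iffD2[OF Infinite_Sum.abs_summable_on_Sigma_iff] conjI ballI)
    show "(\<lambda>m. norm (T (i, m))) summable_on UNIV" for i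
      using inner_norm[of i] by (subst summable_on_UNIV_nonneg_real_iff) (auto simp: sums_iff)
    have "summable (\<lambda>i. infsum (\<lambda>m. norm (T (i, m))) UNIV)"
      unfolding outer_norm by (intro summable_mult sums_summable[OF exp_converges])
    thus "(\<lambda>i. norm (infsum (\<lambda>m. norm (T (i, m))) UNIV)) summable_on UNIV"
      by (simp add: infsum_nonneg summable_on_UNIV_nonneg_real_iff)
  qed
  hence "T summable_on (Sigma UNIV (\<lambda>_. UNIV))" by (rule Infinite_Sum.abs_summable_summable)
  then obtain S where S: "(T has_sum S) (Sigma UNIV (\<lambda>_. UNIV))"
    unfolding summable_on_def by blast
  have "(R has_sum S) UNIV"
    by (rule has_sum_SigmaD[OF S]) (use inner_has_sum in auto)
  hence RS: "R sums S" by (rule has_sum_imp_sums)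
  have "R i = (1 - z) powr (- of_real (a + 1)) * ((- (of_real t * z / (1 - z))) ^ i /\<^sub>R fact i)" for i
  proof -
    have "- complex_of_real (real i + a + 1) = - of_real (a + 1) - of_nat i" by simp
    hence "(1 - z) powr (- of_real (real i + a + 1)) = (1 - z) powr (- of_real (a + 1)) / (1 - z) ^ i"
      using z1 by (simp only: powr_diff powr_complexpow[OF z1])
    moreover have "(- (of_real t * z / (1 - z))) ^ i = (- of_real t * z) ^ i / (1 - z) ^ i"
      by (simp add: power_divide[symmetric])
    ultimately show ?thesis
      unfolding R_def by (simp add: scaleR_conv_of_real field_simps)
  qed
  hence "R = (\<lambda>i. (1 - z) powr (- of_real (a + 1)) * ((- (of_real t * z / (1 - z))) ^ i /\<^sub>R fact i))"
    by (rule ext)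
  hence "R sums ((1 - z) powr (- of_real (a + 1)) * exp (- (of_real t * z / (1 - z))))"
    using sums_mult[OF exp_converges[of "- (of_real t * z / (1 - z))"]] by simp
  with RS have S_eq: "S = (1 - z) powr (- of_real (a + 1)) * exp (- (of_real t * z / (1 - z)))"
    by (rule sums_unique2)
  have "bij_betw (\<lambda>(n, i). (i, n - i)) (Sigma UNIV (\<lambda>n. {..n})) (UNIV \<times> UNIV :: (nat \<times> nat) set)"
    by (rule bij_betw_byWitness[where f' = "\<lambda>(i, m). (i + m, i)"]) auto
  from iffD2[OF has_sum_reindex_bij_betw[OF this] S]
  have "((\<lambda>(n, i). T (i, n - i)) has_sum S) (Sigma UNIV (\<lambda>n. {..n}))"
    by (simp add: case_prod_unfold)
  hence "((\<lambda>n. \<Sum>i\<le>n. T (i, n - i)) has_sum S) UNIV"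
    by (rule has_sum_SigmaD) (auto intro: has_sum_finite)
  moreover have "(\<Sum>i\<le>n. T (i, n - i)) = of_real (Laguerre a n t) * z ^ n" for n
    unfolding Laguerre_def of_real_sum sum_distrib_right
  proof (intro sum.cong refl)
    fix i assume "i \<in> {..n}"
    hence i: "i \<le> n" by simp
    have "real (n - i) + (real i + a) = real n + a" using i by (simp add: of_nat_diff)
    moreover have "z ^ i * z ^ (n - i) = z ^ n" using i by (simp add: power_add[symmetric])
    moreover have "(- of_real t * z) ^ i = of_real ((-1) ^ i * t ^ i) * z ^ i"
      by (simp only: power_mult_distrib power_minus[of "complex_of_real t" i]) simp
    ultimately show "T (i, n - i) = of_real ((-1) ^ i * (real n + a gchoose (n - i)) * t ^ i / fact i) * z ^ n"
      by (simp add: T_def mult_ac)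
  qed
  ultimately show ?thesis
    using S_eq by (simp add: has_sum_imp_sums)
qed

corollary Laguerre_generating_function_real:
  fixes z a t :: real
  assumes "0 \<le> a" "\<bar>z\<bar> < 1"
  shows "(\<lambda>n. Laguerre a n t * z ^ n) sums ((1 - z) powr (- (a + 1)) * exp (- (t * z / (1 - z))))"
proof -
  have "(\<lambda>n. of_real (Laguerre a n t) * of_real z ^ n) sums
     ((1 - of_real z) powr (- of_real (a + 1)) * exp (- (of_real t * of_real z / (1 - of_real z))) :: complex)"
    using assms by (intro Laguerre_generating_function) auto
  also have "(\<lambda>n. of_real (Laguerre a n t) * of_real z ^ n :: complex) = (\<lambda>n. of_real (Laguerre a n t * z ^ n))"
    by simp
  also have "(1 - of_real z :: complex) powr (- of_real (a + 1)) = of_real ((1 - z) powr (- (a + 1)))"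
    using assms powr_of_real[of "1 - z" "- (a + 1)"] by simp
  also have "exp (- (of_real t * of_real z / (1 - of_real z))) = (of_real (exp (- (t * z / (1 - z)))) :: complex)"
    by (simp flip: exp_of_real)
  finally show ?thesis by (simp only: of_real_mult[symmetric] sums_of_real_iff)
qed


section \<open>Uniform bounds\<close>

text \<open>The derivative of the path contributes 2 pi i times the point itself, so the contour
  integral becomes a plain mean over [0, 1]. For n = 0 this is the mean value property, which
  evaluates the integral of the Poisson kernel.\<close>

lemma has_integral_circle_coefficient:
  assumes hol: "F holomorphic_on ball 0 1" and \<rho>: "0 < \<rho>" "\<rho> < 1"
  shows "((\<lambda>x. F (of_real \<rho> * exp (2 * of_real pi * \<i> * of_real x)) / (of_real \<rho> * exp (2 * of_real pi * \<i> * of_real x)) ^ n)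
      has_integral ((deriv ^^ n) F 0 / fact n)) {0..1}"
proof -
  let ?g = "\<lambda>x::real. of_real \<rho> * exp (2 * of_real pi * \<i> * of_real x)"
  have sub: "cball 0 \<rho> \<subseteq> (ball 0 1 :: complex set)" using \<rho> by auto
  have "((\<lambda>u. F u / (u - 0) ^ Suc n) has_contour_integral ((2 * pi * \<i>) / fact n * (deriv ^^ n) F 0))
      (circlepath 0 \<rho>)"
    using sub \<rho> hol
    by (intro Cauchy_has_contour_integral_higher_derivative_circlepath)
       (auto intro: holomorphic_on_imp_continuous_on holomorphic_on_subset)
  hence "((\<lambda>x. F (?g x) / (?g x) ^ Suc n * (2 * pi * \<i> * \<rho> * exp (2 * of_real pi * \<i> * of_real x)))
      has_integral ((2 * pi * \<i>) / fact n * (deriv ^^ n) F 0)) {0..1}"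
    unfolding has_contour_integral_def
    by (rule has_integral_eq[rotated], simp add: vector_derivative_circlepath01) (simp add: circlepath)
  hence "((\<lambda>x. F (?g x) / (?g x) ^ Suc n * (2 * pi * \<i> * \<rho> * exp (2 * of_real pi * \<i> * of_real x)) / (2 * pi * \<i>))
      has_integral ((2 * pi * \<i>) / fact n * (deriv ^^ n) F 0) / (2 * pi * \<i>)) {0..1}"
    by (rule has_integral_divide)
  moreover have "F (?g x) / (?g x) ^ Suc n * (2 * pi * \<i> * \<rho> * exp (2 * of_real pi * \<i> * of_real x)) / (2 * pi * \<i>)
      = F (?g x) / (?g x) ^ n" for x
  proof -
    have "?g x \<noteq> 0" using \<rho> by simp
    hence "F (?g x) / (?g x) ^ Suc n * (2 * pi * \<i> * ?g x) / (2 * pi * \<i>) = F (?g x) / (?g x) ^ n"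
      by (simp add: field_simps)
    thus ?thesis by (simp add: mult_ac)
  qed
  ultimately show ?thesis by (simp add: field_simps)
qed

definition Laguerre_gf :: "real \<Rightarrow> real \<Rightarrow> complex \<Rightarrow> complex" where
  "Laguerre_gf a t z = (1 - z) powr (- of_real (a + 1)) * exp (- (of_real t * z / (1 - z)))"

lemma holomorphic_Laguerre_gf: "Laguerre_gf a t holomorphic_on ball 0 1"
  unfolding Laguerre_gf_def[abs_def]
  by (intro holomorphic_intros) (use one_minus_not_nonpos_Reals in auto)

lemma deriv_Laguerre_gf:
  assumes "0 \<le> a"
  shows "(deriv ^^ n) (Laguerre_gf a t) 0 / fact n = of_real (Laguerre a n t)"
proof -
  have "Laguerre_gf a t has_fps_expansion Abs_fps (\<lambda>n. of_real (Laguerre a n t))"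
  proof (rule has_fps_expansionI)
    have "eventually (\<lambda>z. z \<in> ball (0::complex) 1) (nhds 0)"
      by (intro eventually_nhds_in_open) auto
    thus "eventually (\<lambda>z. (\<lambda>n. fps_nth (Abs_fps (\<lambda>n. of_real (Laguerre a n t))) n * z ^ n)
        sums Laguerre_gf a t z) (nhds 0)"
      by eventually_elim (use Laguerre_generating_function[OF assms] in \<open>simp add: Laguerre_gf_def\<close>)
  qed
  from fps_nth_fps_expansion[OF this, of n] show ?thesis by simp
qed

text \<open>Apply u \<le> exp u at u = y / (b + 1). Scaling by b + 1 rather than b admits b = 0, and
  the exponent y * b / (b + 1) that results is at most y.\<close>

lemma powr_le_exp:
  fixes y b :: real
  assumes "0 \<le> y" "0 \<le> b"
  shows "y powr b \<le> (b + 1) powr b * exp y"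
proof -
  have "y / (b + 1) \<le> exp (y / (b + 1))" using exp_ge_add_one_self[of "y / (b + 1)"] by linarith
  hence "(y / (b + 1)) powr b \<le> exp (y / (b + 1)) powr b"
    using assms by (intro powr_mono2) auto
  also have "\<dots> = exp (y * (b / (b + 1)))" by (simp add: powr_def)
  also have "\<dots> \<le> exp y"
    using assms mult_left_mono[of "b / (b + 1)" 1 y] by simp
  finally show ?thesis using assms by (simp add: powr_divide field_simps)
qed

text \<open>By the second identity, exp (- t / 2) times the modulus of the exponential factor of the
  generating function is exp (- t P / 2), where P is the Poisson kernel computed in the
  first.\<close>

lemma Re_Cayley:
  fixes z :: complex
  assumes "norm z < 1"
  shows "Re ((1 + z) / (1 - z)) = (1 - norm z ^ 2) / norm (1 - z) ^ 2"
    and "1 + 2 * Re (z / (1 - z)) = Re ((1 + z) / (1 - z))"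
proof -
  have z1: "1 - z \<noteq> 0" using assms by auto
  have "Re ((1 + z) / (1 - z)) = Re ((1 + z) * cnj (1 - z)) / norm (1 - z) ^ 2"
    by (simp add: Re_divide cmod_power2)
  also have "Re ((1 + z) * cnj (1 - z)) = 1 - norm z ^ 2"
    unfolding cmod_power2 by (simp add: algebra_simps power2_eq_square)
  finally show "Re ((1 + z) / (1 - z)) = (1 - norm z ^ 2) / norm (1 - z) ^ 2" .
  define w where "w = z / (1 - z)"
  have "(1 + z) / (1 - z) = 1 + 2 * w" using z1 by (simp add: w_def field_simps)
  thus "1 + 2 * Re (z / (1 - z)) = Re ((1 + z) / (1 - z))" by (simp add: w_def[symmetric])
qed

text \<open>On a circle \<open>norm z = \<rho> < 1\<close> the Poisson kernel \<open>Re ((1 + z) / (1 - z))\<close> has mean \<open>1\<close>,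
  so this pointwise estimate bounds the mean of the generating function by a power of \<open>1 / (1 - \<rho>)\<close>.\<close>

lemma norm_Laguerre_gf_bound:
  fixes z :: complex
  assumes \<alpha>: "0 \<le> \<alpha>" and t: "0 < t" and z: "norm z < 1"
  shows "t powr (\<alpha> / 2) * exp (- t / 2) * norm (Laguerre_gf (\<alpha> + real r) t z)
    \<le> 2 * (\<alpha> + 2) powr (\<alpha> / 2) * (1 / (1 - norm z)) powr (\<alpha> / 2 + real (max 1 r)) * Re ((1 + z) / (1 - z))"
proof -
  define P where "P = Re ((1 + z) / (1 - z))"
  define d where "d = norm (1 - z)"
  define e where "e = 1 - norm z"
  define \<beta> where "\<beta> = \<alpha> / 2"
  have e: "0 < e" "e \<le> 1" using z by (auto simp: e_def)
  have de: "e \<le> d" unfolding d_def e_def using norm_triangle_ineq2[of 1 z] by simp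
  hence d: "0 < d" using e by simp
  have d2: "d \<le> 2" unfolding d_def using norm_triangle_ineq4[of 1 z] z by simp
  have e2: "e \<le> 1 - norm z ^ 2"
    using mult_left_mono[of "norm z" 1 "norm z"] z by (simp add: e_def power2_eq_square)
  have P: "P = (1 - norm z ^ 2) / d ^ 2" "1 + 2 * Re (z / (1 - z)) = P"
    unfolding P_def d_def using Re_Cayley[OF z] by auto
  have Pge: "e / d ^ 2 \<le> P" unfolding P using e2 by (intro divide_right_mono) auto
  have Ppos: "0 < P" using Pge e d by (auto intro: less_le_trans[rotated])
  have \<beta>: "0 \<le> \<beta>" using \<alpha> by (simp add: \<beta>_def)
  have r1: "real (max 1 r) = real (r - 1) + 1" by (cases r) auto
  have gf: "norm (Laguerre_gf (\<alpha> + real r) t z) = d powr (- (\<alpha> + real r + 1)) * exp (- t * Re (z / (1 - z)))"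
    unfolding Laguerre_gf_def d_def by (simp add: norm_mult norm_powr_real_powr' times_divide_eq_right[symmetric] del: times_divide_eq_right)
  have ex: "exp (- t / 2) * exp (- t * Re (z / (1 - z))) = exp (- (t * P / 2))"
    unfolding P(2)[symmetric] by (simp add: exp_add[symmetric] field_simps)
  \<comment> \<open>The maximum of the left side over t has order P^(-\<beta>), and P \<ge> e / d^2
    turns this into e^(-\<beta>) d^\<alpha>. The factor d^\<alpha> then cancels against
    d^(-\<alpha>-r-1) from the generating function.\<close>
  have tb: "t powr \<beta> * exp (- (t * P / 2)) \<le> (\<alpha> + 2) powr \<beta> * ((1 / e) powr \<beta> * d powr \<alpha>)"
  proof -
    have "(t * P / 2) powr \<beta> \<le> (\<beta> + 1) powr \<beta> * exp (t * P / 2)"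
      using t Ppos \<beta> by (intro powr_le_exp) auto
    hence "(t * P / 2) powr \<beta> * exp (- (t * P / 2)) \<le> (\<beta> + 1) powr \<beta>"
      by (simp add: exp_minus field_simps)
    hence le: "(t * P / 2) powr \<beta> * exp (- (t * P / 2)) * (2 / P) powr \<beta> \<le> (\<beta> + 1) powr \<beta> * (2 / P) powr \<beta>"
      by (rule mult_right_mono) auto
    have eq: "(t * P / 2) powr \<beta> * (2 / P) powr \<beta> = t powr \<beta>"
      using t Ppos by (subst powr_mult[symmetric]) auto
    have "t powr \<beta> * exp (- (t * P / 2)) = (t * P / 2) powr \<beta> * exp (- (t * P / 2)) * (2 / P) powr \<beta>"
      unfolding eq[symmetric] by (simp only: mult_ac)
    also note le
    also have "(\<beta> + 1) powr \<beta> * (2 / P) powr \<beta> = (\<alpha> + 2) powr \<beta> * (1 / P) powr \<beta>"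
    proof -
      have "(\<beta> + 1) * (2 / P) = (\<alpha> + 2) * (1 / P)" using Ppos by (simp add: \<beta>_def field_simps)
      thus ?thesis using \<alpha> \<beta> Ppos by (subst (1 2) powr_mult[symmetric]) auto
    qed
    also have "(1 / P) powr \<beta> \<le> (d ^ 2 / e) powr \<beta>"
    proof (rule powr_mono2)
      show "1 / P \<le> d ^ 2 / e" using Pge Ppos d e by (simp add: field_simps)
    qed (use Ppos \<beta> in auto)
    also have "(d ^ 2 / e) powr \<beta> = (1 / e) powr \<beta> * d powr \<alpha>"
    proof -
      have "d ^ 2 = d powr 2" using d by (simp add: powr_numeral)
      hence "(d ^ 2) powr \<beta> = d powr \<alpha>" by (simp add: powr_powr \<beta>_def)
      thus ?thesis using d e by (simp add: powr_divide)
    qed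
    finally show ?thesis by (simp add: mult_left_mono)
  qed
  \<comment> \<open>Two powers of 1/d are kept for the Poisson kernel, since 1/d^2 \<le> P/e; the
    other r - 1 are bounded through e \<le> d. For r = 0 one power is missing and d \<le> 2 supplies
    it.\<close>
  have dr: "d powr (- (real r + 1)) \<le> 2 * (1 / e) powr (real (r - 1)) * (1 / d ^ 2)"
  proof (cases r)
    case 0
    have "d powr (- (real r + 1)) = d * (1 / d ^ 2)"
      using 0 d by (simp add: powr_minus power2_eq_square field_simps)
    also have "\<dots> \<le> 2 * (1 / d ^ 2)" using d2 by (intro mult_right_mono) auto
    finally show ?thesis using 0 e by simp
  next
    case (Suc r')
    have "d powr (- (real r + 1)) = d powr (- real r') * d powr (- 2)"
      by (simp add: Suc powr_add[symmetric] algebra_simps)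
    also have "d powr (- 2) = 1 / d ^ 2" using d by (simp add: powr_minus powr_numeral field_simps)
    also have "d powr (- real r') \<le> e powr (- real r')"
      using de e by (intro powr_mono2') auto
    also have "e powr (- real r') = (1 / e) powr real r'" using e by (simp add: powr_minus powr_divide field_simps)
    also have "(1 / e) powr real r' * (1 / d ^ 2) \<le> 2 * (1 / e) powr (real r') * (1 / d ^ 2)"
      by (intro mult_right_mono) auto
    finally show ?thesis using d by (simp add: Suc divide_right_mono)
  qed
  have "t powr \<beta> * exp (- t / 2) * norm (Laguerre_gf (\<alpha> + real r) t z)
      = (t powr \<beta> * exp (- (t * P / 2))) * d powr (- (\<alpha> + real r + 1))"
    unfolding gf ex[symmetric] by (simp add: mult_ac)
  also have "\<dots> \<le> ((\<alpha> + 2) powr \<beta> * ((1 / e) powr \<beta> * d powr \<alpha>)) * d powr (- (\<alpha> + real r + 1))"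
    by (intro mult_right_mono tb) auto
  also have "\<dots> = (\<alpha> + 2) powr \<beta> * (1 / e) powr \<beta> * d powr (- (real r + 1))"
    by (simp add: mult.assoc powr_add[symmetric])
  also have "\<dots> \<le> (\<alpha> + 2) powr \<beta> * (1 / e) powr \<beta> * (2 * (1 / e) powr (real (r - 1)) * (1 / d ^ 2))"
    by (intro mult_left_mono dr) auto
  also have "1 / d ^ 2 \<le> (1 / e) * P" using Pge e d by (simp add: field_simps)
  also have "(\<alpha> + 2) powr \<beta> * (1 / e) powr \<beta> * (2 * (1 / e) powr (real (r - 1)) * ((1 / e) * P))
     = 2 * (\<alpha> + 2) powr \<beta> * (1 / e) powr (\<beta> + real (max 1 r)) * P"
    using e unfolding r1 by (simp add: powr_add)
  finally show ?thesis by (simp add: \<beta>_def e_def P_def mult_left_mono)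
qed

theorem Laguerre_weighted_bound:
  assumes \<alpha>: "0 \<le> \<alpha>"
  obtains C where "C > 0"
    "\<And>n t. 0 < t \<Longrightarrow> t powr (\<alpha> / 2) * exp (- t / 2) * \<bar>Laguerre (\<alpha> + real r) n t\<bar>
        \<le> C * real (n + 1) powr (\<alpha> / 2 + real (max 1 r))"
proof -
  define \<gamma> where "\<gamma> = \<alpha> / 2 + real (max 1 r)"
  define K where "K = 2 * (\<alpha> + 2) powr (\<alpha> / 2)"
  have \<gamma>: "0 \<le> \<gamma>" using \<alpha> by (simp add: \<gamma>_def)
  have K: "K > 0" using \<alpha> by (simp add: K_def)
  show ?thesis
  proof
    show "exp 1 * K * 2 powr \<gamma> > 0" using K by simp
    fix n :: nat and t :: real
    assume t: "0 < t"
    define c where "c = t powr (\<alpha> / 2) * exp (- t / 2)"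
    \<comment> \<open>With this radius 1 / (1 - \<rho>) = n + 2, the base of the power in the
      pointwise estimate, while the factor \<rho>^(-n) from Cauchy's formula stays below e.\<close>
    define \<rho> where "\<rho> = real (n + 1) / real (n + 2)"
    define g where "g x = of_real \<rho> * exp (2 * of_real pi * \<i> * of_real x)" for x :: real
    let ?F = "Laguerre_gf (\<alpha> + real r) t"
    have \<rho>: "0 < \<rho>" "\<rho> < 1" by (auto simp: \<rho>_def)
    have ng: "norm (g x) = \<rho>" for x using \<rho> by (simp add: g_def norm_mult)
    have "1 / (1 - \<rho>) = real (n + 2)" by (simp add: \<rho>_def field_simps)
    hence bnd: "c * norm (?F (g x)) \<le> K * real (n + 2) powr \<gamma> * Re ((1 + g x) / (1 - g x))" for x
      using norm_Laguerre_gf_bound[OF \<alpha> t, of "g x" r] \<rho> by (simp only: ng c_def K_def \<gamma>_def)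
    have c: "c \<ge> 0" by (simp add: c_def)
    have I1: "((\<lambda>x. ?F (g x) / g x ^ n) has_integral of_real (Laguerre (\<alpha> + real r) n t)) {0..1}"
      using has_integral_circle_coefficient[OF holomorphic_Laguerre_gf \<rho>, of "\<alpha> + real r" t n] \<alpha>
      by (simp add: g_def deriv_Laguerre_gf)
    \<comment> \<open>The Poisson kernel is the real part of a holomorphic function with value 1 at
      0, so its mean is 1 and integration adds no further power of n.\<close>
    have "(\<lambda>z. (1 + z) / (1 - z)) holomorphic_on ball 0 1"
      by (intro holomorphic_intros) auto
    from has_integral_circle_coefficient[OF this \<rho>, of 0]
    have "((\<lambda>x. (1 + g x) / (1 - g x)) has_integral 1) {0..1}"
      by (simp add: g_def)
    hence "((\<lambda>x. Re ((1 + g x) / (1 - g x))) has_integral Re 1) {0..1}"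
      by (rule has_integral_Re)
    hence "((\<lambda>x. K * real (n + 2) powr \<gamma> * (1 / \<rho>) ^ n * Re ((1 + g x) / (1 - g x))) has_integral
        K * real (n + 2) powr \<gamma> * (1 / \<rho>) ^ n * Re 1) {0..1}"
      by (rule has_integral_mult_right)
    moreover have "((\<lambda>x. of_real c * (?F (g x) / g x ^ n)) has_integral of_real c * of_real (Laguerre (\<alpha> + real r) n t)) {0..1}"
      using I1 by (rule has_integral_mult_right)
    moreover have "norm (of_real c * (?F (g x) / g x ^ n)) \<le> K * real (n + 2) powr \<gamma> * (1 / \<rho>) ^ n * Re ((1 + g x) / (1 - g x))" for x
      using mult_right_mono[OF bnd[of x], of "(1 / \<rho>) ^ n"] c \<rho>
      by (simp add: norm_mult norm_divide norm_power ng power_divide mult_ac)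
    ultimately have "norm (of_real c * of_real (Laguerre (\<alpha> + real r) n t) :: complex)
       \<le> K * real (n + 2) powr \<gamma> * (1 / \<rho>) ^ n * Re 1"
      using integral_norm_bound_integral by (metis (no_types, lifting) has_integral_iff)
    hence "c * \<bar>Laguerre (\<alpha> + real r) n t\<bar> \<le> K * real (n + 2) powr \<gamma> * (1 / \<rho>) ^ n"
      using c by (simp add: norm_mult)
    also have "(1 / \<rho>) ^ n \<le> exp 1"
    proof -
      have "1 / \<rho> \<le> exp (1 / real (n + 1))"
        using exp_ge_add_one_self[of "1 / real (n + 1)"] by (simp add: \<rho>_def field_simps)
      hence "(1 / \<rho>) ^ n \<le> exp (1 / real (n + 1)) ^ n" using \<rho> by (intro power_mono) auto
      also have "\<dots> = exp (real n * (1 / real (n + 1)))" by (rule exp_of_nat_mult[symmetric])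
      also have "\<dots> \<le> exp 1" by (simp add: field_simps)
      finally show ?thesis .
    qed
    also have "real (n + 2) powr \<gamma> \<le> (2 * real (n + 1)) powr \<gamma>"
      using \<gamma> by (intro powr_mono2) auto
    also have "(2 * real (n + 1)) powr \<gamma> = 2 powr \<gamma> * real (n + 1) powr \<gamma>"
      by (rule powr_mult; simp)
    finally show "t powr (\<alpha> / 2) * exp (- t / 2) * \<bar>Laguerre (\<alpha> + real r) n t\<bar>
        \<le> exp 1 * K * 2 powr \<gamma> * real (n + 1) powr (\<alpha> / 2 + real (max 1 r))"
      using K by (simp add: c_def \<gamma>_def mult_ac mult_left_mono mult_right_mono)
  qed
qed

section \<open>Derivatives of the orthonormal system\<close>

text \<open>Each derivative lowers the degree and raises the parameter by one. The case k < j is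
  separate because truncated subtraction would leave the constant
  \<open>Laguerre (\<alpha> + real j) 0\<close> where the derivative is 0.\<close>

lemma deriv_funpow_ell:
  "(deriv ^^ j) (ell \<alpha> k) = (\<lambda>t. if k < j then 0
      else (-1) ^ j * Laguerre (\<alpha> + real j) (k - j) t / sqrt (gamma_ratio \<alpha> k))"
proof (induction j)
  case 0
  show ?case by (simp add: ell_gamma_ratio fun_eq_iff)
next
  case (Suc j)
  show ?case
  proof (cases "k < j")
    case True
    thus ?thesis by (simp add: Suc.IH)
  next
    case False
    show ?thesis
    proof (cases "k = j")
      case True
      thus ?thesis unfolding funpow.simps o_def Suc.IH by simp
    next
      case neq: False
      define m where "m = k - Suc j"
      have k: "k - j = Suc m" using False neq by (simp add: m_def)
      have "((\<lambda>t. (-1) ^ j * Laguerre (\<alpha> + real j) (Suc m) t / sqrt (gamma_ratio \<alpha> k))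
        has_real_derivative (-1) ^ j * (- Laguerre (\<alpha> + real j + 1) m t) / sqrt (gamma_ratio \<alpha> k)) (at t)" for t
        by (intro DERIV_cdivide DERIV_cmult DERIV_Laguerre)
      from DERIV_imp_deriv[OF this] show ?thesis
        using False neq by (simp add: Suc.IH k m_def[symmetric] add_ac fun_eq_iff)
    qed
  qed
qed

lemma DERIV_funpow_ell:
  "((deriv ^^ j) (ell \<alpha> k) has_real_derivative (deriv ^^ Suc j) (ell \<alpha> k) t) (at t)"
proof -
  have "(deriv ^^ j) (ell \<alpha> k) field_differentiable (at t)"
  proof (cases "k < j")
    case False
    have "\<exists>D. (Laguerre (\<alpha> + real j) (k - j) has_real_derivative D) (at t)"
    proof (cases "k - j")
      case 0
      have "Laguerre (\<alpha> + real j) 0 = (\<lambda>t. 1)" by (rule ext) simp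
      thus ?thesis unfolding 0 using DERIV_const by metis
    qed (use DERIV_Laguerre in \<open>simp, blast\<close>)
    then obtain D where "(Laguerre (\<alpha> + real j) (k - j) has_real_derivative D) (at t)" ..
    hence "((\<lambda>t. (-1) ^ j * Laguerre (\<alpha> + real j) (k - j) t / sqrt (gamma_ratio \<alpha> k))
       has_real_derivative ((-1) ^ j * D / sqrt (gamma_ratio \<alpha> k))) (at t)"
      by (intro DERIV_cdivide DERIV_cmult)
    thus ?thesis using False by (auto simp: deriv_funpow_ell field_differentiable_def)
  qed (auto simp: deriv_funpow_ell)
  thus ?thesis by (simp add: DERIV_deriv_iff_field_differentiable)
qed

lemma sqrt_weight: "0 < t \<Longrightarrow> sqrt (weight \<alpha> t) = t powr (\<alpha> / 2) * exp (- t / 2)"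
  by (simp add: weight_def real_sqrt_mult powr_half_sqrt[symmetric] powr_powr exp_powr_real)

text \<open>The normalisation divides by the square root of \<open>gamma_ratio\<close>, of order (k
  + 1)^(\<alpha>/2), and this removes exactly the part \<alpha>/2 of the exponent in
  \<open>Laguerre_weighted_bound\<close>.\<close>

theorem deriv_ell_weighted_bound:
  assumes \<alpha>: "0 \<le> \<alpha>"
  obtains C where "C > 0"
    "\<And>k t. 0 < t \<Longrightarrow> \<bar>(deriv ^^ j) (ell \<alpha> k) t\<bar> * sqrt (weight \<alpha> t) \<le> C * real (k + 1) ^ max 1 j"
proof -
  obtain C where C: "C > 0" "\<And>n t. 0 < t \<Longrightarrow> t powr (\<alpha> / 2) * exp (- t / 2) * \<bar>Laguerre (\<alpha> + real j) n t\<bar>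
        \<le> C * real (n + 1) powr (\<alpha> / 2 + real (max 1 j))"
    using Laguerre_weighted_bound[OF \<alpha>, of j] by blast
  obtain c D where c: "c > 0" "\<And>k. c * real (k + 1) powr \<alpha> \<le> gamma_ratio \<alpha> k"
    using gamma_ratio_bounds[OF \<alpha>] by metis
  show ?thesis
  proof
    show "C / sqrt c > 0" using C c by simp
    fix k :: nat and t :: real
    assume t: "0 < t"
    show "\<bar>(deriv ^^ j) (ell \<alpha> k) t\<bar> * sqrt (weight \<alpha> t) \<le> C / sqrt c * real (k + 1) ^ max 1 j"
    proof (cases "k < j")
      case True
      thus ?thesis using C c by (simp add: deriv_funpow_ell)
    next
      case False
      have "sqrt (c * real (k + 1) powr \<alpha>) \<le> sqrt (gamma_ratio \<alpha> k)" using c by simp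
      also have "sqrt (c * real (k + 1) powr \<alpha>) = sqrt c * real (k + 1) powr (\<alpha> / 2)"
        by (simp add: real_sqrt_mult powr_half_sqrt[symmetric] powr_powr)
      finally have g: "sqrt c * real (k + 1) powr (\<alpha> / 2) \<le> sqrt (gamma_ratio \<alpha> k)" .
      have gpos: "sqrt c * real (k + 1) powr (\<alpha> / 2) > 0" using c by simp
      have "\<bar>(deriv ^^ j) (ell \<alpha> k) t\<bar> * sqrt (weight \<alpha> t)
        = (t powr (\<alpha> / 2) * exp (- t / 2) * \<bar>Laguerre (\<alpha> + real j) (k - j) t\<bar>) / sqrt (gamma_ratio \<alpha> k)"
        using False t gamma_ratio_pos[OF \<alpha>, of k]
        by (simp add: deriv_funpow_ell sqrt_weight abs_mult mult_ac)
      also have "\<dots> \<le> (C * real (k - j + 1) powr (\<alpha> / 2 + real (max 1 j))) / (sqrt c * real (k + 1) powr (\<alpha> / 2))"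
        using C t g gpos by (intro frac_le) auto
      also have "\<dots> \<le> (C * real (k + 1) powr (\<alpha> / 2 + real (max 1 j))) / (sqrt c * real (k + 1) powr (\<alpha> / 2))"
        using C c \<alpha> by (intro divide_right_mono mult_left_mono powr_mono2) auto
      also have "\<dots> = C / sqrt c * real (k + 1) ^ max 1 j"
        by (simp add: powr_add powr_realpow del: of_nat_max)
      finally show ?thesis .
    qed
  qed
qed


section \<open>Completeness\<close>

text \<open>Weierstrass approximation in the variable u = exp (- t). Because H vanishes for t \<le>
  0, only u in [0, 1] counts, so the whole half-line is covered by uniform approximation on a
  compact interval.\<close>

lemma integral_continuous_of_exp_eq_0:
  fixes H \<phi> :: "real \<Rightarrow> real"
  assumes H: "integrable lborel H" and H0: "\<And>t. t \<le> 0 \<Longrightarrow> H t = 0"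
    and mom: "\<And>m. (\<integral>t. H t * exp (- t) ^ m \<partial>lborel) = 0"
    and cont: "continuous_on UNIV \<phi>"
  shows "(\<integral>t. H t * \<phi> (exp (- t)) \<partial>lborel) = 0"
proof -
  have [measurable]: "H \<in> borel_measurable borel" using H by auto
  have [measurable]: "\<phi> \<in> borel_measurable borel" using cont by (rule borel_measurable_continuous_onI)
  have int: "integrable lborel (\<lambda>t. H t * \<psi> (exp (- t)))"
    if \<psi>: "continuous_on UNIV \<psi>" for \<psi> :: "real \<Rightarrow> real"
  proof -
    have [measurable]: "\<psi> \<in> borel_measurable borel" using \<psi> by (rule borel_measurable_continuous_onI)
    have "compact (\<psi> ` {0..1})" using \<psi> by (intro compact_continuous_image continuous_on_subset[OF \<psi>]) auto
    then obtain B where B: "\<And>u. u \<in> {0..1} \<Longrightarrow> norm (\<psi> u) \<le> B"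
      by (meson compact_imp_bounded bounded_iff imageI)
    show ?thesis
    proof (rule Bochner_Integration.integrable_bound)
      show "integrable lborel (\<lambda>t. B * H t)" using H by simp
      show "AE t in lborel. norm (H t * \<psi> (exp (- t))) \<le> norm (B * H t)"
      proof (rule AE_I2)
        fix t :: real
        show "norm (H t * \<psi> (exp (- t))) \<le> norm (B * H t)"
        proof (cases "t \<le> 0")
          case False
          hence "norm (\<psi> (exp (- t))) \<le> B" by (intro B) auto
          hence "norm (\<psi> (exp (- t))) \<le> norm B" by simp
          from mult_right_mono[OF this, of "norm (H t)"] show ?thesis by (simp add: abs_mult mult_ac)
        qed (simp add: H0)
      qed
    qed measurable
  qed
  have "norm (\<integral>t. H t * \<phi> (exp (- t)) \<partial>lborel) \<le> e * (\<integral>t. \<bar>H t\<bar> \<partial>lborel)" if e: "e > 0" for e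
  proof -
    obtain p where p: "real_polynomial_function p" "\<And>u. u \<in> {0..1} \<Longrightarrow> \<bar>\<phi> u - p u\<bar> < e"
      using Stone_Weierstrass_real_polynomial_function[of "{0..1::real}" \<phi> e] e
        continuous_on_subset[OF cont] by auto
    then obtain a n where pa: "p = (\<lambda>x. \<Sum>i\<le>n. a i * x ^ i)"
      using real_polynomial_function_iff_sum by auto
    have int_power: "integrable lborel (\<lambda>t. H t * exp (- t) ^ i)" for i
      by (rule int) (intro continuous_intros)
    have contp: "continuous_on UNIV p" unfolding pa by (intro continuous_intros)
    have "(\<integral>t. H t * p (exp (- t)) \<partial>lborel) = (\<integral>t. (\<Sum>i\<le>n. a i * (H t * exp (- t) ^ i)) \<partial>lborel)"
      unfolding pa by (simp add: sum_distrib_left mult_ac)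
    also have "\<dots> = (\<Sum>i\<le>n. a i * (\<integral>t. H t * exp (- t) ^ i \<partial>lborel))"
      using int_power by simp
    also have "\<dots> = 0" by (simp add: mom)
    finally have "(\<integral>t. H t * \<phi> (exp (- t)) \<partial>lborel)
        = (\<integral>t. H t * \<phi> (exp (- t)) \<partial>lborel) - (\<integral>t. H t * p (exp (- t)) \<partial>lborel)" by simp
    also have "\<dots> = (\<integral>t. H t * \<phi> (exp (- t)) - H t * p (exp (- t)) \<partial>lborel)"
      by (rule Bochner_Integration.integral_diff[symmetric]) (intro int cont contp)+
    also have "norm \<dots> \<le> (\<integral>t. norm (H t * \<phi> (exp (- t)) - H t * p (exp (- t))) \<partial>lborel)"
      by (rule integral_norm_bound)
    also have "\<dots> \<le> (\<integral>t. e * \<bar>H t\<bar> \<partial>lborel)"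
    proof (rule integral_mono)
      show "integrable lborel (\<lambda>t. norm (H t * \<phi> (exp (- t)) - H t * p (exp (- t))))"
        by (intro integrable_norm Bochner_Integration.integrable_diff int cont contp)
      show "integrable lborel (\<lambda>t. e * \<bar>H t\<bar>)" using H by simp
      fix t :: real
      show "norm (H t * \<phi> (exp (- t)) - H t * p (exp (- t))) \<le> e * \<bar>H t\<bar>"
      proof (cases "t \<le> 0")
        case False
        hence "\<bar>\<phi> (exp (- t)) - p (exp (- t))\<bar> \<le> e" by (intro less_imp_le p(2)) auto
        from mult_left_mono[OF this, of "\<bar>H t\<bar>"] show ?thesis
          by (simp add: abs_mult[symmetric] algebra_simps)
      qed (simp add: H0)
    qed
    finally show ?thesis by simp
  qed
  moreover have "((\<lambda>e. e * (\<integral>t. \<bar>H t\<bar> \<partial>lborel)) \<longlongrightarrow> 0 * (\<integral>t. \<bar>H t\<bar> \<partial>lborel)) (at_right 0)"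
    by (intro tendsto_intros)
  ultimately have "norm (\<integral>t. H t * \<phi> (exp (- t)) \<partial>lborel) \<le> 0 * (\<integral>t. \<bar>H t\<bar> \<partial>lborel)"
    by (intro tendsto_lowerbound[where F = "at_right (0::real)"]) (auto simp: eventually_at_right_less eventually_at_filter)
  thus ?thesis by simp
qed

text \<open>Vanishing moments pass to continuous functions of exp (- t), and from these to
  indicators of half-lines by dominated convergence. A density whose integral over every half-line
  vanishes is zero.\<close>

lemma AE_eq_0_if_exp_moments_eq_0:
  fixes H :: "real \<Rightarrow> real"
  assumes H: "integrable lborel H" and H0: "\<And>t. t \<le> 0 \<Longrightarrow> H t = 0"
    and mom: "\<And>m. (\<integral>t. H t * exp (- t) ^ m \<partial>lborel) = 0"
  shows "AE t in lborel. H t = 0"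
proof -
  have [measurable]: "H \<in> borel_measurable borel" using H by auto
  have tail: "(\<integral>t. H t * indicator {x<..} t \<partial>lborel) = 0" for x
  proof -
    \<comment> \<open>Continuous ramps in u = exp (- t) that increase to the indicator of u < exp (-
      x), that is, of the half-line t > x.\<close>
    define \<phi> where "\<phi> n u = min 1 (max 0 (real n * (exp (- x) - u)))" for n u
    have "(\<lambda>n. \<integral>t. H t * \<phi> n (exp (- t)) \<partial>lborel) \<longlonglongrightarrow> (\<integral>t. H t * indicator {x<..} t \<partial>lborel)"
    proof (rule integral_dominated_convergence)
      show "integrable lborel (\<lambda>t. \<bar>H t\<bar>)" using H by simp
      show "(\<lambda>t. H t * \<phi> n (exp (- t))) \<in> borel_measurable lborel" for n
        unfolding \<phi>_def by measurable
      show "AE t in lborel. norm (H t * \<phi> n (exp (- t))) \<le> \<bar>H t\<bar>" for n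
        by (intro AE_I2) (auto simp: \<phi>_def abs_mult intro: mult_left_le)
      show "AE t in lborel. (\<lambda>n. H t * \<phi> n (exp (- t))) \<longlonglongrightarrow> H t * indicator {x<..} t"
      proof (rule AE_I2)
        fix t :: real
        have "(\<lambda>n. \<phi> n (exp (- t))) \<longlonglongrightarrow> indicator {x<..} t"
        proof (cases "x < t")
          case True
          define d where "d = exp (- x) - exp (- t)"
          have d: "d > 0" using True by (simp add: d_def)
          have "eventually (\<lambda>n. \<phi> n (exp (- t)) = 1) sequentially"
            using eventually_ge_at_top[of "nat \<lceil>1 / d\<rceil>"]
          proof eventually_elim
            case (elim n)
            hence "1 / d \<le> real n" by linarith
            hence "1 \<le> real n * d" using d by (simp add: field_simps)
            thus ?case by (simp add: \<phi>_def d_def)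
          qed
          thus ?thesis using True by (simp add: tendsto_eventually)
        next
          case False
          hence "exp (- x) - exp (- t) \<le> 0" by simp
          hence "\<phi> n (exp (- t)) = 0" for n
            using mult_nonneg_nonpos[of "real n" "exp (- x) - exp (- t)"] by (simp add: \<phi>_def)
          thus ?thesis using False by simp
        qed
        thus "(\<lambda>n. H t * \<phi> n (exp (- t))) \<longlonglongrightarrow> H t * indicator {x<..} t"
          by (intro tendsto_intros)
      qed
    qed measurable
    moreover have "(\<integral>t. H t * \<phi> n (exp (- t)) \<partial>lborel) = 0" for n
    proof (rule integral_continuous_of_exp_eq_0[OF H _ mom])
      show "continuous_on UNIV (\<phi> n)" unfolding \<phi>_def[abs_def] by (intro continuous_intros)
    qed (rule H0)
    ultimately show ?thesis using LIMSEQ_unique[OF _ tendsto_const] by fastforce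
  qed
  have intmax: "integrable lborel (\<lambda>t. max 0 (s * H t) * indicator {x<..} t)" for x s
  proof (rule Bochner_Integration.integrable_bound)
    show "integrable lborel (\<lambda>t. s * H t)" using H by simp
    show "AE t in lborel. norm (max 0 (s * H t) * indicator {x<..} t) \<le> norm (s * H t)"
      by (intro AE_I2) (auto simp: max_def split: split_indicator)
  qed measurable
  have em: "emeasure (density lborel (\<lambda>t. ennreal (s * H t))) {x<..}
      = ennreal (\<integral>t. max 0 (s * H t) * indicator {x<..} t \<partial>lborel)" for x s
  proof -
    have "emeasure (density lborel (\<lambda>t. ennreal (s * H t))) {x<..}
       = (\<integral>\<^sup>+t. ennreal (max 0 (s * H t) * indicator {x<..} t) \<partial>lborel)"
      by (subst emeasure_density) (auto intro!: nn_integral_cong simp: ennreal_neg max_def split: split_indicator)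
    also have "\<dots> = ennreal (\<integral>t. max 0 (s * H t) * indicator {x<..} t \<partial>lborel)"
      by (intro nn_integral_eq_integral intmax) auto
    finally show ?thesis .
  qed
  \<comment> \<open>As \<open>ennreal\<close> truncates at 0, the two densities are the positive and
    the negative part of H. Their measures are finite and equal on every \<open>{x<..}\<close>,
    hence identical.\<close>
  have "density lborel (\<lambda>t. ennreal (1 * H t)) = density lborel (\<lambda>t. ennreal (- 1 * H t))"
  proof (rule measure_eqI_lessThan)
    fix x
    have "(\<integral>t. max 0 (1 * H t) * indicator {x<..} t \<partial>lborel) - (\<integral>t. max 0 (- 1 * H t) * indicator {x<..} t \<partial>lborel)
       = (\<integral>t. max 0 (1 * H t) * indicator {x<..} t - max 0 (- 1 * H t) * indicator {x<..} t \<partial>lborel)"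
      by (rule Bochner_Integration.integral_diff[symmetric]) (rule intmax)+
    also have "\<dots> = (\<integral>t. H t * indicator {x<..} t \<partial>lborel)"
      by (intro Bochner_Integration.integral_cong) (auto split: split_indicator)
    finally show "emeasure (density lborel (\<lambda>t. ennreal (1 * H t))) {x<..}
      = emeasure (density lborel (\<lambda>t. ennreal (- 1 * H t))) {x<..}"
      unfolding em tail by simp
    show "emeasure (density lborel (\<lambda>t. ennreal (1 * H t))) {x<..} < \<infinity>"
      unfolding em by simp
  qed auto
  hence "AE t in lborel. ennreal (1 * H t) = ennreal (- 1 * H t)"
    by (intro sigma_finite_measure.density_unique[OF sigma_finite_lborel]) auto
  thus ?thesis
    by eventually_elim (metis ennreal_eq_0_iff ennreal_neg le_cases mult_minus1 mult_1 neg_0_le_iff_le neg_le_0_iff_le order_antisym)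
qed

text \<open>At t = 0 the Laguerre polynomial equals \<open>gamma_ratio\<close> up to a constant, so
  the generating function sums \<open>gamma_ratio\<close> itself, and sqrt x \<le> 1 + x does the
  rest. The series is the majorant for integrating the generating function term by term.\<close>

lemma summable_sqrt_gamma_ratio:
  assumes "0 \<le> \<alpha>" "0 \<le> z" "z < 1"
  shows "summable (\<lambda>n. sqrt (gamma_ratio \<alpha> n) * z ^ n)"
proof -
  have "Gamma (\<alpha> + 1) > 0" using assms by simp
  moreover have "Laguerre \<alpha> n 0 = gamma_ratio \<alpha> n / Gamma (\<alpha> + 1)" for n
    using assms sum.delta[of "{..n}" 0 "\<lambda>i. gamma_ratio \<alpha> n / Gamma (\<alpha> + 1)"]
    by (simp add: Laguerre_Gamma power_0_left if_distrib cong: if_cong)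
  ultimately have "Gamma (\<alpha> + 1) * (Laguerre \<alpha> n 0 * z ^ n) = gamma_ratio \<alpha> n * z ^ n" for n
    by simp
  moreover have "summable (\<lambda>n. Gamma (\<alpha> + 1) * (Laguerre \<alpha> n 0 * z ^ n))"
    using Laguerre_generating_function_real[of \<alpha> z 0] assms by (intro summable_mult) (auto simp: sums_iff)
  ultimately have "summable (\<lambda>n. gamma_ratio \<alpha> n * z ^ n)" by (simp only:)
  hence "summable (\<lambda>n. z ^ n + gamma_ratio \<alpha> n * z ^ n)"
    using assms by (intro summable_add summable_geometric) auto
  thus ?thesis
  proof (rule summable_comparison_test')
    fix n
    have g: "0 < gamma_ratio \<alpha> n" using gamma_ratio_pos[OF assms(1)] .
    have "sqrt (gamma_ratio \<alpha> n) \<le> 1 + gamma_ratio \<alpha> n"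
      using arith_geo_mean_sqrt[of 1 "gamma_ratio \<alpha> n"] g by simp
    from mult_right_mono[OF this, of "z ^ n"] show
      "norm (sqrt (gamma_ratio \<alpha> n) * z ^ n) \<le> z ^ n + gamma_ratio \<alpha> n * z ^ n"
      using assms g by (simp add: distrib_right)
  qed
qed

text \<open>The hypotheses ask for integrals bounded uniformly in n rather than for h in
  \<open>L2w\<close>: h will be the difference between f and its Laguerre series, and square
  integrability of the series is never established. The bound B, against the geometric factor z^n,
  is what allows integration of the generating function term by term.\<close>

lemma Laguerre_complete:
  assumes \<alpha>: "0 \<le> \<alpha>"
    and int: "\<And>n. integrable (lebesgue_on {0<..}) (\<lambda>t. weight \<alpha> t * h t * ell \<alpha> n t)"
    and bnd: "\<And>n. (\<integral>t. \<bar>weight \<alpha> t * h t * ell \<alpha> n t\<bar> \<partial>lebesgue_on {0<..}) \<le> B"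
    and zero: "\<And>n. (\<integral>t. weight \<alpha> t * h t * ell \<alpha> n t \<partial>lebesgue_on {0<..}) = 0"
  shows "AE t in lebesgue_on {0<..}. h t = 0"
proof -
  let ?M = "lebesgue_on {0<..} :: real measure"
  have ell: "Laguerre \<alpha> n t = sqrt (gamma_ratio \<alpha> n) * ell \<alpha> n t" for n t
    using gamma_ratio_pos[OF \<alpha>, of n] by (simp add: ell_gamma_ratio)
  have "integrable ?M (\<lambda>t. sqrt (gamma_ratio \<alpha> 0) * (weight \<alpha> t * h t * ell \<alpha> 0 t))"
    using int by simp
  also have "(\<lambda>t. sqrt (gamma_ratio \<alpha> 0) * (weight \<alpha> t * h t * ell \<alpha> 0 t)) = (\<lambda>t. weight \<alpha> t * h t)"
    using ell[of 0] by (auto simp: mult_ac fun_eq_iff)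
  finally have wh: "integrable ?M (\<lambda>t. weight \<alpha> t * h t)" .
  have mom: "(\<integral>t. weight \<alpha> t * h t * exp (- t) ^ m \<partial>?M) = 0" for m :: nat
  proof -
    \<comment> \<open>Chosen so that z / (1 - z) = m, which makes the generating function a constant
      multiple of exp (- t) ^ m.\<close>
    define z where "z = real m / (1 + real m)"
    have z: "0 \<le> z" "z < 1" "z / (1 - z) = real m" by (auto simp: z_def field_simps)
    define g where "g n t = weight \<alpha> t * h t * (Laguerre \<alpha> n t * z ^ n)" for n t
    have g: "g n t = (sqrt (gamma_ratio \<alpha> n) * z ^ n) * (weight \<alpha> t * h t * ell \<alpha> n t)" for n t
      unfolding g_def ell by simp
    have gint: "integrable ?M (g n)" for n unfolding g[abs_def] using int by simp
    have gnorm: "(\<integral>t. norm (g n t) \<partial>?M) \<le> sqrt (gamma_ratio \<alpha> n) * z ^ n * B" for n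
      unfolding g using bnd[of n] z gamma_ratio_pos[OF \<alpha>, of n]
      by (simp add: abs_mult mult_left_mono)
    have s1: "AE t in ?M. summable (\<lambda>n. norm (g n t))"
    proof (rule AE_I2)
      fix t :: real
      \<comment> \<open>A power series converging at the larger radius (1 + z) / 2 < 1 converges
        absolutely at z.\<close>
      have "summable (\<lambda>n. Laguerre \<alpha> n t * ((1 + z) / 2) ^ n)"
        using Laguerre_generating_function_real[OF \<alpha>, of "(1 + z) / 2" t] z by (auto simp: sums_iff)
      hence "summable (\<lambda>n. norm (Laguerre \<alpha> n t * z ^ n))"
        by (rule powser_insidea) (use z in auto)
      hence "summable (\<lambda>n. norm (weight \<alpha> t * h t) * norm (Laguerre \<alpha> n t * z ^ n))"
        by (rule summable_mult)
      thus "summable (\<lambda>n. norm (g n t))" by (simp only: g_def norm_mult)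
    qed
    have s2: "summable (\<lambda>n. \<integral>t. norm (g n t) \<partial>?M)"
      by (rule summable_comparison_test'[OF summable_mult2[OF summable_sqrt_gamma_ratio[OF \<alpha> z(1,2)]]])
         (use gnorm in \<open>auto simp: integral_nonneg_AE\<close>)
    have "(\<integral>t. (\<Sum>n. g n t) \<partial>?M) = (\<Sum>n. \<integral>t. g n t \<partial>?M)"
      by (rule integral_suminf[OF gint s1 s2])
    also have "\<dots> = 0" unfolding g using zero by simp
    finally have "(\<integral>t. (\<Sum>n. g n t) \<partial>?M) = 0" .
    moreover have "(\<Sum>n. g n t) = (1 - z) powr (- (\<alpha> + 1)) * (weight \<alpha> t * h t * exp (- t) ^ m)" for t
    proof -
      have "(\<lambda>n. g n t) sums (weight \<alpha> t * h t * ((1 - z) powr (- (\<alpha> + 1)) * exp (- (t * z / (1 - z)))))"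
        unfolding g_def using z by (intro sums_mult Laguerre_generating_function_real \<alpha>) auto
      moreover have "exp (- (t * z / (1 - z))) = exp (- t) ^ m"
        unfolding times_divide_eq_right[symmetric] z by (simp add: exp_of_nat_mult[symmetric] mult_ac)
      ultimately show ?thesis by (simp add: sums_iff mult_ac)
    qed
    ultimately have "(1 - z) powr (- (\<alpha> + 1)) * (\<integral>t. weight \<alpha> t * h t * exp (- t) ^ m \<partial>?M) = 0"
      by simp
    thus ?thesis using z by simp
  qed
  \<comment> \<open>The moment lemma speaks of Borel functions and \<open>lborel\<close>, but the
    data are Lebesgue measurable. Hence weight * h is extended by 0 and then changed on a null set
    into a Borel function H.\<close>
  define G where "G t = indicator {0<..} t * (weight \<alpha> t * h t)" for t :: real
  have G: "integrable lebesgue G"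
    using wh by (simp add: integrable_restrict_space G_def[abs_def])
  then obtain G1 where G1[measurable]: "G1 \<in> borel_measurable lborel" "AE t in lborel. G t = G1 t"
    using completion_ex_borel_measurable_real[of G lborel] by auto
  define H where "H t = (if t \<le> 0 then 0 else G1 t)" for t :: real
  have Hm[measurable]: "H \<in> borel_measurable lborel" unfolding H_def[abs_def] by measurable
  have GH: "AE t in lborel. G t = H t"
    using G1(2) by eventually_elim (auto simp: G_def H_def)
  hence GH': "AE t in lebesgue. G t = H t" by (rule AE_completion)
  have HL: "H \<in> borel_measurable lebesgue" using Hm by (rule measurable_completion)
  have "AE t in lborel. H t = 0"
  proof (rule AE_eq_0_if_exp_moments_eq_0)
    have "integrable lebesgue H"
      using G GH' HL by (subst integrable_cong_AE[of H lebesgue G]) auto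
    thus "integrable lborel H" using Hm by (simp add: integrable_completion)
    show "H t = 0" if "t \<le> 0" for t using that by (simp add: H_def)
    fix m :: nat
    have "(\<integral>t. H t * exp (- t) ^ m \<partial>lborel) = (\<integral>t. H t * exp (- t) ^ m \<partial>lebesgue)"
      by (rule integral_completion[symmetric]) measurable
    also have "\<dots> = (\<integral>t. G t * exp (- t) ^ m \<partial>lebesgue)"
    proof (rule integral_cong_AE)
      have e: "(\<lambda>t::real. exp (- t) ^ m) \<in> borel_measurable lebesgue"
        by (rule measurable_completion) measurable
      show "(\<lambda>t. H t * exp (- t) ^ m) \<in> borel_measurable lebesgue" by (intro borel_measurable_times HL e)
      show "(\<lambda>t. G t * exp (- t) ^ m) \<in> borel_measurable lebesgue"
        by (intro borel_measurable_times borel_measurable_integrable[OF G] e)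
      show "AE t in lebesgue. H t * exp (- t) ^ m = G t * exp (- t) ^ m"
        using GH' by eventually_elim simp
    qed
    also have "\<dots> = (\<integral>t. weight \<alpha> t * h t * exp (- t) ^ m \<partial>?M)"
      by (subst integral_restrict_space) (auto simp: G_def mult_ac)
    finally show "(\<integral>t. H t * exp (- t) ^ m \<partial>lborel) = 0" by (simp add: mom)
  qed
  hence "AE t in lebesgue. H t = 0" by (rule AE_completion)
  with GH' have "AE t in lebesgue. t \<in> {0<..} \<longrightarrow> h t = 0"
    by eventually_elim (use weight_pos[of _ \<alpha>] in \<open>force simp: G_def indicator_def\<close>)
  thus ?thesis by (simp add: AE_restrict_space_iff)
qed


section \<open>Derivatives of Laguerre series\<close>

text \<open>The weight tends to 0 at infinity and, for \<alpha> > 0, at 0, so weighted estimates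
  become unweighted ones only locally. The interval (t/2, 2t) is the neighbourhood of t on which the
  series are majorised.\<close>

lemma sqrt_weight_lower_bound:
  assumes "0 \<le> \<alpha>" "0 < t"
  obtains m where "m > 0" "\<And>x. x \<in> {t / 2<..<2 * t} \<Longrightarrow> m \<le> sqrt (weight \<alpha> x)"
proof
  show "(t / 2) powr (\<alpha> / 2) * exp (- t) > 0" using assms by simp
  fix x assume x: "x \<in> {t / 2<..<2 * t}"
  have "0 < x" using x assms by auto
  moreover have "(t / 2) powr (\<alpha> / 2) * exp (- t) \<le> x powr (\<alpha> / 2) * exp (- x / 2)"
    using x assms by (intro mult_mono powr_mono2) auto
  ultimately show "(t / 2) powr (\<alpha> / 2) * exp (- t) \<le> sqrt (weight \<alpha> x)"
    by (simp add: sqrt_weight)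
qed

definition ell_series :: "real \<Rightarrow> (nat \<Rightarrow> real) \<Rightarrow> nat \<Rightarrow> real \<Rightarrow> real" where
  "ell_series \<alpha> a j t = (\<Sum>k. a k * (deriv ^^ j) (ell \<alpha> k) t)"

context
  fixes \<alpha> :: real and r :: nat and a :: "nat \<Rightarrow> real"
  assumes \<alpha>: "0 \<le> \<alpha>" and r: "1 \<le> r" and sm: "summable (\<lambda>k. \<bar>a k\<bar> * real (k + 1) ^ r)"
begin

text \<open>One summability assumption serves all orders j \<le> r, because r \<ge> 1 keeps the
  exponent max 1 j of the derivative bound at most r, even for j = 0.\<close>

lemma ell_series_dominated:
  assumes t: "0 < t" and j: "j \<le> r"
  obtains M where "summable M"
    "\<And>k x. x \<in> {t / 2<..<2 * t} \<Longrightarrow> norm (a k * (deriv ^^ j) (ell \<alpha> k) x) \<le> M k"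
proof -
  obtain C where C: "C > 0" "\<And>k t. 0 < t \<Longrightarrow> \<bar>(deriv ^^ j) (ell \<alpha> k) t\<bar> * sqrt (weight \<alpha> t) \<le> C * real (k + 1) ^ max 1 j"
    using deriv_ell_weighted_bound[OF \<alpha>, of j] by blast
  obtain m where m: "m > 0" "\<And>x. x \<in> {t / 2<..<2 * t} \<Longrightarrow> m \<le> sqrt (weight \<alpha> x)"
    using sqrt_weight_lower_bound[OF \<alpha> t] by blast
  show ?thesis
  proof
    show "summable (\<lambda>k. C / m * (\<bar>a k\<bar> * real (k + 1) ^ r))" by (intro summable_mult sm)
    fix k x assume x: "x \<in> {t / 2<..<2 * t}"
    hence x0: "0 < x" using t by auto
    have "\<bar>(deriv ^^ j) (ell \<alpha> k) x\<bar> * m \<le> \<bar>(deriv ^^ j) (ell \<alpha> k) x\<bar> * sqrt (weight \<alpha> x)"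
      using m x by (intro mult_left_mono) auto
    also have "\<dots> \<le> C * real (k + 1) ^ max 1 j" using C x0 by blast
    also have "\<dots> \<le> C * real (k + 1) ^ r"
      using C r j by (intro mult_left_mono power_increasing) auto
    finally have "\<bar>(deriv ^^ j) (ell \<alpha> k) x\<bar> \<le> C * real (k + 1) ^ r / m"
      using m by (simp add: field_simps)
    from mult_left_mono[OF this, of "\<bar>a k\<bar>"]
    show "norm (a k * (deriv ^^ j) (ell \<alpha> k) x) \<le> C / m * (\<bar>a k\<bar> * real (k + 1) ^ r)"
      by (simp add: abs_mult mult_ac)
  qed
qed

lemma summable_ell_series:
  assumes "0 < t" "j \<le> r"
  shows "summable (\<lambda>k. \<bar>a k * (deriv ^^ j) (ell \<alpha> k) t\<bar>)"
proof -
  obtain M where M: "summable M" "\<And>k x. x \<in> {t / 2<..<2 * t} \<Longrightarrow> norm (a k * (deriv ^^ j) (ell \<alpha> k) x) \<le> M k"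
    using ell_series_dominated[OF assms] by blast
  from M(1) show ?thesis
    by (rule summable_comparison_test') (use M(2)[of t] assms in simp)
qed

lemma DERIV_ell_series:
  assumes t: "0 < t" and j: "j < r"
  shows "(ell_series \<alpha> a j has_real_derivative ell_series \<alpha> a (Suc j) t) (at t)"
proof -
  obtain M where M: "summable M"
    "\<And>k x. x \<in> {t / 2<..<2 * t} \<Longrightarrow> norm (a k * (deriv ^^ Suc j) (ell \<alpha> k) x) \<le> M k"
    using ell_series_dominated[OF t, of "Suc j"] j by auto
  have "((\<lambda>x. \<Sum>k. a k * (deriv ^^ j) (ell \<alpha> k) x) has_field_derivative (\<Sum>k. a k * (deriv ^^ Suc j) (ell \<alpha> k) t)) (at t)"
  proof (rule has_field_derivative_series'(2))
    show "convex {t / 2<..<2 * t}" by simp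
    show "((\<lambda>x. a k * (deriv ^^ j) (ell \<alpha> k) x) has_real_derivative a k * (deriv ^^ Suc j) (ell \<alpha> k) x) (at x within {t / 2<..<2 * t})" for k x
      by (intro DERIV_cmult has_field_derivative_at_within[OF DERIV_funpow_ell])
    show "uniformly_convergent_on {t / 2<..<2 * t} (\<lambda>n x. \<Sum>k<n. a k * (deriv ^^ Suc j) (ell \<alpha> k) x)"
      using M(2) M(1) by (rule Weierstrass_m_test')
    show "t \<in> {t / 2<..<2 * t}" using t by simp
    show "t \<in> interior {t / 2<..<2 * t}" using t by simp
    show "summable (\<lambda>k. a k * (deriv ^^ j) (ell \<alpha> k) t)"
      using summable_rabs_cancel[OF summable_ell_series[OF t, of j]] j by simp
  qed
  thus ?thesis by (simp add: ell_series_def[abs_def])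
qed

lemma deriv_funpow_ell_series:
  assumes "j \<le> r" "0 < t"
  shows "(deriv ^^ j) (ell_series \<alpha> a 0) t = ell_series \<alpha> a j t"
  using assms
proof (induction j arbitrary: t)
  case (Suc j)
  have "eventually (\<lambda>x. x \<in> {0<..}) (nhds t)" using Suc.prems by (intro eventually_nhds_in_open) auto
  hence "eventually (\<lambda>x. (deriv ^^ j) (ell_series \<alpha> a 0) x = ell_series \<alpha> a j x) (nhds t)"
    by eventually_elim (use Suc in auto)
  hence "deriv ((deriv ^^ j) (ell_series \<alpha> a 0)) t = deriv (ell_series \<alpha> a j) t"
    by (rule deriv_cong_ev) simp
  also have "\<dots> = ell_series \<alpha> a (Suc j) t"
    using Suc.prems by (intro DERIV_imp_deriv DERIV_ell_series) auto
  finally show ?case by simp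
qed simp

lemma continuous_on_ell_series: "continuous_on {0<..} (ell_series \<alpha> a r)"
proof -
  have "isCont (ell_series \<alpha> a r) t" if t: "0 < t" for t
  proof -
    obtain M where M: "summable M"
      "\<And>k x. x \<in> {t / 2<..<2 * t} \<Longrightarrow> norm (a k * (deriv ^^ r) (ell \<alpha> k) x) \<le> M k"
      using ell_series_dominated[OF t, of r] by auto
    have "uniform_limit {t / 2<..<2 * t} (\<lambda>n x. \<Sum>k<n. a k * (deriv ^^ r) (ell \<alpha> k) x) (ell_series \<alpha> a r) sequentially"
      unfolding ell_series_def[abs_def] using M(2) M(1) by (rule Weierstrass_m_test)
    moreover have "continuous_on {t / 2<..<2 * t} ((deriv ^^ r) (ell \<alpha> k))" for k
      by (intro DERIV_continuous_on[OF has_field_derivative_at_within[OF DERIV_funpow_ell]])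
    hence "eventually (\<lambda>n. continuous_on {t / 2<..<2 * t} (\<lambda>x. \<Sum>k<n. a k * (deriv ^^ r) (ell \<alpha> k) x)) sequentially"
      by (intro always_eventually allI continuous_intros) auto
    ultimately have "continuous_on {t / 2<..<2 * t} (ell_series \<alpha> a r)"
      by (intro uniform_limit_theorem) auto
    thus ?thesis using t by (simp add: continuous_on_eq_continuous_at)
  qed
  thus ?thesis by (simp add: continuous_on_eq_continuous_at)
qed

lemma class_Cr_ell_series: "class_Cr r (ell_series \<alpha> a 0)"
  unfolding class_Cr_def
proof (intro conjI allI impI)
  fix k and t :: real assume k: "k < r" and t: "0 < t"
  have "(ell_series \<alpha> a k has_real_derivative ell_series \<alpha> a (Suc k) t) (at t)"
    using t k by (rule DERIV_ell_series)
  hence "((deriv ^^ k) (ell_series \<alpha> a 0) has_real_derivative ell_series \<alpha> a (Suc k) t) (at t)"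
    by (rule has_field_derivative_transform_within_open[where S = "{0<..}"])
       (use t k deriv_funpow_ell_series in auto)
  thus "(deriv ^^ k) (ell_series \<alpha> a 0) differentiable (at t)"
    by (auto simp: real_differentiable_def)
next
  show "continuous_on {0<..} ((deriv ^^ r) (ell_series \<alpha> a 0))"
    using continuous_on_ell_series by (rule continuous_on_eq) (simp add: deriv_funpow_ell_series)
qed

lemma summable_abs_of_weighted: "summable (\<lambda>k. \<bar>a k\<bar>)"
  using sm
proof (rule summable_comparison_test')
  fix k
  have "1 \<le> real (k + 1) ^ r" by (rule one_le_power) simp
  from mult_left_mono[OF this, of "\<bar>a k\<bar>"] show "norm \<bar>a k\<bar> \<le> \<bar>a k\<bar> * real (k + 1) ^ r" by simp
qed

text \<open>Tested against \<open>ell \<alpha> n\<close>, the k-th term has an integral of modulus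
  at most |a k|, so sum and integral commute. The third claim, whose right side is free of n, is the
  bound that \<open>Laguerre_complete\<close> requires.\<close>

lemma ell_series_coefficients:
  fixes n :: nat
  defines "g \<equiv> ell_series \<alpha> a 0"
  shows "integrable (lebesgue_on {0<..}) (\<lambda>t. weight \<alpha> t * g t * ell \<alpha> n t)"
    and "(\<integral>t. weight \<alpha> t * g t * ell \<alpha> n t \<partial>lebesgue_on {0<..}) = a n"
    and "(\<integral>t. \<bar>weight \<alpha> t * g t * ell \<alpha> n t\<bar> \<partial>lebesgue_on {0<..}) \<le> (\<Sum>k. \<bar>a k\<bar>)"
proof -
  let ?M = "lebesgue_on {0<..} :: real measure"
  define F where "F k t = a k * (weight \<alpha> t * ell \<alpha> k t * ell \<alpha> n t)" for k t
  have int: "integrable ?M (F k)" for k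
    unfolding F_def[abs_def] using has_integral_ell_ell[OF \<alpha>, of k n] by (auto simp: has_bochner_integral_iff)
  have val: "(\<integral>t. F k t \<partial>?M) = (if k = n then a n else 0)" for k
    unfolding F_def using inner_w_ell_ell[OF \<alpha>, of k n] by (simp add: inner_w_def)
  have nrm: "(\<integral>t. norm (F k t) \<partial>?M) \<le> \<bar>a k\<bar>" for k
  proof -
    have "(\<integral>t. \<bar>weight \<alpha> t * ell \<alpha> k t * ell \<alpha> n t\<bar> \<partial>?M) \<le> 1"
      using L2w_mult(2)[OF ell_in_L2w[OF \<alpha>, of k] ell_in_L2w[OF \<alpha>, of n]] integral_ell_square[OF \<alpha>]
      by simp
    from mult_left_mono[OF this, of "\<bar>a k\<bar>"] show ?thesis by (simp add: F_def abs_mult)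
  qed
  have pt: "summable (\<lambda>k. norm (F k t))" "(\<Sum>k. F k t) = weight \<alpha> t * g t * ell \<alpha> n t" if t: "0 < t" for t
  proof -
    have s: "summable (\<lambda>k. \<bar>a k * ell \<alpha> k t\<bar>)" using summable_ell_series[OF t, of 0] by simp
    from summable_mult[OF this, of "\<bar>weight \<alpha> t * ell \<alpha> n t\<bar>"]
    show "summable (\<lambda>k. norm (F k t))" by (simp only: F_def abs_mult[symmetric] real_norm_def mult_ac)
    have "(\<lambda>k. a k * ell \<alpha> k t) sums g t"
      using summable_sums[OF summable_rabs_cancel[OF s]] by (simp add: g_def ell_series_def)
    from sums_mult[OF this, of "weight \<alpha> t * ell \<alpha> n t"]
    show "(\<Sum>k. F k t) = weight \<alpha> t * g t * ell \<alpha> n t" by (simp add: F_def sums_iff mult_ac)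
  qed
  have ae: "AE t in ?M. summable (\<lambda>k. norm (F k t))"
    by (intro AE_I2 pt(1)) (simp add: space_restrict_space)
  have sn: "summable (\<lambda>k. \<integral>t. norm (F k t) \<partial>?M)"
    by (rule summable_comparison_test'[OF summable_abs_of_weighted]) (use nrm in \<open>simp add: integral_nonneg_AE\<close>)
  have cong: "(\<Sum>k. F k t) = weight \<alpha> t * g t * ell \<alpha> n t" if "t \<in> space ?M" for t
    using that by (intro pt(2)) (simp add: space_restrict_space)
  show I: "integrable ?M (\<lambda>t. weight \<alpha> t * g t * ell \<alpha> n t)"
    using integrable_suminf[OF int ae sn] cong by (subst Bochner_Integration.integrable_cong[OF refl, symmetric]) auto
  have "(\<integral>t. weight \<alpha> t * g t * ell \<alpha> n t \<partial>?M) = (\<integral>t. (\<Sum>k. F k t) \<partial>?M)"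
    by (rule Bochner_Integration.integral_cong[OF refl]) (simp add: cong)
  also have "\<dots> = (\<Sum>k. if k = n then a n else 0)"
    unfolding val[symmetric] by (rule integral_suminf[OF int ae sn])
  also have "\<dots> = a n" by (subst suminf_finite[of "{n}"]) auto
  finally show "(\<integral>t. weight \<alpha> t * g t * ell \<alpha> n t \<partial>?M) = a n" .
  have int': "integrable ?M (\<lambda>t. norm (F k t))" for k using int by simp
  have ae': "AE t in ?M. summable (\<lambda>k. norm (norm (F k t)))" using ae by simp
  have sn': "summable (\<lambda>k. \<integral>t. norm (norm (F k t)) \<partial>?M)" using sn by simp
  have "(\<integral>t. \<bar>weight \<alpha> t * g t * ell \<alpha> n t\<bar> \<partial>?M) \<le> (\<integral>t. (\<Sum>k. norm (F k t)) \<partial>?M)"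
  proof (rule integral_mono)
    show "integrable ?M (\<lambda>t. \<Sum>k. norm (F k t))" by (rule integrable_suminf[OF int' ae' sn'])
    fix t assume t: "t \<in> space ?M"
    hence "0 < t" by (simp add: space_restrict_space)
    from summable_norm[OF pt(1)[OF this]] cong[OF t]
    show "\<bar>weight \<alpha> t * g t * ell \<alpha> n t\<bar> \<le> (\<Sum>k. norm (F k t))" by simp
  qed (use I in simp)
  also have "\<dots> = (\<Sum>k. \<integral>t. norm (F k t) \<partial>?M)" by (rule integral_suminf[OF int' ae' sn'])
  also have "\<dots> \<le> (\<Sum>k. \<bar>a k\<bar>)" by (rule suminf_le[OF nrm sn summable_abs_of_weighted])
  finally show "(\<integral>t. \<bar>weight \<alpha> t * g t * ell \<alpha> n t\<bar> \<partial>?M) \<le> (\<Sum>k. \<bar>a k\<bar>)" .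
qed

end

lemma ell_series_eq_AE:
  assumes \<alpha>: "0 \<le> \<alpha>" and r: "1 \<le> r" and f: "f \<in> L2w \<alpha>"
    and sm: "summable (\<lambda>k. \<bar>coeffs_w \<alpha> f k\<bar> * real (k + 1) ^ r)"
  shows "AE t in lebesgue_on {0<..}. ell_series \<alpha> (coeffs_w \<alpha> f) 0 t = f t"
proof -
  let ?M = "lebesgue_on {0<..} :: real measure"
  let ?a = "coeffs_w \<alpha> f"
  let ?g = "ell_series \<alpha> ?a 0"
  note g = ell_series_coefficients[OF \<alpha> r sm]
  have f1: "integrable ?M (\<lambda>t. weight \<alpha> t * f t * ell \<alpha> n t)" for n
    using L2w_mult(1)[OF f ell_in_L2w[OF \<alpha>]] .
  have f2: "(\<integral>t. \<bar>weight \<alpha> t * f t * ell \<alpha> n t\<bar> \<partial>?M) \<le> ((\<integral>t. weight \<alpha> t * (f t)\<^sup>2 \<partial>?M) + 1) / 2" for n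
    using L2w_mult(2)[OF f ell_in_L2w[OF \<alpha>, of n]] integral_ell_square[OF \<alpha>] by simp
  have eq: "weight \<alpha> t * (?g t - f t) * ell \<alpha> n t = weight \<alpha> t * ?g t * ell \<alpha> n t - weight \<alpha> t * f t * ell \<alpha> n t" for t n
    by (simp add: algebra_simps)
  have "AE t in ?M. ?g t - f t = 0"
  proof (rule Laguerre_complete[OF \<alpha>])
    fix n
    show "integrable ?M (\<lambda>t. weight \<alpha> t * (?g t - f t) * ell \<alpha> n t)"
      unfolding eq using g(1) f1 by (rule Bochner_Integration.integrable_diff)
    show "(\<integral>t. weight \<alpha> t * (?g t - f t) * ell \<alpha> n t \<partial>?M) = 0"
      unfolding eq using g(1,2)[of n] f1[of n] by (simp add: coeffs_w_def inner_w_def)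
    have "(\<integral>t. \<bar>weight \<alpha> t * (?g t - f t) * ell \<alpha> n t\<bar> \<partial>?M)
      \<le> (\<integral>t. \<bar>weight \<alpha> t * ?g t * ell \<alpha> n t\<bar> + \<bar>weight \<alpha> t * f t * ell \<alpha> n t\<bar> \<partial>?M)"
      unfolding eq using g(1)[of n] f1[of n] by (intro integral_mono) auto
    also have "\<dots> = (\<integral>t. \<bar>weight \<alpha> t * ?g t * ell \<alpha> n t\<bar> \<partial>?M) + (\<integral>t. \<bar>weight \<alpha> t * f t * ell \<alpha> n t\<bar> \<partial>?M)"
      using g(1)[of n] f1[of n] by (intro Bochner_Integration.integral_add) auto
    also have "\<dots> \<le> (\<Sum>k. \<bar>?a k\<bar>) + ((\<integral>t. weight \<alpha> t * (f t)\<^sup>2 \<partial>?M) + 1) / 2"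
      by (intro add_mono g(3) f2)
    finally show "(\<integral>t. \<bar>weight \<alpha> t * (?g t - f t) * ell \<alpha> n t\<bar> \<partial>?M)
      \<le> (\<Sum>k. \<bar>?a k\<bar>) + ((\<integral>t. weight \<alpha> t * (f t)\<^sup>2 \<partial>?M) + 1) / 2" .
  qed
  thus ?thesis by simp
qed

section \<open>Independence of the chosen representative\<close>

text \<open>Nothing is known about the function picked by \<open>SOME\<close> except that it is
  admissible, so any admissible g must give the same value. Two such functions differ on an open
  null set, which is empty, and equality on the open half-line passes to all iterated
  derivatives.\<close>

lemma rderiv_eqI:
  assumes r: "1 \<le> r" and g: "class_Cr r g" "AE t in lebesgue_on {0<..}. g t = f t" and t: "0 < t"
  shows "rderiv r f t = (deriv ^^ r) g t"
proof -
  define h where "h = (SOME g. class_Cr r g \<and> (AE t in lebesgue_on {0<..}. g t = f t))"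
  have h: "class_Cr r h" "AE t in lebesgue_on {0<..}. h t = f t"
    unfolding h_def using someI[of "\<lambda>g. class_Cr r g \<and> (AE t in lebesgue_on {0<..}. g t = f t)" g] g by auto
  have cont: "continuous_on {0<..} u" if "class_Cr r u" for u
  proof -
    have "\<forall>t>0. (deriv ^^ 0) u differentiable (at t)" using that r unfolding class_Cr_def by fastforce
    thus ?thesis
      by (intro continuous_at_imp_continuous_on ballI differentiable_imp_continuous_within) auto
  qed
  define D where "D = {0<..} \<inter> (\<lambda>t. h t - g t) -` (- {0})"
  have "open D"
    unfolding D_def using cont[OF h(1)] cont[OF g(1)]
    by (intro continuous_open_preimage continuous_intros) auto
  moreover have "AE t in lebesgue_on {0<..}. h t = g t"
    using h(2) g(2) by eventually_elim simp
  hence "AE t in lebesgue. t \<in> {0<..} \<longrightarrow> t \<in> - D"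
    by (simp add: AE_restrict_space_iff D_def)
  ultimately have "x \<in> - D" if "0 < x" for x
    using that by (intro mem_closed_if_AE_lebesgue_open[of "{0<..}" "- D" x]) auto
  hence eq: "h x = g x" if "0 < x" for x
    using that by (auto simp: D_def)
  have "(deriv ^^ j) h x = (deriv ^^ j) g x" if "0 < x" for j x
    using that
  proof (induction j arbitrary: x)
    case (Suc j)
    have "eventually (\<lambda>x. x \<in> {0<..}) (nhds x)" using Suc.prems by (intro eventually_nhds_in_open) auto
    hence "eventually (\<lambda>y. (deriv ^^ j) h y = (deriv ^^ j) g y) (nhds x)"
      by eventually_elim (use Suc in auto)
    hence "deriv ((deriv ^^ j) h) x = deriv ((deriv ^^ j) g) x"
      by (rule deriv_cong_ev) simp
    thus ?case by simp
  qed (simp add: eq)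
  from this[OF t, of r] show ?thesis by (simp add: rderiv_def h_def)
qed

theorem rderiv_eq_ell_series:
  assumes "0 \<le> \<alpha>" "1 \<le> r" "f \<in> L2w \<alpha>"
    and "summable (\<lambda>k. \<bar>coeffs_w \<alpha> f k\<bar> * real (k + 1) ^ r)" and "0 < t"
  shows "rderiv r f t = ell_series \<alpha> (coeffs_w \<alpha> f) r t"
  using rderiv_eqI[OF assms(2) class_Cr_ell_series ell_series_eq_AE] deriv_funpow_ell_series assms
  by simp


section \<open>Norms and power sums\<close>

lemma recip_top [simp]: "recip top = 0"
  by (simp add: recip_def)

lemma recip_finite:
  assumes "1 \<le> q" "q \<noteq> \<infinity>"
  shows "1 \<le> enn2real q" "recip q = 1 / enn2real q"
proof -
  obtain x where x: "0 \<le> x" "q = ennreal x" using assms(2) by (cases q) auto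
  have x1: "1 \<le> x" using assms(1) x by (simp add: ennreal_le_iff flip: ennreal_1)
  thus "1 \<le> enn2real q" unfolding x(2) enn2real_ennreal[OF x(1)] .
  have "1 / ennreal x = ennreal (1 / x)"
    using x1 divide_ennreal[of 1 x] by simp
  thus "recip q = 1 / enn2real q" using x by (simp add: recip_def)
qed

lemma recip_bounds:
  assumes "1 \<le> q"
  shows "0 \<le> recip q" "recip q \<le> 1"
proof -
  have "0 \<le> recip q \<and> recip q \<le> 1"
  proof (cases "q = \<infinity>")
    case False
    from recip_finite(1)[OF assms this] show ?thesis
      unfolding recip_finite(2)[OF assms False] by simp
  qed simp
  thus "0 \<le> recip q" "recip q \<le> 1" by auto
qed

text \<open>Either y lies below the threshold m^(-1/P), or y = y^P * y^(1-P), where the second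
  factor is at most the threshold to the power 1 - P because 1 - P \<le> 0.\<close>

lemma le_powr_split:
  fixes y m P :: real
  assumes "0 \<le> y" "1 \<le> P" "0 < m"
  shows "y \<le> m powr (- (1 / P)) + m powr (1 - 1 / P) * y powr P"
proof (cases "y \<le> m powr (- (1 / P))")
  case False
  define l where "l = m powr (- (1 / P))"
  have l: "0 < l" "l < y" using False assms by (auto simp: l_def)
  have "y = y powr P * y powr (1 - P)" using l by (simp add: powr_add[symmetric])
  also have "\<dots> \<le> y powr P * l powr (1 - P)"
    using l assms by (intro mult_left_mono powr_mono2') auto
  also have "l powr (1 - P) = m powr (1 - 1 / P)"
  proof -
    have "- (1 / P) * (1 - P) = 1 - 1 / P" using assms by (simp add: field_simps)
    thus ?thesis by (simp only: l_def powr_powr)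
  qed
  finally show ?thesis using l by (simp add: l_def mult.commute add_increasing)
qed (simp add: add_increasing2)

text \<open>A bound for the entries of a vector in a ball of \<open>\<ell>\<^sub>p\<close> that replaces Hoelder's inequality and
  treats all \<open>p\<close>, including \<open>\<infinity>\<close>, alike: the first summand is what a vector spread evenly over
  \<open>m\<close> indices attains, the second is what a vector concentrated on one index attains.\<close>

lemma lp_ball_split:
  assumes p: "1 \<le> p" and \<delta>: "0 < \<delta>" and x: "lp_norm p x \<le> ennreal \<delta>"
  obtains c where "\<And>k. 0 \<le> c k" "summable c" "(\<Sum>k. c k) \<le> 1"
    "\<And>k m. 0 < m \<Longrightarrow> \<bar>x k\<bar> \<le> \<delta> * (m powr (- recip p) + m powr (1 - recip p) * c k)"
proof (cases "p = \<infinity>")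
  case True
  have "\<bar>x k\<bar> \<le> \<delta>" for k
  proof -
    have "ennreal \<bar>x k\<bar> \<le> (SUP k. ennreal \<bar>x k\<bar>)" by (rule SUP_upper) simp
    also have "\<dots> \<le> ennreal \<delta>" using x True by (simp add: lp_norm_def)
    finally show ?thesis using \<delta> by simp
  qed
  \<comment> \<open>Here \<open>recip p\<close> is 0, so the first summand alone is already the
    bound \<delta>.\<close>
  thus ?thesis using True by (intro that[of "\<lambda>_. 0"]) auto
next
  case False
  define P where "P = enn2real p"
  have P: "1 \<le> P" "recip p = 1 / P" using recip_finite[OF p False] by (auto simp: P_def)
  have sm: "summable (\<lambda>k. \<bar>x k\<bar> powr P)"
    using x False by (auto simp: lp_norm_def P_def top_unique split: if_splits)
  define S where "S = (\<Sum>k. \<bar>x k\<bar> powr P)"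
  have "ennreal (S powr (1 / P)) \<le> ennreal \<delta>"
    using x False sm by (simp add: lp_norm_def P_def S_def)
  hence "S powr (1 / P) \<le> \<delta>" using \<delta> by simp
  hence "(S powr (1 / P)) powr P \<le> \<delta> powr P" using P by (intro powr_mono2) auto
  moreover have "0 \<le> S" unfolding S_def by (intro suminf_nonneg sm) simp
  ultimately have S: "S \<le> \<delta> powr P" using P by (simp add: powr_powr)
  have eq: "(\<bar>x k\<bar> / \<delta>) powr P = \<bar>x k\<bar> powr P / \<delta> powr P" for k
    using \<delta> by (simp add: powr_divide)
  show ?thesis
  proof (rule that[of "\<lambda>k. (\<bar>x k\<bar> / \<delta>) powr P"])
    show "summable (\<lambda>k. (\<bar>x k\<bar> / \<delta>) powr P)" unfolding eq by (intro summable_divide sm)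
    have "(\<Sum>k. (\<bar>x k\<bar> / \<delta>) powr P) = S / \<delta> powr P"
      unfolding eq S_def by (rule suminf_divide[OF sm])
    thus "(\<Sum>k. (\<bar>x k\<bar> / \<delta>) powr P) \<le> 1" using S \<delta> by simp
    fix k and m :: real assume m: "0 < m"
    have "\<bar>x k\<bar> / \<delta> \<le> m powr (- (1 / P)) + m powr (1 - 1 / P) * (\<bar>x k\<bar> / \<delta>) powr P"
      using \<delta> P m by (intro le_powr_split) auto
    thus "\<bar>x k\<bar> \<le> \<delta> * (m powr (- recip p) + m powr (1 - recip p) * (\<bar>x k\<bar> / \<delta>) powr P)"
      unfolding P(2) using \<delta> by (simp add: pos_divide_le_eq mult.commute)
  qed simp
qed

lemma W_norm_eq_lp_norm:
  "W_norm \<alpha> s \<mu> f = lp_norm s (\<lambda>k. real (max 1 k) powr \<mu> * coeffs_w \<alpha> f k)"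
proof -
  have "\<bar>real (max 1 k) powr \<mu> * coeffs_w \<alpha> f k\<bar> powr enn2real s
    = real (max 1 k) powr (enn2real s * \<mu>) * \<bar>coeffs_w \<alpha> f k\<bar> powr enn2real s" for k
    by (simp add: abs_mult powr_mult powr_powr mult.commute)
  moreover have "\<bar>real (max 1 k) powr \<mu> * coeffs_w \<alpha> f k\<bar> = real (max 1 k) powr \<mu> * \<bar>coeffs_w \<alpha> f k\<bar>" for k
    by (simp add: abs_mult)
  ultimately show ?thesis by (simp only: W_norm_def lp_norm_def)
qed

section \<open>Sums of powers\<close>

lemma powr_minus_diff_lower:
  fixes x \<kappa> :: real
  assumes "0 < x" "0 < \<kappa>"
  shows "(x + 1) powr (- 1 - \<kappa>) \<le> (x powr (- \<kappa>) - (x + 1) powr (- \<kappa>)) / \<kappa>"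
proof -
  have "\<exists>z. x < z \<and> z < x + 1 \<and> (x + 1) powr (- \<kappa>) - x powr (- \<kappa>) = (x + 1 - x) * (- \<kappa> * z powr (- \<kappa> - 1))"
    using assms by (intro MVT2) (auto intro!: DERIV_fun_powr derivative_eq_intros)
  then obtain z where z: "x < z" "z < x + 1" "(x + 1) powr (- \<kappa>) - x powr (- \<kappa>) = - \<kappa> * z powr (- \<kappa> - 1)"
    by auto
  have "(x + 1) powr (- 1 - \<kappa>) \<le> z powr (- 1 - \<kappa>)"
    using z assms by (intro powr_mono2') auto
  hence "\<kappa> * (x + 1) powr (- 1 - \<kappa>) \<le> \<kappa> * z powr (- 1 - \<kappa>)"
    using assms by simp
  moreover have e: "- \<kappa> - 1 = - 1 - \<kappa>" by simp
  ultimately have "\<kappa> * (x + 1) powr (- 1 - \<kappa>) \<le> x powr (- \<kappa>) - (x + 1) powr (- \<kappa>)"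
    using z(3)[unfolded e] by linarith
  thus ?thesis using assms by (simp only: pos_le_divide_eq mult.commute)
qed

text \<open>By the mean value theorem the terms are at most differences of the sequence (k +
  N)^(-\<kappa>) / \<kappa>, which telescope: convergence and the constant 1/\<kappa> come
  together.\<close>

lemma suminf_powr_tail_le:
  fixes \<kappa> :: real
  assumes N: "1 \<le> N" and \<kappa>: "0 < \<kappa>"
  shows "summable (\<lambda>k. real (k + N + 1) powr (- 1 - \<kappa>))"
    and "(\<Sum>k. real (k + N + 1) powr (- 1 - \<kappa>)) \<le> real N powr (- \<kappa>) / \<kappa>"
proof -
  define g where "g k = real (k + N) powr (- \<kappa>) / \<kappa>" for k
  have "filterlim (\<lambda>k. real (k + N)) at_top sequentially"
    by (rule filterlim_compose[OF filterlim_real_sequentially filterlim_add_const_nat_at_top])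
  hence "(\<lambda>k. real (k + N) powr (- \<kappa>)) \<longlonglongrightarrow> 0" using \<kappa> by (intro tendsto_neg_powr) auto
  hence "g \<longlonglongrightarrow> 0" unfolding g_def[abs_def] by (rule tendsto_divide_zero)
  from telescope_sums'[OF this] have g: "(\<lambda>k. g k - g (Suc k)) sums g 0" by simp
  have le: "real (k + N + 1) powr (- 1 - \<kappa>) \<le> g k - g (Suc k)" for k
    using powr_minus_diff_lower[of "real (k + N)" \<kappa>] N \<kappa> by (simp add: g_def diff_divide_distrib add_ac)
  show s: "summable (\<lambda>k. real (k + N + 1) powr (- 1 - \<kappa>))"
    by (rule summable_comparison_test'[OF sums_summable[OF g]]) (use le in auto)
  show "(\<Sum>k. real (k + N + 1) powr (- 1 - \<kappa>)) \<le> real N powr (- \<kappa>) / \<kappa>"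
    using suminf_le[OF le s sums_summable[OF g]] sums_unique[OF g] by (simp add: g_def)
qed

text \<open>The new term is compared with the increment of N^\<omega>. For \<omega> \<le> 1 the mean
  value theorem makes the increment at least \<omega> (N + 1)^(\<omega> - 1), whence 1/\<omega>; for
  \<omega> > 1, and for N = 0, it is at least (N + 1)^(\<omega> - 1), whence 1.\<close>

lemma sum_powr_le:
  fixes \<omega> :: real
  assumes \<omega>: "0 < \<omega>"
  shows "(\<Sum>k=1..N. real k powr (\<omega> - 1)) \<le> (1 + 1 / \<omega>) * real N powr \<omega>"
proof (induction N)
  case (Suc N)
  have step: "real (Suc N) powr (\<omega> - 1) \<le> (1 + 1 / \<omega>) * (real (Suc N) powr \<omega> - real N powr \<omega>)"
  proof (cases "N = 0")
    case False
    have "\<exists>z. real N < z \<and> z < real N + 1 \<and> (real N + 1) powr \<omega> - real N powr \<omega> = (real N + 1 - real N) * (\<omega> * z powr (\<omega> - 1))"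
      using False by (intro MVT2) (auto intro!: DERIV_fun_powr derivative_eq_intros)
    then obtain z where z: "real N < z" "z < real N + 1"
      "(real N + 1) powr \<omega> - real N powr \<omega> = \<omega> * z powr (\<omega> - 1)" by auto
    show ?thesis
    proof (cases "\<omega> \<le> 1")
      case True
      have "real (Suc N) powr (\<omega> - 1) \<le> z powr (\<omega> - 1)"
        using z True False by (intro powr_mono2') auto
      also have "\<dots> \<le> (1 + 1 / \<omega>) * (\<omega> * z powr (\<omega> - 1))"
        using \<omega> by (simp add: field_simps)
      finally show ?thesis using z by (simp add: add.commute)
    next
      case gt: False
      have "real N powr \<omega> = real N * real N powr (\<omega> - 1)"
        using False powr_add[of "real N" 1 "\<omega> - 1"] by simp
      also have "\<dots> \<le> real N * real (Suc N) powr (\<omega> - 1)"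
        using gt by (intro mult_left_mono powr_mono2) auto
      finally have "real (Suc N) powr (\<omega> - 1) \<le> (1 + real N) * real (Suc N) powr (\<omega> - 1) - real N powr \<omega>"
        by (simp add: algebra_simps)
      also have "(1 + real N) * real (Suc N) powr (\<omega> - 1) = real (Suc N) powr \<omega>"
        using powr_add[of "real (Suc N)" 1 "\<omega> - 1"] by simp
      finally have le: "real (Suc N) powr (\<omega> - 1) \<le> real (Suc N) powr \<omega> - real N powr \<omega>" .
      also have "\<dots> \<le> (1 + 1 / \<omega>) * (real (Suc N) powr \<omega> - real N powr \<omega>)"
      proof -
        have "0 \<le> real (Suc N) powr \<omega> - real N powr \<omega>" using \<omega> by (simp add: powr_mono2)
        thus ?thesis using \<omega> by (simp add: distrib_right)
      qed
      finally show ?thesis .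
    qed
  qed (use \<omega> in auto)
  have "(\<Sum>k=1..Suc N. real k powr (\<omega> - 1)) = (\<Sum>k=1..N. real k powr (\<omega> - 1)) + real (Suc N) powr (\<omega> - 1)"
    by simp
  also have "\<dots> \<le> (1 + 1 / \<omega>) * real N powr \<omega> + (1 + 1 / \<omega>) * (real (Suc N) powr \<omega> - real N powr \<omega>)"
    by (intro add_mono Suc.IH step)
  finally show ?case by (simp add: algebra_simps)
qed simp

section \<open>The recovery method as a finite sum of derivatives\<close>

lemma deriv_funpow_sum_ell:
  "(deriv ^^ j) (\<lambda>t. \<Sum>k\<in>A. b k * ell \<alpha> k t) = (\<lambda>t. \<Sum>k\<in>A. b k * (deriv ^^ j) (ell \<alpha> k) t)"
proof (induction j)
  case (Suc j)
  have "((\<lambda>t. \<Sum>k\<in>A. b k * (deriv ^^ j) (ell \<alpha> k) t) has_real_derivative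
      (\<Sum>k\<in>A. b k * (deriv ^^ Suc j) (ell \<alpha> k) t)) (at t)" for t
    by (intro DERIV_sum DERIV_cmult DERIV_funpow_ell)
  from DERIV_imp_deriv[OF this] show ?case by (simp add: Suc.IH)
qed simp

lemma psi_S_eq: "psi_S \<alpha> r \<nu> N y t = (\<Sum>k\<le>N. \<nu> N k * y k * (deriv ^^ r) (ell \<alpha> k) t)"
  using deriv_funpow_sum_ell[where j = r and A = "{..N}" and b = "\<lambda>k. \<nu> N k * y k"] by (simp add: psi_S_def S_op_def[abs_def])

lemma psi_S_recovery_op: "psi_S \<alpha> r \<nu> N \<in> recovery_ops p"
  unfolding recovery_ops_def C_space_def psi_S_eq[abs_def]
  by (auto intro!: continuous_intros DERIV_continuous_on[OF has_field_derivative_at_within[OF DERIV_funpow_ell]])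


section \<open>Upper bound\<close>

lemma sum_le_suminf_le_1:
  fixes c :: "nat \<Rightarrow> real"
  assumes "\<And>k. 0 \<le> c k" "summable c" "(\<Sum>k. c k) \<le> 1" "finite A"
  shows "sum c A \<le> 1"
  using sum_le_suminf[of c A] assms by force

text \<open>With \<omega> = \<theta> - \<kappa> > 0 the evenly spread part of x gives a sum of
  k^(\<omega>-1), of order N^\<omega>, and the concentrated part gives at most N^\<omega> times the
  sum of c. Division by N^\<theta> leaves N^(-\<kappa>). This is where the order of the method must
  exceed \<kappa>: for \<omega> < 0 small indices would dominate.\<close>

lemma split_head_le:
  fixes x c :: "nat \<Rightarrow> real"
  assumes c: "\<And>k. 0 \<le> c k" "summable c" "(\<Sum>k. c k) \<le> 1"
    and x: "\<And>k. 1 \<le> k \<Longrightarrow> x k \<le> real k powr (- 1 - \<kappa>) + real k powr (- \<kappa>) * c k"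
    and \<theta>: "\<kappa> < \<theta>" and N: "1 \<le> N"
  shows "(\<Sum>k=1..N. x k * (real k / real N) powr \<theta>) \<le> (2 + 1 / (\<theta> - \<kappa>)) * real N powr (- \<kappa>)"
proof -
  define \<omega> where "\<omega> = \<theta> - \<kappa>"
  have \<omega>: "0 < \<omega>" using \<theta> by (simp add: \<omega>_def)
  have N0: "0 < real N" using N by simp
  have summand: "x k * (real k / real N) powr \<theta> \<le> real N powr (- \<theta>) * (real k powr (\<omega> - 1) + real N powr \<omega> * c k)"
    if k: "k \<in> {1..N}" for k
  proof -
    have k0: "0 < real k" using k by simp
    have "(real k / real N) powr \<theta> = real N powr (- \<theta>) * real k powr \<theta>"
      using k0 N0 by (simp add: powr_divide powr_minus field_simps)
    hence "x k * (real k / real N) powr \<theta> \<le> (real k powr (- 1 - \<kappa>) + real k powr (- \<kappa>) * c k) * (real N powr (- \<theta>) * real k powr \<theta>)"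
      using k by (auto intro!: mult_right_mono x)
    also have "(real k powr (- 1 - \<kappa>) + real k powr (- \<kappa>) * c k) * (real N powr (- \<theta>) * real k powr \<theta>)
      = real N powr (- \<theta>) * (real k powr (- 1 - \<kappa>) * real k powr \<theta> + real k powr (- \<kappa>) * real k powr \<theta> * c k)"
      by (simp add: algebra_simps)
    also have "real k powr (- 1 - \<kappa>) * real k powr \<theta> = real k powr (\<omega> - 1)"
      by (simp add: powr_add[symmetric] \<omega>_def algebra_simps)
    also have "real k powr (- \<kappa>) * real k powr \<theta> = real k powr \<omega>"
      by (simp add: powr_add[symmetric] \<omega>_def algebra_simps)
    also have "real N powr (- \<theta>) * (real k powr (\<omega> - 1) + real k powr \<omega> * c k)
      \<le> real N powr (- \<theta>) * (real k powr (\<omega> - 1) + real N powr \<omega> * c k)"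
      using k \<omega> c by (intro mult_left_mono add_left_mono mult_right_mono powr_mono2) auto
    finally show ?thesis .
  qed
  have "(\<Sum>k=1..N. x k * (real k / real N) powr \<theta>)
     \<le> (\<Sum>k=1..N. real N powr (- \<theta>) * (real k powr (\<omega> - 1) + real N powr \<omega> * c k))"
    by (rule sum_mono) (rule summand)
  also have "\<dots> = real N powr (- \<theta>) * ((\<Sum>k=1..N. real k powr (\<omega> - 1)) + real N powr \<omega> * (\<Sum>k=1..N. c k))"
    by (simp only: sum_distrib_left[symmetric] sum.distrib)
  also have "\<dots> \<le> real N powr (- \<theta>) * ((1 + 1 / \<omega>) * real N powr \<omega> + real N powr \<omega> * 1)"
    using c by (intro mult_left_mono add_mono sum_powr_le \<omega> sum_le_suminf_le_1) auto
  also have "\<dots> = (2 + 1 / \<omega>) * (real N powr (- \<theta>) * real N powr \<omega>)"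
    by (simp add: algebra_simps)
  also have "real N powr (- \<theta>) * real N powr \<omega> = real N powr (- \<kappa>)"
    by (simp add: powr_add[symmetric] \<omega>_def)
  finally show ?thesis by (simp add: \<omega>_def)
qed

text \<open>Beyond N the concentrated part costs at most N^(-\<kappa>), as k^(-\<kappa>) decreases
  and c sums to at most 1; the spread part is the telescoped tail.\<close>

lemma split_tail_le:
  fixes x c :: "nat \<Rightarrow> real"
  assumes c: "\<And>k. 0 \<le> c k" "summable c" "(\<Sum>k. c k) \<le> 1"
    and x: "\<And>k. 1 \<le> k \<Longrightarrow> x k \<le> real k powr (- 1 - \<kappa>) + real k powr (- \<kappa>) * c k"
    and x0: "\<And>k. 0 \<le> x k" and \<kappa>: "0 < \<kappa>" and N: "1 \<le> N"
  shows "summable (\<lambda>k. x (k + Suc N))"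
    and "(\<Sum>k. x (k + Suc N)) \<le> (1 + 1 / \<kappa>) * real N powr (- \<kappa>)"
proof -
  have le: "x (k + Suc N) \<le> real (k + N + 1) powr (- 1 - \<kappa>) + real N powr (- \<kappa>) * c (k + Suc N)" for k
  proof -
    have "real (k + Suc N) powr (- \<kappa>) * c (k + Suc N) \<le> real N powr (- \<kappa>) * c (k + Suc N)"
      using N \<kappa> c by (intro mult_right_mono powr_mono2') auto
    thus ?thesis using x[of "k + Suc N"] by (simp add: add_ac)
  qed
  note p = suminf_powr_tail_le[OF N \<kappa>]
  have sc: "summable (\<lambda>k. c (k + Suc N))" using c by (subst summable_iff_shift)
  have s: "summable (\<lambda>k. real (k + N + 1) powr (- 1 - \<kappa>) + real N powr (- \<kappa>) * c (k + Suc N))"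
    by (intro summable_add p summable_mult sc)
  show sx: "summable (\<lambda>k. x (k + Suc N))"
    by (rule summable_comparison_test'[OF s]) (use le x0 in auto)
  have "(\<Sum>k. c (k + Suc N)) = (\<Sum>k. c k) - (\<Sum>k<Suc N. c k)"
    by (rule suminf_minus_initial_segment[OF c(2)])
  also have "\<dots> \<le> 1" using c(3) sum_nonneg[of "{..<Suc N}" c] c(1) by simp
  finally have c1: "(\<Sum>k. c (k + Suc N)) \<le> 1" .
  have "(\<Sum>k. x (k + Suc N)) \<le> (\<Sum>k. real (k + N + 1) powr (- 1 - \<kappa>) + real N powr (- \<kappa>) * c (k + Suc N))"
    by (rule suminf_le[OF le sx s])
  also have "\<dots> = (\<Sum>k. real (k + N + 1) powr (- 1 - \<kappa>)) + real N powr (- \<kappa>) * (\<Sum>k. c (k + Suc N))"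
    by (simp only: suminf_add[OF p(1) summable_mult[OF sc], symmetric] suminf_mult[OF sc])
  also have "\<dots> \<le> real N powr (- \<kappa>) / \<kappa> + real N powr (- \<kappa>) * 1"
    by (intro add_mono p mult_left_mono c1) auto
  finally show "(\<Sum>k. x (k + Suc N)) \<le> (1 + 1 / \<kappa>) * real N powr (- \<kappa>)" by (simp add: algebra_simps)
qed

text \<open>The splitting of the ball is used with m = k, a different m for every index. Both
  resulting exponents, r - 1/p and r + 1 - 1/p, are nonnegative since r \<ge> 1, so k may be
  replaced by N. The N equal terms and the sum of c contribute the same amount, hence the factor
  2.\<close>

lemma lp_ball_weighted_sum_le:
  assumes p: "1 \<le> p" and \<delta>: "0 < \<delta>" and \<xi>: "lp_norm p \<xi> \<le> ennreal \<delta>" and r: "1 \<le> r"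
  shows "(\<Sum>k=1..N. \<bar>\<xi> k\<bar> * real k ^ r) \<le> 2 * \<delta> * real N powr (real r + 1 - recip p)"
proof (cases "N = 0")
  case False
  obtain c where c: "\<And>k. 0 \<le> c k" "summable c" "(\<Sum>k. c k) \<le> 1"
    "\<And>k m. 0 < m \<Longrightarrow> \<bar>\<xi> k\<bar> \<le> \<delta> * (m powr (- recip p) + m powr (1 - recip p) * c k)"
    using lp_ball_split[OF p \<delta> \<xi>] by blast
  define q where "q = recip p"
  have q: "0 \<le> q" "q \<le> 1" using recip_bounds[OF p] by (auto simp: q_def)
  have N0: "0 < real N" using False by simp
  have summand: "\<bar>\<xi> k\<bar> * real k ^ r \<le> \<delta> * (real N powr (real r - q) + real N powr (real r + 1 - q) * c k)"
    if k: "k \<in> {1..N}" for k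
  proof -
    have k0: "0 < real k" using k by simp
    have "real k ^ r = real k powr r" using k0 by (simp add: powr_realpow)
    hence "\<bar>\<xi> k\<bar> * real k ^ r \<le> \<delta> * (real k powr (- q) + real k powr (1 - q) * c k) * real k powr r"
      using c(4)[OF k0] by (auto intro!: mult_right_mono simp: q_def)
    also have "\<delta> * (real k powr (- q) + real k powr (1 - q) * c k) * real k powr r
      = \<delta> * (real k powr r * real k powr (- q) + real k powr r * real k powr (1 - q) * c k)"
      by (simp add: algebra_simps)
    also have "\<dots> = \<delta> * (real k powr (real r - q) + real k powr (real r + 1 - q) * c k)"
      by (simp add: powr_add[symmetric] algebra_simps)
    also have "\<dots> \<le> \<delta> * (real N powr (real r - q) + real N powr (real r + 1 - q) * c k)"
      using \<delta> c(1) k q r by (intro mult_left_mono add_mono mult_right_mono powr_mono2) auto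
    finally show ?thesis .
  qed
  have "(\<Sum>k=1..N. \<bar>\<xi> k\<bar> * real k ^ r)
     \<le> (\<Sum>k=1..N. \<delta> * (real N powr (real r - q) + real N powr (real r + 1 - q) * c k))"
    by (rule sum_mono) (rule summand)
  also have "\<dots> = \<delta> * (real N * real N powr (real r - q) + real N powr (real r + 1 - q) * (\<Sum>k=1..N. c k))"
    by (simp add: sum_distrib_left[symmetric] sum.distrib)
  also have "real N * real N powr (real r - q) = real N powr (real r + 1 - q)"
    using N0 powr_add[of "real N" 1 "real r - q"] by (simp add: algebra_simps)
  also have "\<delta> * (real N powr (real r + 1 - q) + real N powr (real r + 1 - q) * (\<Sum>k=1..N. c k))
     \<le> \<delta> * (real N powr (real r + 1 - q) + real N powr (real r + 1 - q) * 1)"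
    using \<delta> c by (intro mult_left_mono add_left_mono sum_le_suminf_le_1) auto
  finally show ?thesis by (simp add: q_def)
qed simp

text \<open>Again m = k, now for the unit ball. Multiplying by k^(r - \<mu>) turns the exponents
  -1/s and 1 - 1/s into -1 - \<kappa> and -\<kappa>. All size estimates for functions in the ball go
  through this inequality.\<close>

lemma W_ball_coeff_split:
  assumes s: "1 \<le> s" and \<kappa>: "\<kappa> = \<mu> + recip s - 1 - real r" and f: "f \<in> W_ball \<alpha> s \<mu>"
  obtains c where "\<And>k. 0 \<le> c k" "summable c" "(\<Sum>k. c k) \<le> 1"
    "\<And>k. 1 \<le> k \<Longrightarrow> \<bar>coeffs_w \<alpha> f k\<bar> * real k ^ r \<le> real k powr (- 1 - \<kappa>) + real k powr (- \<kappa>) * c k"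
proof -
  define x where "x k = real (max 1 k) powr \<mu> * coeffs_w \<alpha> f k" for k
  have "lp_norm s x \<le> ennreal 1"
    using f by (simp add: W_ball_def W_norm_eq_lp_norm x_def[abs_def])
  from lp_ball_split[OF s zero_less_one this] obtain c where c: "\<And>k. 0 \<le> c k" "summable c" "(\<Sum>k. c k) \<le> 1"
    "\<And>k m. 0 < m \<Longrightarrow> \<bar>x k\<bar> \<le> 1 * (m powr (- recip s) + m powr (1 - recip s) * c k)" by blast
  show ?thesis
  proof (rule that[OF c(1-3)])
    fix k :: nat assume k: "1 \<le> k"
    hence k0: "0 < real k" by simp
    have "real k powr \<mu> * \<bar>coeffs_w \<alpha> f k\<bar> \<le> real k powr (- recip s) + real k powr (1 - recip s) * c k"
      using c(4)[OF k0, of k] k by (simp add: x_def abs_mult max_def)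
    from mult_left_mono[OF this, of "real k powr (real r - \<mu>)"]
    have "real k powr (real r - \<mu>) * real k powr \<mu> * \<bar>coeffs_w \<alpha> f k\<bar>
      \<le> real k powr (real r - \<mu>) * real k powr (- recip s) + real k powr (real r - \<mu>) * real k powr (1 - recip s) * c k"
      by (simp add: algebra_simps)
    moreover have "real k powr (real r - \<mu>) * real k powr \<mu> = real k ^ r"
      using k0 by (simp add: powr_add[symmetric] powr_realpow)
    moreover have "real k powr (real r - \<mu>) * real k powr (- recip s) = real k powr (- 1 - \<kappa>)"
      by (simp add: powr_add[symmetric] \<kappa> algebra_simps)
    moreover have "real k powr (real r - \<mu>) * real k powr (1 - recip s) = real k powr (- \<kappa>)"
      by (simp add: powr_add[symmetric] \<kappa> algebra_simps)
    ultimately show "\<bar>coeffs_w \<alpha> f k\<bar> * real k ^ r \<le> real k powr (- 1 - \<kappa>) + real k powr (- \<kappa>) * c k"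
      by (simp add: mult.commute)
  qed
qed

text \<open>Here \<kappa> > 0 enters: k^(-1-\<kappa>) is summable and k^(-\<kappa>) \<le> 1. This is
  the assumption under which f has a C^r representative given by its Laguerre series.\<close>

lemma W_ball_summable:
  assumes s: "1 \<le> s" and \<kappa>: "\<kappa> = \<mu> + recip s - 1 - real r" "0 < \<kappa>" and f: "f \<in> W_ball \<alpha> s \<mu>"
  shows "summable (\<lambda>k. \<bar>coeffs_w \<alpha> f k\<bar> * real (k + 1) ^ r)"
proof -
  obtain c where c: "\<And>k. 0 \<le> c k" "summable c" "(\<Sum>k. c k) \<le> 1"
    "\<And>k. 1 \<le> k \<Longrightarrow> \<bar>coeffs_w \<alpha> f k\<bar> * real k ^ r \<le> real k powr (- 1 - \<kappa>) + real k powr (- \<kappa>) * c k"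
    using W_ball_coeff_split[OF s \<kappa>(1) f] by blast
  have "summable (\<lambda>k. 2 ^ r * (real k powr (- 1 - \<kappa>) + c k))"
    using \<kappa> c(2) by (intro summable_mult summable_add) (auto simp: summable_real_powr_iff)
  thus ?thesis
  proof (rule summable_comparison_test')
    fix k :: nat assume k: "1 \<le> k"
    have "real (k + 1) ^ r \<le> (2 * real k) ^ r" using k by (intro power_mono) auto
    hence "\<bar>coeffs_w \<alpha> f k\<bar> * real (k + 1) ^ r \<le> \<bar>coeffs_w \<alpha> f k\<bar> * (2 * real k) ^ r"
      by (intro mult_left_mono) auto
    also have "\<dots> = 2 ^ r * (\<bar>coeffs_w \<alpha> f k\<bar> * real k ^ r)" by (simp add: power_mult_distrib)
    also have "\<dots> \<le> 2 ^ r * (real k powr (- 1 - \<kappa>) + real k powr (- \<kappa>) * c k)"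
      using c(4)[OF k] by simp
    also have "real k powr (- \<kappa>) * c k \<le> 1 * c k"
    proof (rule mult_right_mono)
      have "real k powr (- \<kappa>) \<le> 1 powr (- \<kappa>)" using k \<kappa> by (intro powr_mono2') auto
      thus "real k powr (- \<kappa>) \<le> 1" by simp
    qed (rule c)
    finally show "norm (\<bar>coeffs_w \<alpha> f k\<bar> * real (k + 1) ^ r) \<le> 2 ^ r * (real k powr (- 1 - \<kappa>) + c k)"
      by (simp add: abs_mult)
  qed
qed

text \<open>Since r \<ge> 1, differentiation kills \<open>ell \<alpha> 0\<close>, so k^r can replace
  (k + 1)^r and index 0 drops out of the error altogether.\<close>

lemma deriv_ell_weighted_bound':
  assumes "0 \<le> \<alpha>" "1 \<le> r"
  obtains C where "C > 0"
    "\<And>k t. 0 < t \<Longrightarrow> \<bar>(deriv ^^ r) (ell \<alpha> k) t * sqrt (weight \<alpha> t)\<bar> \<le> C * real k ^ r"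
proof -
  obtain C where C: "C > 0" "\<And>k t. 0 < t \<Longrightarrow> \<bar>(deriv ^^ r) (ell \<alpha> k) t\<bar> * sqrt (weight \<alpha> t) \<le> C * real (k + 1) ^ max 1 r"
    using deriv_ell_weighted_bound[OF assms(1), of r] by blast
  have r: "max 1 r = r" using assms by simp
  show ?thesis
  proof
    show "C * 2 ^ r > 0" using C by simp
    fix k :: nat and t :: real assume t: "0 < t"
    show "\<bar>(deriv ^^ r) (ell \<alpha> k) t * sqrt (weight \<alpha> t)\<bar> \<le> C * 2 ^ r * real k ^ r"
    proof (cases "k = 0")
      case True
      thus ?thesis using assms C by (simp add: deriv_funpow_ell)
    next
      case False
      have "\<bar>(deriv ^^ r) (ell \<alpha> k) t * sqrt (weight \<alpha> t)\<bar> \<le> C * real (k + 1) ^ r"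
        using C(2)[OF t, of k] unfolding r by (simp add: abs_mult)
      also have "\<dots> \<le> C * (2 * real k) ^ r"
        using C False by (intro mult_left_mono power_mono) auto
      finally show ?thesis by (simp add: power_mult_distrib mult_ac)
    qed
  qed
qed

text \<open>The error is a tail over k > N plus, for k \<le> N, a damping part (1 - \<nu>) a and a
  noise part \<nu> \<xi>. Taking absolute values inside the sums loses only constants, because near
  t = 1/k the derivatives really have size k^r.\<close>

lemma psi_S_pointwise_error:
  assumes \<alpha>: "0 \<le> \<alpha>" and r: "1 \<le> r" and s: "1 \<le> s" and p: "1 \<le> p"
    and \<kappa>: "\<kappa> = \<mu> + recip s - 1 - real r" "0 < \<kappa>" and \<theta>: "\<kappa> < \<theta>"
    and \<nu>: "0 < D" "\<And>N k. 1 \<le> N \<Longrightarrow> k \<le> N \<Longrightarrow> \<bar>1 - \<nu> N k\<bar> \<le> D * (real k / real N) powr \<theta>"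
  obtains A where "A > 0"
    "\<And>f \<xi> \<delta> N t. f \<in> W_ball \<alpha> s \<mu> \<Longrightarrow> 0 < \<delta> \<Longrightarrow> lp_norm p \<xi> \<le> ennreal \<delta> \<Longrightarrow> 1 \<le> N \<Longrightarrow> 0 < t \<Longrightarrow>
      \<bar>(rderiv r f t - psi_S \<alpha> r \<nu> N (\<lambda>k. coeffs_w \<alpha> f k + \<xi> k) t) * sqrt (weight \<alpha> t)\<bar>
        \<le> A * (real N powr (- \<kappa>) + \<delta> * real N powr (real r + 1 - recip p))"
proof -
  obtain C where C: "C > 0"
    "\<And>k t. 0 < t \<Longrightarrow> \<bar>(deriv ^^ r) (ell \<alpha> k) t * sqrt (weight \<alpha> t)\<bar> \<le> C * real k ^ r"
    using deriv_ell_weighted_bound'[OF \<alpha> r] by blast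
  define A1 where "A1 = (1 + 1 / \<kappa>) + D * (2 + 1 / (\<theta> - \<kappa>))"
  define A2 where "A2 = 2 * (1 + D)"
  have A: "0 < A1" "0 < A2" using \<kappa> \<theta> \<nu>(1) by (auto simp: A1_def A2_def intro!: add_pos_pos mult_pos_pos)
  show ?thesis
  proof
    show "C * (A1 + A2) > 0" using A C by simp
    fix f \<xi> :: "_ \<Rightarrow> real" and \<delta> t :: real and N :: nat
    assume f: "f \<in> W_ball \<alpha> s \<mu>" and \<delta>: "0 < \<delta>" and \<xi>: "lp_norm p \<xi> \<le> ennreal \<delta>"
      and N: "1 \<le> N" and t: "0 < t"
    define a where "a = coeffs_w \<alpha> f"
    define e where "e k = (deriv ^^ r) (ell \<alpha> k) t * sqrt (weight \<alpha> t)" for k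
    define v where "v = \<nu> N"
    define x where "x k = \<bar>a k\<bar> * real k ^ r" for k
    have e: "\<bar>e k\<bar> \<le> C * real k ^ r" for k using C(2)[OF t] by (simp add: e_def)
    have e0: "e 0 = 0" using e[of 0] r by (simp add: power_0_left)
    obtain c where c: "\<And>k. 0 \<le> c k" "summable c" "(\<Sum>k. c k) \<le> 1"
      "\<And>k. 1 \<le> k \<Longrightarrow> x k \<le> real k powr (- 1 - \<kappa>) + real k powr (- \<kappa>) * c k"
      using W_ball_coeff_split[OF s \<kappa>(1) f] unfolding x_def a_def by blast
    have x0: "0 \<le> x k" for k by (simp add: x_def)
    have sm: "summable (\<lambda>k. \<bar>coeffs_w \<alpha> f k\<bar> * real (k + 1) ^ r)" by (rule W_ball_summable[OF s \<kappa> f])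
    have fL: "f \<in> L2w \<alpha>" using f by (simp add: W_ball_def)
    have sde: "summable (\<lambda>k. a k * (deriv ^^ r) (ell \<alpha> k) t)"
      using summable_rabs_cancel[OF summable_ell_series[OF \<alpha> r sm t order_refl]] by (simp add: a_def)
    have sae: "summable (\<lambda>k. a k * e k)"
      using summable_mult2[OF sde, of "sqrt (weight \<alpha> t)"] by (simp add: e_def mult_ac)
    have "rderiv r f t * sqrt (weight \<alpha> t) = (\<Sum>k. a k * e k)"
      using suminf_mult2[OF sde, of "sqrt (weight \<alpha> t)"]
      by (simp add: rderiv_eq_ell_series[OF \<alpha> r fL sm t] ell_series_def a_def[symmetric] e_def mult_ac)
    also have "\<dots> = (\<Sum>k. a (k + Suc N) * e (k + Suc N)) + (\<Sum>k<Suc N. a k * e k)"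
      by (rule suminf_split_initial_segment[OF sae])
    finally have R: "rderiv r f t * sqrt (weight \<alpha> t)
      = (\<Sum>k. a (k + Suc N) * e (k + Suc N)) + (\<Sum>k\<le>N. a k * e k)"
      by (simp add: lessThan_Suc_atMost)
    have P: "psi_S \<alpha> r \<nu> N (\<lambda>k. a k + \<xi> k) t * sqrt (weight \<alpha> t) = (\<Sum>k\<le>N. v k * (a k + \<xi> k) * e k)"
      unfolding psi_S_eq sum_distrib_right by (simp add: e_def v_def mult_ac)
    have "(rderiv r f t - psi_S \<alpha> r \<nu> N (\<lambda>k. a k + \<xi> k) t) * sqrt (weight \<alpha> t)
      = (\<Sum>k. a (k + Suc N) * e (k + Suc N)) + (\<Sum>k\<le>N. ((1 - v k) * a k - v k * \<xi> k) * e k)"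
    proof -
      have sp: "((1 - v k) * a k - v k * \<xi> k) * e k = a k * e k - v k * (a k + \<xi> k) * e k" for k
        by (simp add: algebra_simps)
      show ?thesis unfolding left_diff_distrib[of "rderiv r f t"] R P sp sum_subtractf by simp
    qed
    \<comment> \<open>The term k = 0 vanishes with e 0, and the estimates of the powers of k start
      at 1.\<close>
    also have "(\<Sum>k\<le>N. ((1 - v k) * a k - v k * \<xi> k) * e k) = (\<Sum>k=1..N. ((1 - v k) * a k - v k * \<xi> k) * e k)"
      by (rule sum.mono_neutral_right) (auto simp: e0 not_le)
    finally have eq: "(rderiv r f t - psi_S \<alpha> r \<nu> N (\<lambda>k. a k + \<xi> k) t) * sqrt (weight \<alpha> t)
      = (\<Sum>k. a (k + Suc N) * e (k + Suc N)) + (\<Sum>k=1..N. ((1 - v k) * a k - v k * \<xi> k) * e k)" .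
    have tail: "summable (\<lambda>k. x (k + Suc N))"
      "(\<Sum>k. x (k + Suc N)) \<le> (1 + 1 / \<kappa>) * real N powr (- \<kappa>)"
      using split_tail_le[of c x \<kappa> N] c x0 \<kappa>(2) N by auto
    have aex: "\<bar>a k * e k\<bar> \<le> C * x k" for k
      using mult_left_mono[OF e[of k], of "\<bar>a k\<bar>"] by (simp add: x_def abs_mult mult_ac)
    have "\<bar>\<Sum>k. a (k + Suc N) * e (k + Suc N)\<bar> \<le> (\<Sum>k. C * x (k + Suc N))"
      using norm_suminf_le[of "\<lambda>k. a (k + Suc N) * e (k + Suc N)", OF _ summable_mult[OF tail(1)]] aex
      by simp
    also have "\<dots> = C * (\<Sum>k. x (k + Suc N))" by (rule suminf_mult[OF tail(1)])
    also have "\<dots> \<le> C * ((1 + 1 / \<kappa>) * real N powr (- \<kappa>))"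
      using C by (intro mult_left_mono tail) auto
    finally have T: "\<bar>\<Sum>k. a (k + Suc N) * e (k + Suc N)\<bar> \<le> C * ((1 + 1 / \<kappa>) * real N powr (- \<kappa>))" .
    have summand: "\<bar>((1 - v k) * a k - v k * \<xi> k) * e k\<bar>
        \<le> C * (D * (x k * (real k / real N) powr \<theta>) + (1 + D) * (\<bar>\<xi> k\<bar> * real k ^ r))" if k: "k \<in> {1..N}" for k
    proof -
      have d: "\<bar>1 - v k\<bar> \<le> D * (real k / real N) powr \<theta>" using \<nu>(2)[OF N] k by (simp add: v_def)
      \<comment> \<open>For k \<le> N the damping is at most D, so the multipliers themselves are
        bounded by 1 + D; this is the factor in front of the noise.\<close>
      have "(real k / real N) powr \<theta> \<le> 1 powr \<theta>" using k N \<kappa> \<theta> by (intro powr_mono2) auto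
      hence "D * (real k / real N) powr \<theta> \<le> D" using \<nu>(1) by (simp add: mult_left_le)
      hence v: "\<bar>v k\<bar> \<le> 1 + D" using d by linarith
      have "\<bar>(1 - v k) * a k - v k * \<xi> k\<bar> \<le> \<bar>1 - v k\<bar> * \<bar>a k\<bar> + \<bar>v k\<bar> * \<bar>\<xi> k\<bar>"
        by (metis abs_mult abs_triangle_ineq4)
      also have "\<dots> \<le> D * (real k / real N) powr \<theta> * \<bar>a k\<bar> + (1 + D) * \<bar>\<xi> k\<bar>"
        using d v by (intro add_mono mult_right_mono) auto
      finally have "\<bar>(1 - v k) * a k - v k * \<xi> k\<bar> * \<bar>e k\<bar>
         \<le> (D * (real k / real N) powr \<theta> * \<bar>a k\<bar> + (1 + D) * \<bar>\<xi> k\<bar>) * (C * real k ^ r)"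
        using e \<nu>(1) by (intro mult_mono) auto
      also have "\<dots> = C * (D * (x k * (real k / real N) powr \<theta>) + (1 + D) * (\<bar>\<xi> k\<bar> * real k ^ r))"
        by (simp add: x_def algebra_simps)
      finally show ?thesis by (simp only: abs_mult)
    qed
    have "\<bar>\<Sum>k=1..N. ((1 - v k) * a k - v k * \<xi> k) * e k\<bar>
      \<le> (\<Sum>k=1..N. C * (D * (x k * (real k / real N) powr \<theta>) + (1 + D) * (\<bar>\<xi> k\<bar> * real k ^ r)))"
      by (rule order_trans[OF sum_abs sum_mono]) (rule summand)
    also have "\<dots> = C * (D * (\<Sum>k=1..N. x k * (real k / real N) powr \<theta>) + (1 + D) * (\<Sum>k=1..N. \<bar>\<xi> k\<bar> * real k ^ r))"
      by (simp only: sum_distrib_left[symmetric] sum.distrib)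
    also have "\<dots> \<le> C * (D * ((2 + 1 / (\<theta> - \<kappa>)) * real N powr (- \<kappa>)) + (1 + D) * (2 * \<delta> * real N powr (real r + 1 - recip p)))"
      using C \<nu>(1)
      by (intro mult_left_mono add_mono split_head_le[OF c \<theta> N] lp_ball_weighted_sum_le[OF p \<delta> \<xi> r]) auto
    finally have H: "\<bar>\<Sum>k=1..N. ((1 - v k) * a k - v k * \<xi> k) * e k\<bar>
      \<le> C * (D * ((2 + 1 / (\<theta> - \<kappa>)) * real N powr (- \<kappa>)) + (1 + D) * (2 * \<delta> * real N powr (real r + 1 - recip p)))" .
    define X Y where "X = real N powr (- \<kappa>)" and "Y = \<delta> * real N powr (real r + 1 - recip p)"
    have XY: "0 \<le> X" "0 \<le> Y" using \<delta> by (auto simp: X_def Y_def)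
    have "\<bar>(rderiv r f t - psi_S \<alpha> r \<nu> N (\<lambda>k. a k + \<xi> k) t) * sqrt (weight \<alpha> t)\<bar>
      \<le> C * ((1 + 1 / \<kappa>) * X) + C * (D * ((2 + 1 / (\<theta> - \<kappa>)) * X) + (1 + D) * (2 * Y))"
      unfolding eq using abs_triangle_ineq T H by (simp add: X_def Y_def mult_ac)
    also have "\<dots> = C * (A1 * X + A2 * Y)" by (simp add: A1_def A2_def algebra_simps)
    also have "\<dots> \<le> C * ((A1 + A2) * X + (A1 + A2) * Y)"
      using C A XY by (intro mult_left_mono add_mono mult_right_mono) auto
    finally show "\<bar>(rderiv r f t - psi_S \<alpha> r \<nu> N (\<lambda>k. coeffs_w \<alpha> f k + \<xi> k) t) * sqrt (weight \<alpha> t)\<bar>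
        \<le> C * (A1 + A2) * (real N powr (- \<kappa>) + \<delta> * real N powr (real r + 1 - recip p))"
      by (simp add: a_def X_def Y_def algebra_simps)
  qed
qed

theorem psi_S_recovery_error:
  assumes \<alpha>: "0 \<le> \<alpha>" and r: "1 \<le> r" and s: "1 \<le> s" and p: "1 \<le> p"
    and \<kappa>: "\<kappa> = \<mu> + recip s - 1 - real r" "0 < \<kappa>" and \<theta>: "\<kappa> < \<theta>"
    and d: "d = \<mu> + recip s - recip p"
    and \<nu>: "\<nu> \<in> S_class \<theta>" and a: "0 < a1" "a1 \<le> a2"
  obtains c where "c > 0"
    "\<And>\<delta> N. 0 < \<delta> \<Longrightarrow> 1 \<le> N \<Longrightarrow> a1 * \<delta> powr (- 1 / d) \<le> real N \<Longrightarrow> real N \<le> a2 * \<delta> powr (- 1 / d) \<Longrightarrow>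
       recovery_error \<alpha> r \<delta> (W_ball \<alpha> s \<mu>) (psi_S \<alpha> r \<nu> N) p \<le> ennreal (c * \<delta> powr (\<kappa> / d))"
proof -
  obtain D where D: "0 < D" "\<And>N k. 1 \<le> N \<Longrightarrow> k \<le> N \<Longrightarrow> \<bar>1 - \<nu> N k\<bar> \<le> D * (real k / real N) powr \<theta>"
    using \<nu> by (auto simp: S_class_def)
  obtain A where A: "A > 0"
    "\<And>f \<xi> \<delta> N t. f \<in> W_ball \<alpha> s \<mu> \<Longrightarrow> 0 < \<delta> \<Longrightarrow> lp_norm p \<xi> \<le> ennreal \<delta> \<Longrightarrow> 1 \<le> N \<Longrightarrow> 0 < t \<Longrightarrow>
      \<bar>(rderiv r f t - psi_S \<alpha> r \<nu> N (\<lambda>k. coeffs_w \<alpha> f k + \<xi> k) t) * sqrt (weight \<alpha> t)\<bar>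
        \<le> A * (real N powr (- \<kappa>) + \<delta> * real N powr (real r + 1 - recip p))"
    using psi_S_pointwise_error[where \<nu> = \<nu>, OF \<alpha> r s p \<kappa> \<theta> D] by blast
  \<comment> \<open>The noise contributes \<delta> N^q. As d = \<kappa> + q, both N^(-\<kappa>) and
    \<delta> N^q have order \<delta>^(\<kappa>/d) for the prescribed N; the first needs the bound
    with a1, the second the one with a2.\<close>
  define q where "q = real r + 1 - recip p"
  have q: "0 \<le> q" using recip_bounds[OF p] by (simp add: q_def)
  have dk: "d = \<kappa> + q" using \<kappa> d by (simp add: q_def)
  have d0: "0 < d" using dk \<kappa> q by simp
  show ?thesis
  proof
    show "A * (a1 powr (- \<kappa>) + a2 powr q) > 0" using A a by (intro mult_pos_pos add_pos_pos) auto
    fix \<delta> :: real and N :: nat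
    assume \<delta>: "0 < \<delta>" and N: "1 \<le> N" "a1 * \<delta> powr (- 1 / d) \<le> real N" "real N \<le> a2 * \<delta> powr (- 1 / d)"
    have "real N powr (- \<kappa>) \<le> (a1 * \<delta> powr (- 1 / d)) powr (- \<kappa>)"
      using N a \<delta> \<kappa> by (intro powr_mono2') auto
    also have "\<dots> = a1 powr (- \<kappa>) * \<delta> powr (\<kappa> / d)"
      using a \<delta> by (simp add: powr_mult powr_powr)
    finally have 1: "real N powr (- \<kappa>) \<le> a1 powr (- \<kappa>) * \<delta> powr (\<kappa> / d)" .
    have "real N powr q \<le> (a2 * \<delta> powr (- 1 / d)) powr q"
      using N q by (intro powr_mono2) auto
    also have "\<dots> = a2 powr q * \<delta> powr (- q / d)"
      using a \<delta> by (simp add: powr_mult powr_powr)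
    finally have "\<delta> * real N powr q \<le> a2 powr q * (\<delta> powr 1 * \<delta> powr (- q / d))"
      using \<delta> by (simp add: mult_ac)
    also have "\<delta> powr 1 * \<delta> powr (- q / d) = \<delta> powr (\<kappa> / d)"
    proof -
      have "1 + - q / d = \<kappa> / d" using d0 dk by (simp add: field_simps)
      thus ?thesis by (simp only: powr_add[symmetric])
    qed
    finally have 2: "\<delta> * real N powr q \<le> a2 powr q * \<delta> powr (\<kappa> / d)" .
    have "real N powr (- \<kappa>) + \<delta> * real N powr q \<le> (a1 powr (- \<kappa>) + a2 powr q) * \<delta> powr (\<kappa> / d)"
      using 1 2 by (simp add: distrib_right)
    from mult_left_mono[OF this, of A] A(1)
    have B: "A * (real N powr (- \<kappa>) + \<delta> * real N powr q) \<le> A * (a1 powr (- \<kappa>) + a2 powr q) * \<delta> powr (\<kappa> / d)"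
      by (simp add: mult.assoc)
    show "recovery_error \<alpha> r \<delta> (W_ball \<alpha> s \<mu>) (psi_S \<alpha> r \<nu> N) p
      \<le> ennreal (A * (a1 powr (- \<kappa>) + a2 powr q) * \<delta> powr (\<kappa> / d))"
      unfolding recovery_error_def C_norm_def
    proof (intro SUP_least ennreal_leI)
      fix f \<xi> :: "_ \<Rightarrow> real" and t :: real
      assume "f \<in> W_ball \<alpha> s \<mu>" "\<xi> \<in> {\<xi>. lp_norm p \<xi> \<le> ennreal \<delta>}" "t \<in> {0<..}"
      thus "\<bar>(rderiv r f t - psi_S \<alpha> r \<nu> N (\<lambda>k. coeffs_w \<alpha> f k + \<xi> k) t) * sqrt (weight \<alpha> t)\<bar>
        \<le> A * (a1 powr (- \<kappa>) + a2 powr q) * \<delta> powr (\<kappa> / d)"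
        using A(2)[of f \<delta> \<xi> N t] \<delta> N B by (auto simp: q_def intro: order_trans)
    qed
  qed
qed


section \<open>Lower bound\<close>

lemma pochhammer_ge_1:
  fixes x :: real
  assumes "1 \<le> x"
  shows "1 \<le> pochhammer x n"
proof (induction n)
  case (Suc n)
  have "1 * 1 \<le> pochhammer x n * (x + real n)"
    using Suc assms by (intro mult_mono) auto
  thus ?case by (simp add: pochhammer_Suc)
qed simp

text \<open>For m t \<le> 1/4 the constant term dominates. Since Gamma(i + a + 1) \<ge> Gamma(a +
  1), the other terms are at most that constant times (m choose i) t^i, and these sum to (1 + t)^m -
  1 \<le> exp (1/4) - 1 < 1/2.\<close>

lemma Laguerre_lower_bound:
  assumes a: "0 \<le> a" and t: "0 \<le> t" "real m * t \<le> 1 / 4"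
  shows "gamma_ratio a m / (2 * Gamma (a + 1)) \<le> Laguerre a m t"
proof -
  define g where "g = gamma_ratio a m"
  define G where "G = Gamma (a + 1)"
  have g: "0 < g" using gamma_ratio_pos[OF a] by (simp add: g_def)
  have G: "0 < G" using a by (simp add: G_def)
  define u where "u i = g * ((-1) ^ i * real (m choose i) / Gamma (real i + a + 1)) * t ^ i" for i
  have bnd: "\<bar>u i\<bar> \<le> g / G * (real (m choose i) * t ^ i)" for i
  proof -
    have "pochhammer (a + 1) i = Gamma (a + 1 + real i) / Gamma (a + 1)"
      using a by (intro pochhammer_Gamma) (auto elim!: nonpos_Ints_cases)
    moreover have "1 \<le> pochhammer (a + 1) i" using a by (intro pochhammer_ge_1) auto
    ultimately have GG: "G \<le> Gamma (real i + a + 1)"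
      using G by (simp add: G_def field_simps)
    have "\<bar>u i\<bar> = g * (real (m choose i) * t ^ i) / Gamma (real i + a + 1)"
      using g t GG G by (simp add: u_def abs_mult power_abs)
    also have "\<dots> \<le> g * (real (m choose i) * t ^ i) / G"
      using g t G GG by (intro divide_left_mono mult_nonneg_nonneg mult_pos_pos) auto
    finally show ?thesis by simp
  qed
  have "(1 + t) ^ m \<le> exp t ^ m" using t exp_ge_add_one_self[of t] by (intro power_mono) auto
  also have "\<dots> = exp (real m * t)" by (rule exp_of_nat_mult[symmetric])
  also have "\<dots> \<le> exp (1 / 4)" using t by simp
  also have "\<dots> \<le> 1 + 1 / 4 + (1 / 4)\<^sup>2" by (intro exp_bound) auto
  finally have e: "(1 + t) ^ m - 1 \<le> 1 / 2" by (simp add: power2_eq_square)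
  have "(t + 1) ^ m = (\<Sum>i\<le>m. real (m choose i) * t ^ i)"
    by (subst binomial_ring) simp
  also have "\<dots> = 1 + (\<Sum>i\<in>{..m} - {0}. real (m choose i) * t ^ i)"
    by (subst sum.remove[of _ 0]) auto
  finally have b: "(\<Sum>i\<in>{..m} - {0}. real (m choose i) * t ^ i) \<le> 1 / 2"
    using e by (simp add: add.commute)
  have "Laguerre a m t = (\<Sum>i\<le>m. u i)" unfolding u_def g_def by (rule Laguerre_Gamma[OF a])
  also have "\<dots> = g / G + (\<Sum>i\<in>{..m} - {0}. u i)"
    by (subst sum.remove[of _ 0]) (auto simp: u_def G_def)
  finally have L: "Laguerre a m t = g / G + (\<Sum>i\<in>{..m} - {0}. u i)" .
  have "\<bar>\<Sum>i\<in>{..m} - {0}. u i\<bar> \<le> (\<Sum>i\<in>{..m} - {0}. g / G * (real (m choose i) * t ^ i))"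
    by (rule order_trans[OF sum_abs sum_mono]) (rule bnd)
  also have "\<dots> = g / G * (\<Sum>i\<in>{..m} - {0}. real (m choose i) * t ^ i)"
    by (rule sum_distrib_left[symmetric])
  also have "\<dots> \<le> g / G * (1 / 2)" using b g G by (intro mult_left_mono) auto
  finally show ?thesis unfolding L g_def[symmetric] G_def[symmetric] by (simp add: field_simps)
qed

text \<open>The point 1/(8N) lies so close to 0 that for all k < 2N the differentiated polynomial
  still has the sign and order of its value at 0. The powers of N are \<alpha> + r from that value,
  -\<alpha>/2 from the normalisation and -\<alpha>/2 from the weight. The condition 2r \<le> N gives
  k - r + 1 \<ge> (k + 1)/2.\<close>

lemma deriv_ell_lower_bound:
  assumes \<alpha>: "0 \<le> \<alpha>"
  obtains c where "c > 0"
    "\<And>N k. 1 \<le> N \<Longrightarrow> 2 * r \<le> N \<Longrightarrow> N \<le> k \<Longrightarrow> k < 2 * N \<Longrightarrow>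
       c * real N ^ r \<le> (-1) ^ r * (deriv ^^ r) (ell \<alpha> k) (1 / (8 * real N)) * sqrt (weight \<alpha> (1 / (8 * real N)))"
proof -
  define b where "b = \<alpha> + real r"
  have b: "0 \<le> b" using \<alpha> by (simp add: b_def)
  obtain c1 where c1: "c1 > 0" "\<And>k. c1 * real (k + 1) powr b \<le> gamma_ratio b k"
    using gamma_ratio_bounds[OF b] by metis
  obtain C2 where C2: "C2 > 0" "\<And>k. gamma_ratio \<alpha> k \<le> C2 * real (k + 1) powr \<alpha>"
    using gamma_ratio_bounds[OF \<alpha>] by metis
  define G where "G = Gamma (b + 1)"
  have G: "0 < G" using b by (simp add: G_def)
  \<comment> \<open>In turn: the lower bound for the polynomial, the normalisation, and the weight
    at t = 1/(8N), where (1/8)^(\<alpha>/2) comes from the power and exp (- 1) \<le> exp (- t / 2)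
    from t \<le> 1.\<close>
  define c where "c = c1 * (1 / 2) powr b / (2 * G) / sqrt C2 * (1 / 8) powr (\<alpha> / 2) * exp (- 1)"
  show ?thesis
  proof
    show "c > 0" using c1 C2 G by (simp add: c_def)
    fix N k :: nat
    assume N: "1 \<le> N" "2 * r \<le> N" "N \<le> k" "k < 2 * N"
    define t where "t = 1 / (8 * real N)"
    have N0: "0 < real N" using N by simp
    have t: "0 < t" "t \<le> 1" using N by (auto simp: t_def field_simps)
    have kr: "r \<le> k" using N by simp
    have "real (k - r) * t \<le> (2 * real N) * t" using N t by (intro mult_right_mono) auto
    also have "\<dots> = 1 / 4" using N0 by (simp add: t_def)
    finally have kt: "real (k - r) * t \<le> 1 / 4" .
    have "c1 * ((1 / 2) powr b * real (k + 1) powr b) = c1 * ((1 / 2) * real (k + 1)) powr b"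
      by (subst powr_mult) auto
    also have "\<dots> \<le> c1 * real (k - r + 1) powr b"
      using c1 b N by (intro mult_left_mono powr_mono2) (auto simp: of_nat_diff)
    also have "\<dots> \<le> gamma_ratio b (k - r)" by (rule c1)
    finally have "c1 * ((1 / 2) powr b * real (k + 1) powr b) / (2 * G) \<le> gamma_ratio b (k - r) / (2 * G)"
      using G by (intro divide_right_mono) auto
    also have "\<dots> \<le> Laguerre b (k - r) t"
      unfolding G_def using t kt by (intro Laguerre_lower_bound b) auto
    finally have L: "c1 * ((1 / 2) powr b * real (k + 1) powr b) / (2 * G) \<le> Laguerre b (k - r) t" .
    have "sqrt (gamma_ratio \<alpha> k) \<le> sqrt (C2 * real (k + 1) powr \<alpha>)" using C2 by simp
    also have "\<dots> = sqrt C2 * real (k + 1) powr (\<alpha> / 2)"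
      by (simp add: real_sqrt_mult powr_half_sqrt[symmetric] powr_powr)
    finally have S: "sqrt (gamma_ratio \<alpha> k) \<le> sqrt C2 * real (k + 1) powr (\<alpha> / 2)" .
    have "c1 * (1 / 2) powr b / (2 * G) / sqrt C2 * real N powr (real r + \<alpha> / 2)
      \<le> c1 * (1 / 2) powr b / (2 * G) / sqrt C2 * real (k + 1) powr (real r + \<alpha> / 2)"
      using c1 C2 G N \<alpha> by (intro mult_left_mono powr_mono2) auto
    also have "real (k + 1) powr (real r + \<alpha> / 2) = real (k + 1) powr b / real (k + 1) powr (\<alpha> / 2)"
      by (simp add: b_def powr_diff[symmetric] add.commute)
    also have "c1 * (1 / 2) powr b / (2 * G) / sqrt C2 * (real (k + 1) powr b / real (k + 1) powr (\<alpha> / 2))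
       = (c1 * ((1 / 2) powr b * real (k + 1) powr b) / (2 * G)) / (sqrt C2 * real (k + 1) powr (\<alpha> / 2))"
      by simp
    also have "\<dots> \<le> Laguerre b (k - r) t / sqrt (gamma_ratio \<alpha> k)"
    proof (rule frac_le[OF _ L _ S])
      show "0 \<le> Laguerre b (k - r) t" using c1 G by (intro order_trans[OF _ L]) auto
    qed (use gamma_ratio_pos[OF \<alpha>] in simp)
    also have "\<dots> = (-1) ^ r * (deriv ^^ r) (ell \<alpha> k) t"
    proof -
      have "(-1 :: real) ^ r * (-1) ^ r = 1" by (simp flip: power_mult_distrib)
      thus ?thesis using kr by (simp add: deriv_funpow_ell b_def mult.assoc[symmetric])
    qed
    finally have d: "c1 * (1 / 2) powr b / (2 * G) / sqrt C2 * real N powr (real r + \<alpha> / 2)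
       \<le> (-1) ^ r * (deriv ^^ r) (ell \<alpha> k) t" .
    have w: "(1 / 8) powr (\<alpha> / 2) * real N powr (- (\<alpha> / 2)) * exp (- 1) \<le> sqrt (weight \<alpha> t)"
    proof -
      have "(1 / 8) powr (\<alpha> / 2) * real N powr (- (\<alpha> / 2)) = t powr (\<alpha> / 2)"
        using N0 by (simp add: t_def powr_divide powr_mult powr_minus field_simps)
      moreover have "exp (- 1) \<le> exp (- t / 2)" using t by simp
      ultimately show ?thesis using t by (simp add: sqrt_weight)
    qed
    have "c * real N ^ r = c * (real N powr (real r + \<alpha> / 2) * real N powr (- (\<alpha> / 2)))"
      using N0 by (simp add: powr_add[symmetric] powr_realpow)
    also have "\<dots> = (c1 * (1 / 2) powr b / (2 * G) / sqrt C2 * real N powr (real r + \<alpha> / 2))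
       * ((1 / 8) powr (\<alpha> / 2) * real N powr (- (\<alpha> / 2)) * exp (- 1))"
      by (simp add: c_def)
    also have "\<dots> \<le> ((-1) ^ r * (deriv ^^ r) (ell \<alpha> k) t) * sqrt (weight \<alpha> t)"
    proof (rule mult_mono[OF d w])
      show "0 \<le> (-1) ^ r * (deriv ^^ r) (ell \<alpha> k) t"
        using c1 C2 G by (intro order_trans[OF _ d]) auto
    qed simp
    finally show "c * real N ^ r \<le> (-1) ^ r * (deriv ^^ r) (ell \<alpha> k) (1 / (8 * real N)) * sqrt (weight \<alpha> (1 / (8 * real N)))"
      by (simp add: t_def)
  qed
qed

lemma sum_ell_in_L2w:
  assumes \<alpha>: "0 \<le> \<alpha>"
  shows "(\<lambda>t. \<Sum>k\<in>A. b k * ell \<alpha> k t) \<in> L2w \<alpha>"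
proof -
  have "weight \<alpha> t * (\<Sum>k\<in>A. b k * ell \<alpha> k t)\<^sup>2
     = (\<Sum>j\<in>A. \<Sum>k\<in>A. b j * b k * (weight \<alpha> t * ell \<alpha> j t * ell \<alpha> k t))" for t
    unfolding power2_eq_square sum_product by (simp add: sum_distrib_left mult_ac)
  moreover have "integrable (lebesgue_on {0<..})
     (\<lambda>t. \<Sum>j\<in>A. \<Sum>k\<in>A. b j * b k * (weight \<alpha> t * ell \<alpha> j t * ell \<alpha> k t))"
    using has_integral_ell_ell[OF \<alpha>]
    by (intro Bochner_Integration.integrable_sum integrable_mult_right) (auto simp: has_bochner_integral_iff)
  moreover have "(\<lambda>t. \<Sum>k\<in>A. b k * ell \<alpha> k t) \<in> borel_measurable (lebesgue_on {0<..})"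
    by (intro borel_measurable_lebesgue_onI) measurable
  ultimately show ?thesis by (simp add: L2w_def)
qed

lemma coeffs_w_sum_ell:
  assumes \<alpha>: "0 \<le> \<alpha>" and A: "finite A"
  shows "coeffs_w \<alpha> (\<lambda>t. \<Sum>k\<in>A. b k * ell \<alpha> k t) = (\<lambda>n. if n \<in> A then b n else 0)"
proof
  fix n
  have "weight \<alpha> t * (\<Sum>k\<in>A. b k * ell \<alpha> k t) * ell \<alpha> n t
     = (\<Sum>k\<in>A. b k * (weight \<alpha> t * ell \<alpha> k t * ell \<alpha> n t))" for t
    by (simp add: sum_distrib_left sum_distrib_right mult_ac)
  moreover have "has_bochner_integral (lebesgue_on {0<..})
      (\<lambda>t. \<Sum>k\<in>A. b k * (weight \<alpha> t * ell \<alpha> k t * ell \<alpha> n t)) (\<Sum>k\<in>A. b k * (if k = n then 1 else 0))"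
    by (intro has_bochner_integral_sum has_bochner_integral_mult_right has_integral_ell_ell \<alpha>)
  ultimately have "coeffs_w \<alpha> (\<lambda>t. \<Sum>k\<in>A. b k * ell \<alpha> k t) n = (\<Sum>k\<in>A. b k * (if k = n then 1 else 0))"
    by (simp add: coeffs_w_def inner_w_def has_bochner_integral_integral_eq)
  also have "\<dots> = (\<Sum>k\<in>A. if k = n then b k else 0)" by (intro sum.cong) auto
  also have "\<dots> = (if n \<in> A then b n else 0)" using A by simp
  finally show "coeffs_w \<alpha> (\<lambda>t. \<Sum>k\<in>A. b k * ell \<alpha> k t) n = (if n \<in> A then b n else 0)" .
qed

lemma rderiv_sum_ell:
  assumes \<alpha>: "0 \<le> \<alpha>" and r: "1 \<le> r" and A: "finite A" and t: "0 < t"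
  shows "rderiv r (\<lambda>t. \<Sum>k\<in>A. b k * ell \<alpha> k t) t = (\<Sum>k\<in>A. b k * (deriv ^^ r) (ell \<alpha> k) t)"
proof -
  let ?f = "\<lambda>t. \<Sum>k\<in>A. b k * ell \<alpha> k t"
  have "rderiv r ?f t = ell_series \<alpha> (coeffs_w \<alpha> ?f) r t"
    using A by (intro rderiv_eq_ell_series \<alpha> r t sum_ell_in_L2w)
       (auto simp: coeffs_w_sum_ell[OF \<alpha> A] intro!: summable_finite[OF A])
  also have "\<dots> = (\<Sum>k\<in>A. (if k \<in> A then b k else 0) * (deriv ^^ r) (ell \<alpha> k) t)"
    unfolding ell_series_def coeffs_w_sum_ell[OF \<alpha> A] by (rule suminf_finite[OF A]) auto
  finally show ?thesis by simp
qed

lemma lp_norm_finite_support_le: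
  assumes q: "1 \<le> q" and A: "finite A" "A \<noteq> {}" and z: "0 \<le> z"
    and x: "\<And>k. k \<in> A \<Longrightarrow> \<bar>x k\<bar> \<le> z" "\<And>k. k \<notin> A \<Longrightarrow> x k = 0"
  shows "lp_norm q x \<le> ennreal (z * real (card A) powr recip q)"
proof (cases "q = \<infinity>")
  case True
  have "\<bar>x k\<bar> \<le> z" for k using x z by (cases "k \<in> A") auto
  moreover have "card A \<noteq> 0" using A by simp
  ultimately show ?thesis using True by (auto simp: lp_norm_def intro!: SUP_least ennreal_leI)
next
  case False
  define P where "P = enn2real q"
  have P: "1 \<le> P" "recip q = 1 / P" using recip_finite[OF q False] by (auto simp: P_def)
  have sm: "summable (\<lambda>k. \<bar>x k\<bar> powr P)"
    by (rule summable_finite[OF A(1)]) (simp add: x)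
  have "(\<Sum>k. \<bar>x k\<bar> powr P) = (\<Sum>k\<in>A. \<bar>x k\<bar> powr P)"
    by (rule suminf_finite[OF A(1)]) (simp add: x)
  also have "\<dots> \<le> (\<Sum>k\<in>A. z powr P)" using x P by (intro sum_mono powr_mono2) auto
  also have "\<dots> = real (card A) * z powr P" by simp
  finally have "(\<Sum>k. \<bar>x k\<bar> powr P) powr (1 / P) \<le> (real (card A) * z powr P) powr (1 / P)"
    using P by (intro powr_mono2 suminf_nonneg sm) auto
  also have "\<dots> = z * real (card A) powr (1 / P)"
    using P z by (simp add: powr_mult powr_powr)
  finally show ?thesis using False sm by (simp add: lp_norm_def P_def P(2)[unfolded P_def] ennreal_leI)
qed

text \<open>Opposite functions in the class whose coefficient sequences lie in the noise ball both produce
  the data \<open>0\<close>, so no recovery operator can distinguish them.\<close>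

lemma recovery_error_lower_bound:
  assumes f: "f \<in> W" "g \<in> W"
    and coeffs: "\<And>k. coeffs_w \<alpha> g k = - coeffs_w \<alpha> f k"
    and small: "lp_norm p (coeffs_w \<alpha> f) \<le> ennreal \<delta>" "lp_norm p (coeffs_w \<alpha> g) \<le> ennreal \<delta>"
    and t: "0 < t" and opp: "rderiv r g t = - rderiv r f t"
  shows "ennreal (\<bar>rderiv r f t\<bar> * sqrt (weight \<alpha> t)) \<le> recovery_error \<alpha> r \<delta> W \<psi> p"
proof -
  \<comment> \<open>All data considered equal the zero sequence, so \<psi> enters only through this
    one number, the same for f and for g.\<close>
  define v where "v = \<psi> (\<lambda>k. 0) t"
  have err: "ennreal \<bar>(rderiv r h t - v) * sqrt (weight \<alpha> t)\<bar> \<le> recovery_error \<alpha> r \<delta> W \<psi> p"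
    if h: "h \<in> W" "\<xi> = (\<lambda>k. - coeffs_w \<alpha> h k)" "lp_norm p \<xi> \<le> ennreal \<delta>" for h \<xi>
  proof -
    have "ennreal \<bar>(rderiv r h t - v) * sqrt (weight \<alpha> t)\<bar>
      \<le> C_norm (\<lambda>t. (rderiv r h t - \<psi> (\<lambda>k. coeffs_w \<alpha> h k + \<xi> k) t) * sqrt (weight \<alpha> t))"
      unfolding C_norm_def h(2) by (rule SUP_upper2[of t]) (use t in \<open>auto simp: v_def\<close>)
    also have "\<dots> \<le> (SUP \<xi>\<in>{\<xi>. lp_norm p \<xi> \<le> ennreal \<delta>}.
        C_norm (\<lambda>t. (rderiv r h t - \<psi> (\<lambda>k. coeffs_w \<alpha> h k + \<xi> k) t) * sqrt (weight \<alpha> t)))"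
      by (rule SUP_upper) (use h in simp)
    also have "\<dots> \<le> recovery_error \<alpha> r \<delta> W \<psi> p"
      unfolding recovery_error_def by (rule SUP_upper) (rule h)
    finally show ?thesis .
  qed
  have "(\<lambda>k. - coeffs_w \<alpha> f k) = coeffs_w \<alpha> g" "(\<lambda>k. - coeffs_w \<alpha> g k) = coeffs_w \<alpha> f"
    using coeffs by (auto simp: fun_eq_iff)
  hence 1: "ennreal \<bar>(rderiv r f t - v) * sqrt (weight \<alpha> t)\<bar> \<le> recovery_error \<alpha> r \<delta> W \<psi> p"
    and 2: "ennreal \<bar>(- rderiv r f t - v) * sqrt (weight \<alpha> t)\<bar> \<le> recovery_error \<alpha> r \<delta> W \<psi> p"
    using err[OF f(1) refl] err[OF f(2) refl] small opp by auto
  \<comment> \<open>The two values to be recovered are 2 |rderiv r f t| apart, so v misses one of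
    them by at least half of that.\<close>
  have "\<bar>rderiv r f t\<bar> \<le> \<bar>rderiv r f t - v\<bar> \<or> \<bar>rderiv r f t\<bar> \<le> \<bar>- rderiv r f t - v\<bar>"
    by linarith
  hence "\<bar>rderiv r f t\<bar> * sqrt (weight \<alpha> t) \<le> \<bar>(rderiv r f t - v) * sqrt (weight \<alpha> t)\<bar>
      \<or> \<bar>rderiv r f t\<bar> * sqrt (weight \<alpha> t) \<le> \<bar>(- rderiv r f t - v) * sqrt (weight \<alpha> t)\<bar>"
    by (auto simp: abs_mult intro: mult_right_mono)
  thus ?thesis using 1 2 by (auto intro: order_trans[OF ennreal_leI])
qed

text \<open>Up to constants, N equal coefficients of size N^(-\<mu>-1/s) fill the ball, their norm
  as noise is N^(-d), and N derivatives of size N^r with equal signs add up to N^(1 + r - \<mu> -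
  1/s) = N^(-\<kappa>).\<close>

lemma optimal_error_lower_bound:
  assumes \<alpha>: "0 \<le> \<alpha>" and r: "1 \<le> r" and s: "1 \<le> s" and p: "1 \<le> p"
    and \<kappa>: "\<kappa> = \<mu> + recip s - 1 - real r" "0 < \<kappa>" and d: "d = \<mu> + recip s - recip p"
  obtains c where "c > 0"
    "\<And>N \<delta>. 2 * r \<le> N \<Longrightarrow> real N powr (- d) \<le> \<delta> \<Longrightarrow>
       ennreal (c * real N powr (- \<kappa>)) \<le> optimal_error \<alpha> r \<delta> (W_ball \<alpha> s \<mu>) p"
proof -
  obtain c where c: "c > 0"
    "\<And>N k. 1 \<le> N \<Longrightarrow> 2 * r \<le> N \<Longrightarrow> N \<le> k \<Longrightarrow> k < 2 * N \<Longrightarrow>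
       c * real N ^ r \<le> (-1) ^ r * (deriv ^^ r) (ell \<alpha> k) (1 / (8 * real N)) * sqrt (weight \<alpha> (1 / (8 * real N)))"
    using deriv_ell_lower_bound[OF \<alpha>, of r] by blast
  have \<mu>: "0 < \<mu>" using \<kappa> r recip_bounds[OF s] by linarith
  show ?thesis
  proof
    show "c * 2 powr (- \<mu>) > 0" using c by simp
    fix N :: nat and \<delta> :: real
    assume N2: "2 * r \<le> N" and \<delta>: "real N powr (- d) \<le> \<delta>"
    have N1: "1 \<le> N" using N2 r by simp
    hence N0: "0 < real N" by simp
    define A where "A = {N..<2 * N}"
    have A: "finite A" "A \<noteq> {}" "card A = N" using N1 by (auto simp: A_def)
    \<comment> \<open>Indices stay below 2N, so the weights are at most (2N)^\<mu>: the factor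
      2^(-\<mu>) absorbs the 2, and N^(-1/s) the number of indices.\<close>
    define M where "M = 2 powr (- \<mu>) * real N powr (- \<mu> - recip s)"
    have M: "0 < M" using N0 by (simp add: M_def)
    define F where "F z = (\<lambda>t. \<Sum>k\<in>A. z * ell \<alpha> k t)" for z :: real
    have cF: "coeffs_w \<alpha> (F z) = (\<lambda>n. if n \<in> A then z else 0)" for z
      unfolding F_def by (rule coeffs_w_sum_ell[OF \<alpha> A(1)])
    have W: "F z \<in> W_ball \<alpha> s \<mu>" if z: "\<bar>z\<bar> = M" for z
    proof -
      have "W_norm \<alpha> s \<mu> (F z) \<le> ennreal (((2 * real N) powr \<mu> * M) * real (card A) powr recip s)"
        unfolding W_norm_eq_lp_norm
      proof (rule lp_norm_finite_support_le[OF s A(1,2)])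
        fix k assume k: "k \<in> A"
        hence "real (max 1 k) powr \<mu> \<le> (2 * real N) powr \<mu>"
          using \<mu> N1 by (intro powr_mono2) (auto simp: A_def)
        thus "\<bar>real (max 1 k) powr \<mu> * coeffs_w \<alpha> (F z) k\<bar> \<le> (2 * real N) powr \<mu> * M"
          using k z M by (simp add: cF abs_mult mult_right_mono)
      qed (use M in \<open>auto simp: cF\<close>)
      also have "((2 * real N) powr \<mu> * M) * real (card A) powr recip s
         = (2 powr \<mu> * 2 powr (- \<mu>)) * (real N powr \<mu> * real N powr (- \<mu> - recip s) * real N powr recip s)"
        using N0 by (simp add: A(3) M_def powr_mult)
      also have "\<dots> = 1" using N0 by (simp add: powr_add[symmetric])
      finally show ?thesis unfolding W_ball_def F_def using sum_ell_in_L2w[OF \<alpha>] by simp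
    qed
    have small: "lp_norm p (coeffs_w \<alpha> (F z)) \<le> ennreal \<delta>" if z: "\<bar>z\<bar> = M" for z
    proof -
      have "lp_norm p (coeffs_w \<alpha> (F z)) \<le> ennreal (M * real (card A) powr recip p)"
        by (rule lp_norm_finite_support_le[OF p A(1,2)]) (use M z in \<open>auto simp: cF\<close>)
      also have "M * real (card A) powr recip p = 2 powr (- \<mu>) * (real N powr (- \<mu> - recip s) * real N powr recip p)"
        by (simp add: M_def A(3))
      also have "real N powr (- \<mu> - recip s) * real N powr recip p = real N powr (- d)"
        by (simp add: powr_add[symmetric] d algebra_simps)
      also have "2 powr (- \<mu>) * real N powr (- d) \<le> 1 * \<delta>"
      proof (rule mult_mono)
        show "2 powr (- \<mu>) \<le> (1 :: real)" using \<mu> powr_mono[of "- \<mu>" 0 2] by simp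
      qed (use \<delta> in auto)
      finally show ?thesis by (simp add: ennreal_leI)
    qed
    define t where "t = 1 / (8 * real N)"
    have t: "0 < t" using N0 by (simp add: t_def)
    have R: "rderiv r (F z) t = z * (\<Sum>k\<in>A. (deriv ^^ r) (ell \<alpha> k) t)" for z
      unfolding F_def rderiv_sum_ell[OF \<alpha> r A(1) t] by (simp add: sum_distrib_left)
    have "c * 2 powr (- \<mu>) * real N powr (- \<kappa>) = M * (real N * (c * real N ^ r))"
    proof -
      have "real N powr (- \<kappa>) = real N powr (- \<mu> - recip s) * (real N powr 1 * real N powr real r)"
      proof -
        have "- \<kappa> = (- \<mu> - recip s) + (1 + real r)" by (simp add: \<kappa>)
        thus ?thesis by (simp only: powr_add)
      qed
      thus ?thesis using N0 by (simp add: M_def powr_realpow)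
    qed
    also have "real N * (c * real N ^ r) = (\<Sum>k\<in>A. c * real N ^ r)" by (simp add: A)
    also have "\<dots> \<le> (\<Sum>k\<in>A. (-1) ^ r * (deriv ^^ r) (ell \<alpha> k) t * sqrt (weight \<alpha> t))"
      unfolding t_def by (intro sum_mono c(2) N1 N2) (auto simp: A_def)
    also have "\<dots> = (-1) ^ r * (\<Sum>k\<in>A. (deriv ^^ r) (ell \<alpha> k) t) * sqrt (weight \<alpha> t)"
      by (simp add: sum_distrib_left sum_distrib_right)
    also have "\<dots> \<le> \<bar>\<Sum>k\<in>A. (deriv ^^ r) (ell \<alpha> k) t\<bar> * sqrt (weight \<alpha> t)"
    proof (rule mult_right_mono)
      show "(-1) ^ r * (\<Sum>k\<in>A. (deriv ^^ r) (ell \<alpha> k) t) \<le> \<bar>\<Sum>k\<in>A. (deriv ^^ r) (ell \<alpha> k) t\<bar>"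
        using abs_ge_self[of "(-1) ^ r * (\<Sum>k\<in>A. (deriv ^^ r) (ell \<alpha> k) t)"]
        by (simp add: abs_mult power_abs)
    qed simp
    finally have low: "c * 2 powr (- \<mu>) * real N powr (- \<kappa>) \<le> \<bar>rderiv r (F M) t\<bar> * sqrt (weight \<alpha> t)"
      using M by (simp add: R abs_mult mult.assoc)
    have opp: "rderiv r (F (- M)) t = - rderiv r (F M) t" by (simp add: R)
    have co: "coeffs_w \<alpha> (F (- M)) k = - coeffs_w \<alpha> (F M) k" for k by (simp add: cF)
    have "ennreal (\<bar>rderiv r (F M) t\<bar> * sqrt (weight \<alpha> t)) \<le> recovery_error \<alpha> r \<delta> (W_ball \<alpha> s \<mu>) \<psi> p" for \<psi>
      by (rule recovery_error_lower_bound[OF W W co small small t opp]) (use M in auto)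
    thus "ennreal (c * 2 powr (- \<mu>) * real N powr (- \<kappa>)) \<le> optimal_error \<alpha> r \<delta> (W_ball \<alpha> s \<mu>) p"
      unfolding optimal_error_def using low by (intro INF_greatest) (auto intro: order_trans[OF ennreal_leI])
  qed
qed

theorem corollary4p3:
  fixes \<alpha> \<mu> \<theta> :: real and r :: nat and s p :: ennreal
  assumes "\<alpha> \<ge> 0" and "r \<ge> 1" and "1 \<le> s" and "1 \<le> p"
    and "\<mu> > real r + 1 - recip s"
    and "\<theta> > 0" and "\<theta> > \<mu> + recip s - 1 - real r"
  shows "(\<exists>c' c''. 0 < c' \<and> c' \<le> c'' \<and>
            (\<forall>\<delta>. 0 < \<delta> \<and> \<delta> < 1 \<longrightarrow>
               ennreal (c' * \<delta> powr ((\<mu> + recip s - 1 - real r) / (\<mu> + recip s - recip p)))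
                 \<le> optimal_error \<alpha> r \<delta> (W_ball \<alpha> s \<mu>) p \<and>
               optimal_error \<alpha> r \<delta> (W_ball \<alpha> s \<mu>) p
                 \<le> ennreal (c'' * \<delta> powr ((\<mu> + recip s - 1 - real r) / (\<mu> + recip s - recip p)))))
       \<and> (\<forall>\<nu>\<in>S_class \<theta>. \<forall>a\<^sub>1 a\<^sub>2. 0 < a\<^sub>1 \<and> a\<^sub>1 \<le> a\<^sub>2 \<longrightarrow>
            (\<exists>c>0. \<forall>\<delta> N. 0 < \<delta> \<and> \<delta> < 1 \<and> r \<le> N \<and>
               a\<^sub>1 * \<delta> powr (- 1 / (\<mu> + recip s - recip p)) \<le> real N \<and>
               real N \<le> a\<^sub>2 * \<delta> powr (- 1 / (\<mu> + recip s - recip p)) \<longrightarrow>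
                 psi_S \<alpha> r \<nu> N \<in> recovery_ops p \<and>
                 recovery_error \<alpha> r \<delta> (W_ball \<alpha> s \<mu>) (psi_S \<alpha> r \<nu> N) p
                   \<le> ennreal (c * \<delta> powr ((\<mu> + recip s - 1 - real r) / (\<mu> + recip s - recip p)))))"
proof -
  define \<kappa> where "\<kappa> = \<mu> + recip s - 1 - real r"
  define d where "d = \<mu> + recip s - recip p"
  have \<kappa>: "0 < \<kappa>" "\<kappa> < \<theta>" using assms by (auto simp: \<kappa>_def)
  have d: "0 < d" using \<kappa> recip_bounds[OF assms(4)] by (simp add: \<kappa>_def d_def)
  note hyps = assms(1,2,3,4) \<kappa>_def \<kappa>(1)
  have upper: "\<exists>c>0. \<forall>\<delta> N. 0 < \<delta> \<and> \<delta> < 1 \<and> r \<le> N \<and> a1 * \<delta> powr (- 1 / d) \<le> real N \<and> real N \<le> a2 * \<delta> powr (- 1 / d) \<longrightarrow>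
       psi_S \<alpha> r \<nu> N \<in> recovery_ops p \<and>
       recovery_error \<alpha> r \<delta> (W_ball \<alpha> s \<mu>) (psi_S \<alpha> r \<nu> N) p \<le> ennreal (c * \<delta> powr (\<kappa> / d))"
    if \<nu>: "\<nu> \<in> S_class \<theta>" and a: "0 < a1 \<and> a1 \<le> a2" for \<nu> a1 a2
  proof -
    obtain c where "c > 0"
      "\<And>\<delta> N. 0 < \<delta> \<Longrightarrow> 1 \<le> N \<Longrightarrow> a1 * \<delta> powr (- 1 / d) \<le> real N \<Longrightarrow> real N \<le> a2 * \<delta> powr (- 1 / d) \<Longrightarrow>
         recovery_error \<alpha> r \<delta> (W_ball \<alpha> s \<mu>) (psi_S \<alpha> r \<nu> N) p \<le> ennreal (c * \<delta> powr (\<kappa> / d))"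
      using psi_S_recovery_error[OF hyps \<kappa>(2) d_def \<nu>, of a1 a2] a by blast
    thus ?thesis using assms(2) by (intro exI[of _ c]) (auto intro: psi_S_recovery_op)
  qed
  \<comment> \<open>A multiple of m is at least m. The witness is m times the ceiling of x =
    \<delta>^(-1/d), and \<delta> < 1 gives x \<ge> 1, so the ceiling is at most 2x.\<close>
  have exN: "\<exists>N. m \<le> N \<and> real m * \<delta> powr (- 1 / d) \<le> real N \<and> real N \<le> 2 * real m * \<delta> powr (- 1 / d)"
    if \<delta>: "0 < \<delta>" "\<delta> < 1" for m \<delta>
  proof -
    define x where "x = \<delta> powr (- 1 / d)"
    have "1 powr (- 1 / d) \<le> x" unfolding x_def using \<delta> d by (intro powr_mono2') auto
    hence x: "1 \<le> x" by simp
    define n where "n = nat \<lceil>x\<rceil>"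
    have n: "x \<le> real n" "real n \<le> 2 * x" using x by (auto simp: n_def) linarith+
    hence "1 \<le> n" using x by linarith
    have "real m * x \<le> real (m * n)" "real (m * n) \<le> 2 * real m * x"
      using n mult_left_mono[OF n(1), of "real m"] mult_left_mono[OF n(2), of "real m"] by auto
    moreover have "m \<le> m * n" using \<open>1 \<le> n\<close> by simp
    ultimately show ?thesis unfolding x_def by blast
  qed
  obtain c0 where c0: "c0 > 0"
    "\<And>N \<delta>. 2 * r \<le> N \<Longrightarrow> real N powr (- d) \<le> \<delta> \<Longrightarrow>
       ennreal (c0 * real N powr (- \<kappa>)) \<le> optimal_error \<alpha> r \<delta> (W_ball \<alpha> s \<mu>) p"
    using optimal_error_lower_bound[OF hyps d_def] by blast
  \<comment> \<open>The window for m = 2r ends at 4 r \<delta>^(-1/d), and N^(-\<kappa>) is smallest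
    there.\<close>
  define c1 where "c1 = c0 * (4 * real r) powr (- \<kappa>)"
  have c1: "c1 > 0" using c0 assms(2) by (simp add: c1_def)
  have lower: "ennreal (c1 * \<delta> powr (\<kappa> / d)) \<le> optimal_error \<alpha> r \<delta> (W_ball \<alpha> s \<mu>) p"
    if \<delta>: "0 < \<delta>" "\<delta> < 1" for \<delta>
  proof -
    obtain N where N: "2 * r \<le> N" "real (2 * r) * \<delta> powr (- 1 / d) \<le> real N" "real N \<le> 2 * real (2 * r) * \<delta> powr (- 1 / d)"
      using exN[OF \<delta>, of "2 * r"] by blast
    have "1 * \<delta> powr (- 1 / d) \<le> real (2 * r) * \<delta> powr (- 1 / d)"
      using assms(2) by (intro mult_right_mono) auto
    hence "\<delta> powr (- 1 / d) \<le> real N" using N by simp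
    hence "real N powr (- d) \<le> (\<delta> powr (- 1 / d)) powr (- d)"
      using \<delta> d by (intro powr_mono2') auto
    also have "\<dots> = \<delta>" using \<delta> d by (simp add: powr_powr)
    finally have N\<delta>: "real N powr (- d) \<le> \<delta>" .
    have "c1 * \<delta> powr (\<kappa> / d) = c0 * (4 * real r * \<delta> powr (- 1 / d)) powr (- \<kappa>)"
      using \<delta> assms(2) by (simp add: c1_def powr_mult powr_powr)
    also have "\<dots> \<le> c0 * real N powr (- \<kappa>)"
      using c0 N assms(2) \<kappa> by (intro mult_left_mono powr_mono2') auto
    finally show ?thesis using c0(2)[OF N(1) N\<delta>] by (auto intro: order_trans[OF ennreal_leI])
  qed
  \<comment> \<open>Plain partial sums belong to the class for every order, so the second claim
    supplies the upper half of the first.\<close>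
  have "(\<lambda>_ _. 1) \<in> S_class \<theta>" by (auto simp: S_class_def intro!: exI[of _ 1])
  from upper[OF this, of "real r" "2 * real r"] obtain c2 where c2: "c2 > 0"
    "\<And>\<delta> N. 0 < \<delta> \<Longrightarrow> \<delta> < 1 \<Longrightarrow> r \<le> N \<Longrightarrow> real r * \<delta> powr (- 1 / d) \<le> real N \<Longrightarrow> real N \<le> 2 * real r * \<delta> powr (- 1 / d) \<Longrightarrow>
       psi_S \<alpha> r (\<lambda>_ _. 1) N \<in> recovery_ops p \<and>
       recovery_error \<alpha> r \<delta> (W_ball \<alpha> s \<mu>) (psi_S \<alpha> r (\<lambda>_ _. 1) N) p \<le> ennreal (c2 * \<delta> powr (\<kappa> / d))"
    using assms(2) by auto
  \<comment> \<open>The maximum with c1 secures c' \<le> c'' directly.\<close>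
  have opt: "optimal_error \<alpha> r \<delta> (W_ball \<alpha> s \<mu>) p \<le> ennreal (max c1 c2 * \<delta> powr (\<kappa> / d))"
    if \<delta>: "0 < \<delta>" "\<delta> < 1" for \<delta>
  proof -
    obtain N where N: "r \<le> N" "real r * \<delta> powr (- 1 / d) \<le> real N" "real N \<le> 2 * real r * \<delta> powr (- 1 / d)"
      using exN[OF \<delta>, of r] by blast
    have "optimal_error \<alpha> r \<delta> (W_ball \<alpha> s \<mu>) p \<le> ennreal (c2 * \<delta> powr (\<kappa> / d))"
      unfolding optimal_error_def using c2(2)[OF \<delta> N] by (auto intro: INF_lower2)
    also have "\<dots> \<le> ennreal (max c1 c2 * \<delta> powr (\<kappa> / d))"
      by (intro ennreal_leI mult_right_mono) auto
    finally show ?thesis .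
  qed
  show ?thesis
    unfolding \<kappa>_def[symmetric] d_def[symmetric]
  proof (intro conjI ballI allI impI)
    show "\<exists>c' c''. 0 < c' \<and> c' \<le> c'' \<and> (\<forall>\<delta>. 0 < \<delta> \<and> \<delta> < 1 \<longrightarrow>
        ennreal (c' * \<delta> powr (\<kappa> / d)) \<le> optimal_error \<alpha> r \<delta> (W_ball \<alpha> s \<mu>) p \<and>
        optimal_error \<alpha> r \<delta> (W_ball \<alpha> s \<mu>) p \<le> ennreal (c'' * \<delta> powr (\<kappa> / d)))"
      using c1 lower opt by (intro exI[of _ c1] exI[of _ "max c1 c2"]) auto
  qed (rule upper)
qed

end
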